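(* Let $\varepsilon,\alpha\in(0,1)$, $d\ge2$, and $\kappa\ge1$. Any $\varepsilon$-differentially private algorithm that, given $n$ i.i.d. samples $\mathcal{X}=\{X_1,\dots,X_n\}$ from $\mathcal{N}(0,\Sigma)$ for an unknown $\Sigma\in\mathbb{R}^{d\times d}$ satisfying $I\preceq\Sigma\preceq\kappa I$, outputs $\widehat{\Sigma}=\widehat{\Sigma}(\mathcal{X})$ such that, with probability at least $0.9$, $$\mathrm{TV}\left(\mathcal{N}(0,\Sigma),\mathcal{N}(0,\widehat{\Sigma})\right)<O(\alpha),$$ must require $$n=\Omega\left(\frac{d^2}{\varepsilon}\log\left(\frac{d\kappa}{\alpha}\right)+\frac{d^2}{\varepsilon\alpha}\right).$$
   Context: An algorithm is $\varepsilon$-differentially private (pure DP) if for all pairs of datasets $x,x'$ differing in exactly one point and all measurable output sets $S$, $\Pr[\mathcal{M}(x)\in S]\le e^{\varepsilon}\Pr[\mathcal{M}(x')\in S]$. $\mathrm{TV}(P,Q)=\sup_S|P(S)-Q(S)|$ is total variation distance. The accuracy requirement is understood to hold for every $\Sigma$ in the stated class; $O(\alpha)$ denotes $c\alpha$ for a suitable (small) absolute constant $c$.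
   Formalization: The condition κ ≥ 1 is replaced by κ ≥ 1+α: for κ = 1 the only covariance is I, and the constant output I is private and exact for every n, so the claimed bound fails there. *)

theory Defs
  imports
    "HOL-Probability.Probability"
    "Jordan_Normal_Form.Matrix"
    "Jordan_Normal_Form.Determinant"
    "Jordan_Normal_Form.Gauss_Jordan_Elimination"
begin

text \<open>
  The constants hidden in the asymptotic notation are uniform in the dimension, so the dimension
  \<open>d\<close> is a natural number and not a type. Points of \<open>\<real>\<^sup>d\<close> are the functions in
  \<open>PiE {..<d} (\<lambda>_. UNIV)\<close>, as required by the product measure \<open>PiM\<close>; covariance matrices are
  elements of \<open>carrier_mat d d\<close>.
\<close>

definition lebesgue_vec :: "nat \<Rightarrow> (nat \<Rightarrow> real) measure" where
  "lebesgue_vec d = PiM {..<d} (\<lambda>_. lborel)"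

definition psd_mat :: "nat \<Rightarrow> real mat \<Rightarrow> bool" where
  "psd_mat d A \<longleftrightarrow> A \<in> carrier_mat d d \<and> A\<^sup>T = A \<and>
     (\<forall>v \<in> carrier_vec d. 0 \<le> scalar_prod v (A *\<^sub>v v))"

definition pd_mat :: "nat \<Rightarrow> real mat \<Rightarrow> bool" where
  "pd_mat d A \<longleftrightarrow> A \<in> carrier_mat d d \<and> A\<^sup>T = A \<and>
     (\<forall>v \<in> carrier_vec d. v \<noteq> 0\<^sub>v d \<longrightarrow> 0 < scalar_prod v (A *\<^sub>v v))"

definition loewner_le :: "nat \<Rightarrow> real mat \<Rightarrow> real mat \<Rightarrow> bool" where
  "loewner_le d A B \<longleftrightarrow> A \<in> carrier_mat d d \<and> B \<in> carrier_mat d d \<and> psd_mat d (B - A)"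

text \<open>
  \<open>N(0, A)\<close> through its Lebesgue density; only meaningful when \<open>A\<close> is positive definite.
\<close>

definition gaussian :: "nat \<Rightarrow> real mat \<Rightarrow> (nat \<Rightarrow> real) measure" where
  "gaussian d A = density (lebesgue_vec d)
     (\<lambda>x. ennreal (exp (- scalar_prod (Matrix.vec d x) (the (mat_inverse A) *\<^sub>v Matrix.vec d x) / 2)
                    / sqrt ((2 * pi) ^ d * Determinant.det A)))"

definition tv_dist :: "'a measure \<Rightarrow> 'a measure \<Rightarrow> real" where
  "tv_dist P Q = (SUP S \<in> sets P. \<bar>measure P S - measure Q S\<bar>)"

text \<open>
  Datasets of \<open>n\<close> points in \<open>\<real>\<^sup>d\<close>; of the outer product only the underlying
  \<open>\<sigma>\<close>-algebra is used.
\<close>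

definition dataset_space :: "nat \<Rightarrow> nat \<Rightarrow> (nat \<Rightarrow> nat \<Rightarrow> real) measure" where
  "dataset_space n d = PiM {..<n} (\<lambda>_. lebesgue_vec d)"

text \<open>The set of real \<open>d \<times> d\<close> matrices with the Borel \<open>\<sigma>\<close>-algebra, generated by the entries.\<close>

definition mat_borel :: "nat \<Rightarrow> real mat measure" where
  "mat_borel d = vimage_algebra (carrier_mat d d)
     (\<lambda>A. \<lambda>ij \<in> {..<d} \<times> {..<d}. A $$ ij) (PiM ({..<d} \<times> {..<d}) (\<lambda>_. borel))"

text \<open>A randomised estimator is a Markov kernel from datasets to matrices.\<close>

definition estimator :: "nat \<Rightarrow> nat \<Rightarrow> ((nat \<Rightarrow> nat \<Rightarrow> real) \<Rightarrow> real mat measure) \<Rightarrow> bool" where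
  "estimator n d M \<longleftrightarrow> M \<in> dataset_space n d \<rightarrow>\<^sub>M prob_algebra (mat_borel d)"

definition pure_dp ::
  "real \<Rightarrow> nat \<Rightarrow> nat \<Rightarrow> ((nat \<Rightarrow> nat \<Rightarrow> real) \<Rightarrow> real mat measure) \<Rightarrow> bool" where
  "pure_dp \<epsilon> n d M \<longleftrightarrow>
     (\<forall>x \<in> space (dataset_space n d). \<forall>x' \<in> space (dataset_space n d).
        card {i \<in> {..<n}. x i \<noteq> x' i} = 1 \<longrightarrow>
        (\<forall>S \<in> sets (mat_borel d). measure (M x) S \<le> exp \<epsilon> * measure (M x') S))"

text \<open>
  Distribution of the output on \<open>n\<close> i.i.d. samples from \<open>N(0, A)\<close>, over the samples and the
  randomness of the algorithm.
\<close>

definition output_dist ::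
  "nat \<Rightarrow> nat \<Rightarrow> ((nat \<Rightarrow> nat \<Rightarrow> real) \<Rightarrow> real mat measure) \<Rightarrow> real mat \<Rightarrow> real mat measure" where
  "output_dist n d M A = bind (PiM {..<n} (\<lambda>_. gaussian d A)) M"

text \<open>
  The outputs \<open>B\<close> with \<open>TV(N(0, A), N(0, B)) < \<delta>\<close>. An output that is not a covariance matrix is
  a failure. So is a singular one: then \<open>N(0, B)\<close> lives on a Lebesgue null set, and its
  distance to \<open>N(0, A)\<close> with \<open>A\<close> positive definite is 1.
\<close>

definition accurate_outputs :: "nat \<Rightarrow> real mat \<Rightarrow> real \<Rightarrow> real mat set" where
  "accurate_outputs d A \<delta> =
     {B \<in> carrier_mat d d. pd_mat d B \<and> tv_dist (gaussian d A) (gaussian d B) < \<delta>}"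

text \<open>
  The accuracy requirement ranges over all \<open>A\<close> with \<open>I \<preceq> A \<preceq> \<kappa> I\<close>. This class is \<open>{I}\<close> for \<open>\<kappa> = 1\<close>,
  and the constant estimator \<open>I\<close> is then private and exact for every \<open>n\<close>. A lower bound with
  absolute constants therefore needs \<open>\<kappa>\<close> to exceed 1 by a margin; the theorem uses \<open>1 + \<alpha> \<le> \<kappa>\<close>,
  which covers all \<open>\<kappa> \<ge> 2\<close>.
\<close>

definition accurate_estimator ::
  "nat \<Rightarrow> nat \<Rightarrow> ((nat \<Rightarrow> nat \<Rightarrow> real) \<Rightarrow> real mat measure) \<Rightarrow> real \<Rightarrow> real \<Rightarrow> bool" where
  "accurate_estimator n d M \<kappa> \<delta> \<longleftrightarrow>
     (\<forall>A \<in> carrier_mat d d. loewner_le d (1\<^sub>m d) A \<and> loewner_le d A (\<kappa> \<cdot>\<^sub>m 1\<^sub>m d) \<longrightarrow>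
        measure (output_dist n d M A) (accurate_outputs d A \<delta>) \<ge> 9 / 10)"

end

theory Submission
  imports Defs
begin

text \<open>
  A family of Gaussians with indices \<open>z\<close> is a packing if distinct members are further apart in total
  variation than twice the accuracy, so that the sets of accurate outputs are disjoint. If every
  member has density ratio \<open>r\<close> with respect to a common \<open>Q\<close> and \<open>\<integral>|r - 1| dQ \<le> D\<close>, then
  exchanging one sample of law \<open>Q\<close> for one of law \<open>r dQ\<close> changes the expectation of a private output
  probability by a factor of at most \<open>1 + D (e\<^sup>\<epsilon> - 1)\<close>: such a function varies by a factor \<open>e\<^sup>\<epsilon>\<close> at most
  in each sample. Summing over the packing gives \<open>0.9 N \<le> (1 + D (e\<^sup>\<epsilon> - 1))\<^sup>n\<close>, hence \<open>n D \<epsilon>\<close> is at least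
  of order \<open>ln N\<close>.

  The packings consist of linear regressions: the first \<open>d div 2\<close> coordinates \<open>u\<close> are independent
  normal variables of deviation \<open>a\<close>, and the others are \<open>B u\<close> plus independent noise of deviation
  \<open>b\<close>, where \<open>B\<close> is a scaled integer matrix from a code of Gilbert--Varshamov type. The distance of
  two such laws is of order \<open>min 1 (a |B - B'| / b)\<close> in the Frobenius norm. Entries of order \<open>\<alpha> / d\<close>
  with \<open>a\<close> and \<open>b\<close> near 1 keep \<open>D\<close> of order \<open>\<alpha>\<close> and give \<open>d\<^sup>2 / (\<epsilon> \<alpha>)\<close>. In the same regime, matrices
  with about \<open>d\<close> to the \<open>1/4\<close> levels per entry, selected by a fourth
  moment bound of the operator norm, give \<open>d\<^sup>2 ln d / \<epsilon>\<close>. Finally \<open>a\<^sup>2\<close> of order \<open>\<kappa>\<close> with \<open>b\<close> of order 1 leaves room for \<open>\<kappa>\<close> to the \<open>1/4\<close> levels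
  and gives \<open>d\<^sup>2 ln \<kappa> / \<epsilon>\<close>.
\<close>

section \<open>Change of measure for private kernels\<close>

text \<open>Both measures agree on rectangles, where Fubini's theorem factorises the integral of a
  product of functions of one coordinate each.\<close>

lemma PiM_density:
  assumes I: "finite I" and M: "\<And>i. i \<in> I \<Longrightarrow> sigma_finite_measure (M i)"
    and f [measurable]: "\<And>i. i \<in> I \<Longrightarrow> f i \<in> borel_measurable (M i)"
    and D: "\<And>i. i \<in> I \<Longrightarrow> prob_space (density (M i) (f i))"
  shows "PiM I (\<lambda>i. density (M i) (f i)) = density (PiM I M) (\<lambda>x. \<Prod>i\<in>I. f i (x i))"
proof -
  \<comment> \<open>\<open>product_sigma_finite\<close> speaks of all indices, the hypotheses only
    of those in \<open>I\<close>; elsewhere a one-point space with density 1 is put in.\<close>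
  define M' where "M' i = (if i \<in> I then M i else count_space {undefined})" for i
  define f' where "f' i = (if i \<in> I then f i else (\<lambda>_. 1))" for i
  have cnt: "finite_measure (count_space {undefined :: 'b})"
    by (rule finite_measure_count_space) simp
  interpret M: product_sigma_finite M'
    using M finite_measure.axioms(1)[OF cnt]
    by (auto simp: M'_def product_sigma_finite_def)
  have D': "sigma_finite_measure (density (M' i) (f' i))" for i
  proof (cases "i \<in> I")
    case True
    then show ?thesis
      using prob_space_imp_sigma_finite[OF D[OF True]] by (simp add: M'_def f'_def)
  next
    case False
    then show ?thesis
      using finite_measure.axioms(1)[OF cnt] by (simp add: M'_def f'_def density_1)
  qed
  interpret D: product_sigma_finite "\<lambda>i. density (M' i) (f' i)"
    using D' by (simp add: product_sigma_finite_def)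
  have [measurable]: "f' i \<in> borel_measurable (M' i)" for i
    using f by (simp add: f'_def M'_def)
  have "density (PiM I M') (\<lambda>x. \<Prod>i\<in>I. f' i (x i)) = PiM I (\<lambda>i. density (M' i) (f' i))"
  proof (rule D.PiM_eqI[OF I])
    show "sets (density (PiM I M') (\<lambda>x. \<Prod>i\<in>I. f' i (x i))) = sets (PiM I (\<lambda>i. density (M' i) (f' i)))"
      by (simp cong: sets_PiM_cong)
  next
    fix A assume A: "\<And>i. i \<in> I \<Longrightarrow> A i \<in> sets (density (M' i) (f' i))"
    then have A' [measurable]: "\<And>i. i \<in> I \<Longrightarrow> A i \<in> sets (M' i)" by simp
    have "emeasure (density (PiM I M') (\<lambda>x. \<Prod>i\<in>I. f' i (x i))) (Pi\<^sub>E I A)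
        = (\<integral>\<^sup>+x. (\<Prod>i\<in>I. f' i (x i)) * indicator (Pi\<^sub>E I A) x \<partial>PiM I M')"
      by (rule emeasure_density) (auto intro!: borel_measurable_prod_ennreal sets_PiM_I_finite I A')
    also have "\<dots> = (\<integral>\<^sup>+x. (\<Prod>i\<in>I. f' i (x i) * indicator (A i) (x i)) \<partial>PiM I M')"
    proof (rule nn_integral_cong)
      fix x assume "x \<in> space (PiM I M')"
      then have "x \<in> extensional I" by (auto simp: space_PiM PiE_def)
      then have "indicator (Pi\<^sub>E I A) x = (\<Prod>i\<in>I. indicator (A i) (x i) :: ennreal)"
        using I by (auto simp: indicator_def PiE_def Pi_def prod_zero_iff)
      then show "(\<Prod>i\<in>I. f' i (x i)) * indicator (Pi\<^sub>E I A) x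
          = (\<Prod>i\<in>I. f' i (x i) * indicator (A i) (x i))"
        by (simp add: prod.distrib)
    qed
    also have "\<dots> = (\<Prod>i\<in>I. \<integral>\<^sup>+y. f' i y * indicator (A i) y \<partial>M' i)"
      by (rule M.product_nn_integral_prod) (use I in auto)
    also have "\<dots> = (\<Prod>i\<in>I. emeasure (density (M' i) (f' i)) (A i))"
      by (intro prod.cong refl emeasure_density[symmetric]) auto
    finally show "emeasure (density (PiM I M') (\<lambda>x. \<Prod>i\<in>I. f' i (x i))) (Pi\<^sub>E I A)
        = (\<Prod>i\<in>I. emeasure (density (M' i) (f' i)) (A i))" .
  qed
  moreover have "PiM I M' = PiM I M" "PiM I (\<lambda>i. density (M' i) (f' i)) = PiM I (\<lambda>i. density (M i) (f i))"
    by (intro PiM_cong; simp add: M'_def f'_def)+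
  moreover have "(\<lambda>x. \<Prod>i\<in>I. f' i (x i)) = (\<lambda>x. \<Prod>i\<in>I. f i (x i))"
    by (simp add: f'_def)
  ultimately show ?thesis by simp
qed

text \<open>\<open>r - 1\<close> has integral 0 under \<open>Q\<close>, so \<open>h\<close> may be
  centred at its mean \<open>s\<close>: the two expectations differ by \<integral>(r - 1)(h - s) dQ.
  As \<open>h\<close> varies by a factor exp \<epsilon> at most, |h - s| is at most (exp \<epsilon>
  - 1) s, and the difference is at most D (exp \<epsilon> - 1) s.\<close>

lemma dp_change_of_measure_one:
  fixes r h :: "'a \<Rightarrow> real"
  assumes Q: "prob_space Q" and P: "prob_space (density Q (\<lambda>x. ennreal (r x)))"
    and r [measurable]: "r \<in> borel_measurable Q" and r0: "\<And>x. 0 \<le> r x"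
    and D: "(\<integral>x. \<bar>r x - 1\<bar> \<partial>Q) \<le> D"
    and h [measurable]: "h \<in> borel_measurable Q"
    and h01: "\<And>y. y \<in> space Q \<Longrightarrow> 0 \<le> h y \<and> h y \<le> 1"
    and nb: "\<And>y y'. y \<in> space Q \<Longrightarrow> y' \<in> space Q \<Longrightarrow> h y \<le> exp \<epsilon> * h y'"
    and \<epsilon>: "0 \<le> \<epsilon>"
  shows "(\<integral>y. h y \<partial>density Q (\<lambda>x. ennreal (r x))) \<le> (1 + D * (exp \<epsilon> - 1)) * (\<integral>y. h y \<partial>Q)"
proof -
  interpret Q: prob_space Q by fact
  define s where "s = (\<integral>y. h y \<partial>Q)"
  have s0: "0 \<le> s" unfolding s_def using h01 by (intro integral_nonneg_AE) auto
  have inth: "integrable Q h"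
    using h01 by (intro Q.integrable_const_bound[where B=1]) auto
  have "emeasure (density Q (\<lambda>x. ennreal (r x))) (space Q) = 1"
    using prob_space.emeasure_space_1[OF P] by simp
  then have er: "(\<integral>\<^sup>+x. ennreal (r x) \<partial>Q) = 1"
    by (simp add: emeasure_density cong: nn_integral_cong)
  have intr: "integrable Q r"
    using er r0 by (intro integrableI_nonneg) auto
  have ir: "(\<integral>x. r x \<partial>Q) = 1"
    using er r0 by (subst integral_eq_nn_integral) auto
  have hs: "\<bar>h y - s\<bar> \<le> (exp \<epsilon> - 1) * s" if y: "y \<in> space Q" for y
  proof -
    have "h y = (\<integral>y'. h y \<partial>Q)" by (simp add: Q.prob_space)
    also have "\<dots> \<le> (\<integral>y'. exp \<epsilon> * h y' \<partial>Q)"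
      using nb y inth by (intro integral_mono) auto
    also have "\<dots> = exp \<epsilon> * s" by (simp add: s_def)
    finally have 1: "h y \<le> exp \<epsilon> * s" .
    have "s \<le> (\<integral>y'. exp \<epsilon> * h y \<partial>Q)"
      unfolding s_def using nb y inth by (intro integral_mono) auto
    also have "\<dots> = exp \<epsilon> * h y" by (simp add: Q.prob_space)
    finally have 2: "s \<le> exp \<epsilon> * h y" .
    \<comment> \<open>A deviation below the mean is at first bounded through \<open>h y\<close>;
      since \<open>h y \<le> s\<close> in that case, \<open>s\<close> can take its place.\<close>
    have "s - h y \<le> (exp \<epsilon> - 1) * h y" using 2 by (simp add: algebra_simps)
    show ?thesis
    proof (cases "h y \<le> s")
      case True
      have "(exp \<epsilon> - 1) * h y \<le> (exp \<epsilon> - 1) * s"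
        using True \<epsilon> by (intro mult_left_mono) auto
      then show ?thesis using True \<open>s - h y \<le> _\<close> by auto
    next
      case False
      then show ?thesis using 1 by (simp add: algebra_simps)
    qed
  qed
  have i1: "integrable Q (\<lambda>y. r y * h y)"
    by (rule Bochner_Integration.integrable_bound[OF intr])
       (use h01 r0 in \<open>auto intro!: mult_left_le simp: abs_mult\<close>)
  have "(\<integral>y. h y \<partial>density Q (\<lambda>x. ennreal (r x))) = (\<integral>y. r y * h y \<partial>Q)"
    using r0 by (subst integral_density) auto
  also have "\<dots> = s + (\<integral>y. (r y - 1) * (h y - s) \<partial>Q)"
  proof -
    have "(\<lambda>y. (r y - 1) * (h y - s)) = (\<lambda>y. (r y * h y - h y) - (s * r y - s))"
      by (auto simp: algebra_simps)
    then show ?thesis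
      using i1 inth intr ir by (simp add: s_def Q.prob_space)
  qed
  also have "(\<integral>y. (r y - 1) * (h y - s) \<partial>Q) \<le> (\<integral>y. \<bar>r y - 1\<bar> * ((exp \<epsilon> - 1) * s) \<partial>Q)"
  proof (rule integral_mono_AE')
    show "integrable Q (\<lambda>y. \<bar>r y - 1\<bar> * ((exp \<epsilon> - 1) * s))" using intr by simp
    show "AE y in Q. (r y - 1) * (h y - s) \<le> \<bar>r y - 1\<bar> * ((exp \<epsilon> - 1) * s)"
    proof (rule AE_I2)
      fix y assume "y \<in> space Q"
      have "(r y - 1) * (h y - s) \<le> \<bar>r y - 1\<bar> * \<bar>h y - s\<bar>" by (metis abs_ge_self abs_mult)
      also have "\<dots> \<le> \<bar>r y - 1\<bar> * ((exp \<epsilon> - 1) * s)"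
        using hs[OF \<open>y \<in> space Q\<close>] by (intro mult_left_mono) auto
      finally show "(r y - 1) * (h y - s) \<le> \<bar>r y - 1\<bar> * ((exp \<epsilon> - 1) * s)" .
    qed
    show "AE y in Q. 0 \<le> \<bar>r y - 1\<bar> * ((exp \<epsilon> - 1) * s)" using \<epsilon> s0 by auto
  qed
  also have "\<dots> = (\<integral>y. \<bar>r y - 1\<bar> \<partial>Q) * ((exp \<epsilon> - 1) * s)" by simp
  also have "\<dots> \<le> D * ((exp \<epsilon> - 1) * s)"
    using D \<epsilon> s0 by (intro mult_right_mono) auto
  finally show ?thesis by (simp add: s_def algebra_simps)
qed

text \<open>Samples are exchanged one at a time. Each exchange costs the factor
  \<open>1 + D * (exp \<epsilon> - 1)\<close>, whose excess over 1 is proportional to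
  \<open>D\<close>, whereas privacy alone would cost exp \<epsilon> per sample.\<close>

lemma dp_change_of_measure:
  fixes r :: "'a \<Rightarrow> real" and f :: "('i \<Rightarrow> 'a) \<Rightarrow> real"
  assumes Q: "prob_space Q" and P: "prob_space (density Q (\<lambda>x. ennreal (r x)))"
    and r [measurable]: "r \<in> borel_measurable Q" and r0: "\<And>x. 0 \<le> r x"
    and D: "(\<integral>x. \<bar>r x - 1\<bar> \<partial>Q) \<le> D" and D0: "0 \<le> D" and \<epsilon>: "0 \<le> \<epsilon>"
    and I: "finite I" and f: "f \<in> borel_measurable (PiM I (\<lambda>_. Q))"
    and f01: "\<And>x. x \<in> space (PiM I (\<lambda>_. Q)) \<Longrightarrow> 0 \<le> f x \<and> f x \<le> 1"
    and nb: "\<And>x i y. x \<in> space (PiM I (\<lambda>_. Q)) \<Longrightarrow> i \<in> I \<Longrightarrow> y \<in> space Q \<Longrightarrow> f x \<le> exp \<epsilon> * f (x(i := y))"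
  shows "(\<integral>x. f x \<partial>PiM I (\<lambda>_. density Q (\<lambda>x. ennreal (r x))))
      \<le> (1 + D * (exp \<epsilon> - 1)) ^ card I * (\<integral>x. f x \<partial>PiM I (\<lambda>_. Q))"
  using I f f01 nb
proof (induction I arbitrary: f rule: finite_induct)
  case empty
  then show ?case
    by (simp add: PiM_empty)
next
  case (insert i I)
  let ?P = "density Q (\<lambda>x. ennreal (r x))"
  let ?K = "1 + D * (exp \<epsilon> - 1)"
  interpret Q: prob_space Q by fact
  interpret P: prob_space ?P by fact
  interpret QI: product_prob_space "\<lambda>_. Q" I by unfold_locales
  interpret PI: product_prob_space "\<lambda>_. ?P" I by unfold_locales
  interpret QJ: product_prob_space "\<lambda>_. Q" "insert i I" by unfold_locales
  interpret PJ: product_prob_space "\<lambda>_. ?P" "insert i I" by unfold_locales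
  have K: "0 \<le> ?K" using D0 \<epsilon> by (simp add: add_nonneg_nonneg)
  have setsP: "sets (PiM J (\<lambda>_. ?P)) = sets (PiM J (\<lambda>_. Q))" for J :: "'i set"
    by (rule sets_PiM_cong) auto
  have spP: "space (PiM J (\<lambda>_. ?P)) = space (PiM J (\<lambda>_. Q))" for J :: "'i set"
    by (rule sets_eq_imp_space_eq[OF setsP])
  have fm [measurable]: "f \<in> borel_measurable (PiM (insert i I) (\<lambda>_. Q))" by fact
  have fmP: "f \<in> borel_measurable (PiM (insert i I) (\<lambda>_. ?P))"
    using fm measurable_cong_sets[OF setsP refl] by blast
  \<comment> \<open>In the induction the new sample \<open>i\<close> is integrated out under
    \<open>Q\<close>, and the hypothesis is applied to the resulting function of the others.\<close>
  define g where "g x = (\<integral>y. f (x(i := y)) \<partial>Q)" for x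
  have [measurable]: "(\<lambda>(x, y). f (x(i := y))) \<in> borel_measurable (PiM I (\<lambda>_. Q) \<Otimes>\<^sub>M Q)"
    by measurable
  have upd: "x(i := y) \<in> space (PiM (insert i I) (\<lambda>_. Q))"
    if "x \<in> space (PiM I (\<lambda>_. Q))" "y \<in> space Q" for x y
    using that by (auto simp: space_PiM PiE_def Pi_def extensional_def)
  have gm: "g \<in> borel_measurable (PiM I (\<lambda>_. Q))"
    unfolding g_def by measurable
  have sl: "(\<lambda>y. f (x(i := y))) \<in> borel_measurable Q" if "x \<in> space (PiM I (\<lambda>_. Q))" for x
  proof -
    have "(\<lambda>y. (x, y)) \<in> Q \<rightarrow>\<^sub>M PiM I (\<lambda>_. Q) \<Otimes>\<^sub>M Q" using that by measurable
    from measurable_compose[OF this \<open>(\<lambda>(x, y). f (x(i := y))) \<in> _\<close>] show ?thesis by simp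
  qed
  have sli: "integrable Q (\<lambda>y. f (x(i := y)))" if "x \<in> space (PiM I (\<lambda>_. Q))" for x
    using sl[OF that] insert.prems(2)[OF upd[OF that]]
    by (intro Q.integrable_const_bound[where B=1] AE_I2) (auto simp del: fun_upd_apply)
  have g01: "0 \<le> g x \<and> g x \<le> 1" if "x \<in> space (PiM I (\<lambda>_. Q))" for x
  proof
    show "0 \<le> g x" unfolding g_def
      using insert.prems(2)[OF upd[OF that]]
      by (intro integral_nonneg_AE AE_I2) (auto simp del: fun_upd_apply)
    have "g x \<le> (\<integral>y. 1 \<partial>Q)" unfolding g_def
      using insert.prems(2)[OF upd[OF that]] sli[OF that]
      by (intro integral_mono) (auto simp del: fun_upd_apply)
    then show "g x \<le> 1" by (simp add: Q.prob_space)
  qed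
  have "(\<integral>x. f x \<partial>PiM (insert i I) (\<lambda>_. ?P)) = (\<integral>x. (\<integral>y. f (x(i := y)) \<partial>?P) \<partial>PiM I (\<lambda>_. ?P))"
  proof (rule PI.product_integral_insert)
    show "integrable (PiM (insert i I) (\<lambda>_. ?P)) f"
      using fmP insert.prems(2) spP
      by (intro PJ.integrable_const_bound[where B=1]) auto
  qed (use insert in auto)
  also have "\<dots> \<le> (\<integral>x. ?K * g x \<partial>PiM I (\<lambda>_. ?P))"
  proof (rule integral_mono_AE')
    have "integrable (PiM I (\<lambda>_. ?P)) g"
      using gm g01 spP measurable_cong_sets[OF setsP refl]
      by (intro PI.integrable_const_bound[where B=1]) auto
    then show "integrable (PiM I (\<lambda>_. ?P)) (\<lambda>x. ?K * g x)" by simp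
    show "AE x in PiM I (\<lambda>_. ?P). (\<integral>y. f (x(i := y)) \<partial>?P) \<le> ?K * g x"
    proof (rule AE_I2)
      fix x assume "x \<in> space (PiM I (\<lambda>_. ?P))"
      then have x: "x \<in> space (PiM I (\<lambda>_. Q))" using spP by simp
      show "(\<integral>y. f (x(i := y)) \<partial>?P) \<le> ?K * g x"
        unfolding g_def
      proof (rule dp_change_of_measure_one[OF Q P r r0 D sl[OF x] _ _ \<epsilon>])
        fix y assume y: "y \<in> space Q"
        show "0 \<le> f (x(i := y)) \<and> f (x(i := y)) \<le> 1" using insert.prems(2)[OF upd[OF x y]] .
        fix y' assume y': "y' \<in> space Q"
        show "f (x(i := y)) \<le> exp \<epsilon> * f (x(i := y'))"
          using insert.prems(3)[OF upd[OF x y] _ y', of i] by (simp del: fun_upd_apply)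
      qed
    qed
    show "AE x in PiM I (\<lambda>_. ?P). 0 \<le> ?K * g x"
      using K g01 spP by (intro AE_I2 mult_nonneg_nonneg) auto
  qed
  also have "\<dots> = ?K * (\<integral>x. g x \<partial>PiM I (\<lambda>_. ?P))" by simp
  also have "(\<integral>x. g x \<partial>PiM I (\<lambda>_. ?P)) \<le> ?K ^ card I * (\<integral>x. g x \<partial>PiM I (\<lambda>_. Q))"
  proof (rule insert.IH[OF gm g01])
    \<comment> \<open>Averaging over sample \<open>i\<close> preserves the privacy inequality in
      every other sample \<open>j\<close>.\<close>
    fix x j z assume x: "x \<in> space (PiM I (\<lambda>_. Q))" and j: "j \<in> I" and z: "z \<in> space Q"
    have x': "x(j := z) \<in> space (PiM I (\<lambda>_. Q))"
      using x j z by (auto simp: space_PiM PiE_def Pi_def extensional_def)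
    have "g x \<le> (\<integral>y. exp \<epsilon> * f ((x(j := z))(i := y)) \<partial>Q)"
      unfolding g_def
    proof (rule integral_mono[OF sli[OF x]])
      show "integrable Q (\<lambda>y. exp \<epsilon> * f (x(j := z, i := y)))" using sli[OF x'] by simp
      fix y assume "y \<in> space Q"
      then show "f (x(i := y)) \<le> exp \<epsilon> * f (x(j := z, i := y))"
        using insert.prems(3)[OF upd[OF x] _ z, of y j] j \<open>i \<notin> I\<close>
        by (metis fun_upd_twist insertCI)
    qed
    then show "g x \<le> exp \<epsilon> * g (x(j := z))" by (simp add: g_def)
  qed
  also have "(\<integral>x. g x \<partial>PiM I (\<lambda>_. Q)) = (\<integral>x. f x \<partial>PiM (insert i I) (\<lambda>_. Q))"
    unfolding g_def
  proof (rule QI.product_integral_insert[symmetric])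
    show "integrable (PiM (insert i I) (\<lambda>_. Q)) f"
      using fm insert.prems(2)
      by (intro QJ.integrable_const_bound[where B=1]) auto
  qed (use insert in auto)
  finally show ?case
    using K insert.hyps by (simp add: mult_left_mono mult.assoc)
qed

section \<open>Packings and matrix codes\<close>

text \<open>Under \<open>n\<close> samples of the common law \<open>Q\<close> the disjoint events
  \<open>G i\<close> have probabilities of sum at most 1, while the change of measure bounds each of
  them below by \<open>p\<close> divided by the same factor.\<close>

lemma dp_packing:
  fixes r :: "'i \<Rightarrow> (nat \<Rightarrow> real) \<Rightarrow> real"
  assumes est: "estimator n d M" and dp: "pure_dp \<epsilon> n d M" and \<epsilon>: "0 \<le> \<epsilon>"
    and Q: "prob_space Q" and sQ: "sets Q = sets (lebesgue_vec d)"
    and C: "finite C" and D0: "0 \<le> D"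
    and r: "\<And>i. i \<in> C \<Longrightarrow> r i \<in> borel_measurable Q" and r0: "\<And>i x. i \<in> C \<Longrightarrow> 0 \<le> r i x"
    and A: "\<And>i. i \<in> C \<Longrightarrow> gaussian d (A i) = density Q (\<lambda>x. ennreal (r i x))"
    and P: "\<And>i. i \<in> C \<Longrightarrow> prob_space (gaussian d (A i))"
    and D: "\<And>i. i \<in> C \<Longrightarrow> (\<integral>x. \<bar>r i x - 1\<bar> \<partial>Q) \<le> D"
    and G: "\<And>i. i \<in> C \<Longrightarrow> G i \<in> sets (mat_borel d)" and disj: "disjoint_family_on G C"
    and acc: "\<And>i. i \<in> C \<Longrightarrow> p \<le> measure (output_dist n d M (A i)) (G i)"
  shows "p * real (card C) \<le> (1 + D * (exp \<epsilon> - 1)) ^ n"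
proof -
  let ?K = "(1 + D * (exp \<epsilon> - 1)) ^ n"
  interpret Q: prob_space Q by fact
  interpret Qn: product_prob_space "\<lambda>_. Q" "{..<n}" by unfold_locales
  have setsQn: "sets (PiM {..<n} (\<lambda>_. Q)) = sets (dataset_space n d)"
    unfolding dataset_space_def by (rule sets_PiM_cong) (use sQ in auto)
  have spaceQn: "space (PiM {..<n} (\<lambda>_. Q)) = space (dataset_space n d)"
    by (rule sets_eq_imp_space_eq[OF setsQn])
  have M: "M \<in> dataset_space n d \<rightarrow>\<^sub>M subprob_algebra (mat_borel d)"
    using est unfolding estimator_def by (rule measurable_prob_algebraD)
  have prM: "prob_space (M x)" "sets (M x) = sets (mat_borel d)" if "x \<in> space (dataset_space n d)" for x
    using measurable_space[OF est[unfolded estimator_def] that] by (auto simp: space_prob_algebra)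
  define f where "f S x = measure (M x) S" for S x
  have fm: "f S \<in> borel_measurable (PiM {..<n} (\<lambda>_. Q))" if "S \<in> sets (mat_borel d)" for S
  proof -
    have "f S \<in> borel_measurable (dataset_space n d)"
      unfolding f_def by (rule measurable_compose[OF M measurable_measure_subprob_algebra[OF that]])
    then show ?thesis using measurable_cong_sets[OF setsQn refl] by blast
  qed
  have f01: "0 \<le> f S x \<and> f S x \<le> 1" if "x \<in> space (PiM {..<n} (\<lambda>_. Q))" for S x
    using prob_space.prob_le_1[OF prM(1)] that spaceQn by (simp add: f_def)
  have nb: "f S x \<le> exp \<epsilon> * f S (x(i := y))"
    if S: "S \<in> sets (mat_borel d)" and x: "x \<in> space (PiM {..<n} (\<lambda>_. Q))" and i: "i \<in> {..<n}" and y: "y \<in> space Q"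
    for S x i y
  \<comment> \<open>\<open>pure_dp\<close> compares datasets that differ in exactly one place; an
    update that changes nothing is covered by 1 \<le> exp \<epsilon>.\<close>
  proof (cases "x i = y")
    case True
    have "f S x \<le> exp \<epsilon> * f S x"
      using mult_right_mono[of 1 "exp \<epsilon>" "f S x"] f01[OF x, of S] \<epsilon> by simp
    then show ?thesis using True by auto
  next
    case False
    have x': "x(i := y) \<in> space (PiM {..<n} (\<lambda>_. Q))"
      using x i y by (auto simp: space_PiM PiE_def Pi_def extensional_def)
    have eq: "{j \<in> {..<n}. x j \<noteq> (x(i := y)) j} = {i}" using False i by auto
    have "card {j \<in> {..<n}. x j \<noteq> (x(i := y)) j} = 1" unfolding eq by simp
    then show ?thesis
      using dp x x' S unfolding pure_dp_def f_def spaceQn by blast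
  qed
  have out: "measure (output_dist n d M (A i)) S = (\<integral>x. f S x \<partial>PiM {..<n} (\<lambda>_. gaussian d (A i)))"
    if i: "i \<in> C" and S: "S \<in> sets (mat_borel d)" for i S
  proof -
    interpret P: prob_space "gaussian d (A i)" by (rule P[OF i])
    interpret Pn: product_prob_space "\<lambda>_. gaussian d (A i)" "{..<n}" by unfold_locales
    have "sets (PiM {..<n} (\<lambda>_. gaussian d (A i))) = sets (dataset_space n d)"
      unfolding dataset_space_def by (rule sets_PiM_cong) (auto simp: gaussian_def)
    then have "M \<in> PiM {..<n} (\<lambda>_. gaussian d (A i)) \<rightarrow>\<^sub>M subprob_algebra (mat_borel d)"
      using M measurable_cong_sets by blast
    then show ?thesis
      unfolding output_dist_def f_def using S by (rule Pn.measure_bind)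
  qed
  have *: "p \<le> ?K * (\<integral>x. f (G i) x \<partial>PiM {..<n} (\<lambda>_. Q))" if i: "i \<in> C" for i
  proof -
    have "p \<le> (\<integral>x. f (G i) x \<partial>PiM {..<n} (\<lambda>_. density Q (\<lambda>x. ennreal (r i x))))"
      using acc[OF i] out[OF i G[OF i]] A[OF i] by simp
    also have "\<dots> \<le> (1 + D * (exp \<epsilon> - 1)) ^ card {..<n} * (\<integral>x. f (G i) x \<partial>PiM {..<n} (\<lambda>_. Q))"
    proof (rule dp_change_of_measure[OF Q _ r[OF i] r0[OF i] D[OF i] D0 \<epsilon>])
      show "prob_space (density Q (\<lambda>x. ennreal (r i x)))" using P[OF i] A[OF i] by simp
    qed (use fm[OF G[OF i]] f01 nb[OF G[OF i]] in auto)
    finally show ?thesis by simp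
  qed
  have fi: "integrable (PiM {..<n} (\<lambda>_. Q)) (f (G i))" if "i \<in> C" for i
    using fm[OF G[OF that]] f01 by (intro Qn.integrable_const_bound[where B=1]) auto
  have "p * real (card C) = (\<Sum>i\<in>C. p)" by simp
  also have "\<dots> \<le> (\<Sum>i\<in>C. ?K * (\<integral>x. f (G i) x \<partial>PiM {..<n} (\<lambda>_. Q)))"
    by (intro sum_mono *)
  also have "\<dots> = ?K * (\<integral>x. (\<Sum>i\<in>C. f (G i) x) \<partial>PiM {..<n} (\<lambda>_. Q))"
    using fi by (simp add: sum_distrib_left)
  also have "\<dots> \<le> ?K * (\<integral>x. 1 \<partial>PiM {..<n} (\<lambda>_. Q))"
  proof (intro mult_left_mono integral_mono)
    show "integrable (PiM {..<n} (\<lambda>_. Q)) (\<lambda>x. \<Sum>i\<in>C. f (G i) x)" using fi by simp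
    fix x assume "x \<in> space (PiM {..<n} (\<lambda>_. Q))"
    then have x: "x \<in> space (dataset_space n d)" using spaceQn by simp
    interpret Mx: prob_space "M x" by (rule prM[OF x])
    have "(\<Sum>i\<in>C. f (G i) x) = measure (M x) (\<Union>i\<in>C. G i)"
      unfolding f_def using G prM[OF x] disj C
      by (intro Mx.finite_measure_finite_Union[symmetric]) auto
    also have "\<dots> \<le> 1" by simp
    finally show "(\<Sum>i\<in>C. f (G i) x) \<le> 1" .
  qed (use D0 \<epsilon> in \<open>auto intro!: add_nonneg_nonneg\<close>)
  also have "\<dots> = ?K" using prob_space.prob_space[OF Qn.prob_space_axioms] by simp
  finally show ?thesis .
qed

text \<open>A subset of \<open>Q\<close> that is maximal among those with pairwise distances of at
  least a quarter of the length covers \<open>Q\<close> by Hamming balls. The volume of a ball is at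
  most the number of sets of positions times \<open>q ^ (card I div 4)\<close> choices of letters
  there. Restricting to \<open>Q\<close> lets the code words share a further property, at the price
  of a factor 2.\<close>

lemma gv_code:
  fixes A :: "'a set" and I :: "'i set"
  assumes I: "finite I" and A: "finite A" "card A = q" "A \<noteq> {}"
    and Q: "Q \<subseteq> Pi\<^sub>E I (\<lambda>_. A)" and cQ: "q ^ card I \<le> 2 * card Q"
  shows "\<exists>C \<subseteq> Q. (\<forall>x\<in>C. \<forall>y\<in>C. x \<noteq> y \<longrightarrow> card I \<le> 4 * card {i \<in> I. x i \<noteq> y i}) \<and>
     q ^ card I \<le> 2 * (card C * (2 ^ card I * q ^ (card I div 4)))"
proof -
  let ?W = "Pi\<^sub>E I (\<lambda>_. A)"
  let ?N = "card I"
  have finW: "finite ?W" using I A by (intro finite_PiE) auto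
  have finQ: "finite Q" using finite_subset[OF Q finW] .
  have q1: "1 \<le> q" using A by (metis One_nat_def Suc_leI card_gt_0_iff)
  define good where "good C \<longleftrightarrow> C \<subseteq> Q \<and> (\<forall>x\<in>C. \<forall>y\<in>C. x \<noteq> y \<longrightarrow> ?N \<le> 4 * card {i \<in> I. x i \<noteq> y i})" for C
  have "good {}" by (simp add: good_def)
  moreover have "\<forall>C. good C \<longrightarrow> card C < Suc (card Q)"
    using card_mono[OF finQ] by (auto simp: good_def less_Suc_eq_le)
  ultimately obtain C where gC: "good C" and max: "\<And>C'. good C' \<Longrightarrow> card C' \<le> card C"
    using ex_has_greatest_nat[of good "{}" card "Suc (card Q)"] by auto
  have finC: "finite C" using gC finQ finite_subset by (auto simp: good_def)
  define ball where "ball c = {y \<in> ?W. card {i \<in> I. c i \<noteq> y i} \<le> ?N div 4}" for c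
  have cover: "Q \<subseteq> (\<Union>c\<in>C. ball c)"
  proof
    fix y assume y: "y \<in> Q"
    show "y \<in> (\<Union>c\<in>C. ball c)"
    proof (rule ccontr)
      assume n: "y \<notin> (\<Union>c\<in>C. ball c)"
      \<comment> \<open>A word outside the ball has more than \<open>?N div 4\<close> disagreements,
        and the strict inequality makes up for the rounding.\<close>
      have far: "?N \<le> 4 * card {i \<in> I. c i \<noteq> y i}" if "c \<in> C" for c
      proof -
        have "?N div 4 < card {i \<in> I. c i \<noteq> y i}" using n that y Q by (auto simp: ball_def not_le)
        then show ?thesis by linarith
      qed
      have far': "?N \<le> 4 * card {i \<in> I. y i \<noteq> c i}" if "c \<in> C" for c
        using far[OF that] by (simp add: eq_commute)
      have "good (insert y C)"
        using gC y far far' by (auto simp: good_def)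
      from max[OF this] have "y \<in> C" using finC by (cases "y \<in> C") auto
      then show False using n y Q by (auto simp: ball_def)
    qed
  qed
  have cball: "card (ball c) \<le> 2 ^ ?N * q ^ (?N div 4)" if c: "c \<in> C" for c
  proof -
    let ?S = "{S. S \<subseteq> I \<and> card S \<le> ?N div 4}"
    have finS: "finite ?S" using I by auto
    \<comment> \<open>The ball is sorted by the exact set \<open>S\<close> of disagreements with
      \<open>c\<close>. Given \<open>S\<close>, a word is determined by its letters on
      \<open>S\<close>, since it equals \<open>c\<close> elsewhere.\<close>
    have "ball c \<subseteq> (\<Union>S\<in>?S. {y \<in> ?W. {i \<in> I. c i \<noteq> y i} = S})"
    proof
      fix y assume "y \<in> ball c"
      then have "y \<in> ?W" "card {i \<in> I. c i \<noteq> y i} \<le> ?N div 4" by (auto simp: ball_def)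
      then show "y \<in> (\<Union>S\<in>?S. {y \<in> ?W. {i \<in> I. c i \<noteq> y i} = S})" by auto
    qed
    then have "card (ball c) \<le> card (\<Union>S\<in>?S. {y \<in> ?W. {i \<in> I. c i \<noteq> y i} = S})"
      using finS finW by (intro card_mono) auto
    also have "\<dots> \<le> (\<Sum>S\<in>?S. card {y \<in> ?W. {i \<in> I. c i \<noteq> y i} = S})"
      by (rule card_UN_le[OF finS])
    also have "\<dots> \<le> (\<Sum>S\<in>?S. q ^ (?N div 4))"
    proof (rule sum_mono)
      fix S assume S: "S \<in> ?S"
      have finS': "finite S" using S I finite_subset by auto
      have "card {y \<in> ?W. {i \<in> I. c i \<noteq> y i} = S} \<le> card (Pi\<^sub>E S (\<lambda>_. A))"
      proof (rule card_inj_on_le[where f = "\<lambda>y. restrict y S"])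
        show "inj_on (\<lambda>y. restrict y S) {y \<in> ?W. {i \<in> I. c i \<noteq> y i} = S}"
        proof (rule inj_onI)
          fix y z assume y: "y \<in> {y \<in> ?W. {i \<in> I. c i \<noteq> y i} = S}" and z: "z \<in> {y \<in> ?W. {i \<in> I. c i \<noteq> y i} = S}"
            and e: "restrict y S = restrict z S"
          show "y = z"
          proof (rule PiE_ext[where k = I and s = "\<lambda>_. A"])
            fix i assume i: "i \<in> I"
            show "y i = z i"
            proof (cases "i \<in> S")
              case True then show ?thesis using fun_cong[OF e, of i] by simp
            next
              case False then show ?thesis using y z i by auto
            qed
          qed (use y z in auto)
        qed
        show "(\<lambda>y. restrict y S) ` {y \<in> ?W. {i \<in> I. c i \<noteq> y i} = S} \<subseteq> Pi\<^sub>E S (\<lambda>_. A)"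
          using S by (auto simp: PiE_def Pi_def)
        show "finite (Pi\<^sub>E S (\<lambda>_. A))" using finS' A by (intro finite_PiE) auto
      qed
      also have "\<dots> = q ^ card S" using finS' A by (simp add: card_PiE)
      also have "\<dots> \<le> q ^ (?N div 4)" using S q1 by (intro power_increasing) auto
      finally show "card {y \<in> ?W. {i \<in> I. c i \<noteq> y i} = S} \<le> q ^ (?N div 4)" .
    qed
    also have "\<dots> = card ?S * q ^ (?N div 4)" by simp
    also have "card ?S \<le> card (Pow I)" using I by (intro card_mono) auto
    also have "card (Pow I) = 2 ^ ?N" using I by (simp add: card_Pow)
    finally show ?thesis by simp
  qed
  have "card Q \<le> card (\<Union>c\<in>C. ball c)"
    using cover finC finW by (intro card_mono) (auto simp: ball_def)
  also have "\<dots> \<le> (\<Sum>c\<in>C. card (ball c))" by (rule card_UN_le[OF finC])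
  also have "\<dots> \<le> card C * (2 ^ ?N * q ^ (?N div 4))"
    using sum_bounded_above[of C "\<lambda>c. card (ball c)"] cball by simp
  finally have "q ^ ?N \<le> 2 * (card C * (2 ^ ?N * q ^ (?N div 4)))" using cQ by linarith
  then show ?thesis using gC unfolding good_def by (intro exI[of _ C]) simp
qed


text \<open>The summand is the squared Frobenius norm of z z^T, which dominates the fourth power of
  the operator norm of \<open>z\<close>. The at most \<open>D\<close> diagonal entries contribute up
  to \<open>D^2 L^4\<close> each. An off-diagonal entry is a sum of at most \<open>D\<close>
  products of independent symmetric variables; in the mean of its square only the squares survive,
  which is at most \<open>D L^4\<close>. A trivial bound would have \<open>D^4\<close> in place of
  \<open>D^3\<close>.\<close>

lemma sum_gram_squares_le:
  fixes L :: nat and U V :: "nat set"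
  defines "W \<equiv> Pi\<^sub>E (V \<times> U) (\<lambda>_. {- int L..int L})"
  assumes U: "finite U" "card U \<le> D" and V: "finite V" "card V \<le> D"
  shows "(\<Sum>z\<in>W. \<Sum>j\<in>V. \<Sum>k\<in>V. (\<Sum>i\<in>U. z (j, i) * z (k, i))\<^sup>2) \<le> int (card W) * (2 * int D ^ 3 * int L ^ 4)"
proof -
  have zb: "\<bar>z (j, i)\<bar> \<le> int L" if "z \<in> W" "j \<in> V" "i \<in> U" for z j i
    using that PiE_mem[of z "V \<times> U" "\<lambda>_. {- int L..int L}" "(j, i)"]
    unfolding W_def by (simp add: abs_le_iff)
  have prod2: "\<bar>z (j, i) * z (k, i)\<bar> \<le> int L ^ 2" if "z \<in> W" "j \<in> V" "k \<in> V" "i \<in> U" for z j k i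
    unfolding abs_mult power2_eq_square using that by (intro mult_mono zb) auto
  have diag: "(\<Sum>z\<in>W. (\<Sum>i\<in>U. z (j, i) * z (j, i))\<^sup>2) \<le> int (card W) * (int D ^ 2 * int L ^ 4)"
    if j: "j \<in> V" for j
  proof -
    have "(\<Sum>i\<in>U. z (j, i) * z (j, i))\<^sup>2 \<le> int D ^ 2 * int L ^ 4" if z: "z \<in> W" for z
    proof -
      have "(\<Sum>i\<in>U. z (j, i) * z (j, i)) \<le> (\<Sum>i\<in>U. int L ^ 2)"
        using prod2[OF z j j] by (intro sum_mono) (meson abs_le_D1)
      also have "\<dots> \<le> int D * int L ^ 2" using U by (simp add: mult_right_mono)
      finally have "(\<Sum>i\<in>U. z (j, i) * z (j, i))\<^sup>2 \<le> (int D * int L ^ 2)\<^sup>2"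
        by (intro power_mono sum_nonneg) auto
      then show ?thesis by (simp add: power_mult_distrib flip: power_mult)
    qed
    then show ?thesis by (rule sum_bounded_above)
  qed
  have off: "(\<Sum>z\<in>W. (\<Sum>i\<in>U. z (j, i) * z (k, i))\<^sup>2) \<le> int (card W) * (int D * int L ^ 4)"
    if j: "j \<in> V" and k: "k \<in> V" and jk: "j \<noteq> k" for j k
  proof -
    \<comment> \<open>Changing the sign of the entry \<open>(j, i)\<close> is an involution of
      \<open>W\<close>. That entry occurs exactly once in the summand because
      \<open>j \<noteq> k\<close> and \<open>i \<noteq> i'\<close>, so the sum equals its
      negative.\<close>
    have cross: "(\<Sum>z\<in>W. z (j, i) * z (k, i) * (z (j, i') * z (k, i'))) = 0"
      if i: "i \<in> U" "i' \<in> U" "i \<noteq> i'" for i i'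
    proof -
      let ?g = "\<lambda>z::nat \<times> nat \<Rightarrow> int. z (j, i) * z (k, i) * (z (j, i') * z (k, i'))"
      let ?flip = "\<lambda>z::nat \<times> nat \<Rightarrow> int. z((j, i) := - z (j, i))"
      have fl: "?flip z \<in> W" if "z \<in> W" for z
      proof -
        have "- z (j, i) \<in> {- int L..int L}" using zb[OF that j i(1)] by auto
        then show ?thesis
          using that i j unfolding W_def by (auto simp only: PiE_iff fun_upd_apply extensional_def split: if_splits)
      qed
      have "sum ?g W = (\<Sum>z\<in>W. - ?g z)"
        by (rule sum.reindex_bij_witness[where i = ?flip and j = ?flip])
           (use fl i jk in \<open>simp_all add: fun_upd_idem\<close>)
      then show ?thesis by (simp add: sum_negf)
    qed
    have "(\<Sum>z\<in>W. (\<Sum>i\<in>U. z (j, i) * z (k, i))\<^sup>2)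
        = (\<Sum>i\<in>U. \<Sum>i'\<in>U. \<Sum>z\<in>W. z (j, i) * z (k, i) * (z (j, i') * z (k, i')))"
      unfolding power2_eq_square sum_product
      by (subst sum.swap, intro sum.cong refl, subst sum.swap, rule refl)
    also have "\<dots> = (\<Sum>i\<in>U. \<Sum>i'\<in>U. if i = i' then (\<Sum>z\<in>W. (z (j, i) * z (k, i))\<^sup>2) else 0)"
      using cross by (intro sum.cong refl) (auto simp: power2_eq_square)
    also have "\<dots> = (\<Sum>i\<in>U. \<Sum>z\<in>W. (z (j, i) * z (k, i))\<^sup>2)"
      using U by simp
    also have "\<dots> \<le> (\<Sum>i\<in>U. int (card W) * int L ^ 4)"
    proof (rule sum_mono)
      fix i assume i: "i \<in> U"
      have "(z (j, i) * z (k, i))\<^sup>2 \<le> int L ^ 4" if "z \<in> W" for z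
        using power_mono[OF prod2[OF that j k i], of 2] by (simp flip: power_mult)
      then show "(\<Sum>z\<in>W. (z (j, i) * z (k, i))\<^sup>2) \<le> int (card W) * int L ^ 4"
        by (rule sum_bounded_above)
    qed
    also have "\<dots> = int (card U) * (int (card W) * int L ^ 4)" by simp
    also have "\<dots> \<le> int D * (int (card W) * int L ^ 4)" using U by (intro mult_right_mono) auto
    finally show ?thesis by (simp add: mult_ac)
  qed
  let ?T = "\<lambda>j k. \<Sum>z\<in>W. (\<Sum>i\<in>U. z (j, i) * z (k, i))\<^sup>2"
  let ?c = "int (card W) * (int D * int L ^ 4)"
  have c0: "0 \<le> ?c" by simp
  have "(\<Sum>z\<in>W. \<Sum>j\<in>V. \<Sum>k\<in>V. (\<Sum>i\<in>U. z (j, i) * z (k, i))\<^sup>2) = (\<Sum>j\<in>V. \<Sum>k\<in>V. ?T j k)"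
    by (subst sum.swap, intro sum.cong refl, subst sum.swap, rule refl)
  also have "\<dots> \<le> (\<Sum>j\<in>V. 2 * int D * ?c)"
  proof (rule sum_mono)
    fix j assume j: "j \<in> V"
    have "(\<Sum>k\<in>V. ?T j k) = ?T j j + (\<Sum>k\<in>V - {j}. ?T j k)"
      using V j by (simp add: sum.remove)
    also have "(\<Sum>k\<in>V - {j}. ?T j k) \<le> (\<Sum>k\<in>V - {j}. ?c)"
      using off[OF j] by (intro sum_mono) auto
    also have "\<dots> \<le> int D * ?c"
      using V c0 card_Diff1_le[of V j] by (auto intro!: mult_right_mono)
    also have "?T j j \<le> int D * ?c"
      using diag[OF j] by (simp add: power2_eq_square mult_ac)
    finally show "(\<Sum>k\<in>V. ?T j k) \<le> 2 * int D * ?c" by (simp add: mult_ac)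
  qed
  also have "\<dots> = int (card V) * (2 * int D * ?c)" by simp
  also have "\<dots> \<le> int D * (2 * int D * ?c)" using V c0 by (intro mult_right_mono) auto
  finally show ?thesis by (simp add: power3_eq_cube mult_ac)
qed

text \<open>By Markov's inequality at least half of all matrices have a Gram sum of at most twice
  the mean; the code is chosen among these. The factor 9/10 in the logarithm is the success
  probability of the estimator, put in for the packing bound.\<close>

lemma exists_matrix_code:
  fixes L D :: nat and U V :: "nat set"
  assumes U: "finite U" "card U \<le> D" "U \<noteq> {}" and V: "finite V" "card V \<le> D" "V \<noteq> {}" and L: "12 \<le> L"
  obtains C :: "(nat \<times> nat \<Rightarrow> int) set"
  where "finite C" "C \<subseteq> Pi\<^sub>E (V \<times> U) (\<lambda>_. {- int L..int L})"
    and "\<And>z. z \<in> C \<Longrightarrow> (\<Sum>j\<in>V. \<Sum>k\<in>V. (\<Sum>i\<in>U. z (j, i) * z (k, i))\<^sup>2) \<le> 4 * int D ^ 3 * int L ^ 4"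
    and "\<And>x y. x \<in> C \<Longrightarrow> y \<in> C \<Longrightarrow> x \<noteq> y \<Longrightarrow> card V * card U \<le> 4 * card {p \<in> V \<times> U. x p \<noteq> y p}"
    and "real (card V * card U) / 4 * ln (real L) \<le> ln (9 / 10 * real (card C))"
    and "C \<noteq> {}"
proof -
  let ?I = "V \<times> U"
  let ?A = "{- int L..int L}"
  let ?W = "Pi\<^sub>E ?I (\<lambda>_. ?A)"
  let ?N = "card ?I"
  let ?q = "2 * L + 1"
  let ?S = "\<lambda>z :: nat \<times> nat \<Rightarrow> int. \<Sum>j\<in>V. \<Sum>k\<in>V. (\<Sum>i\<in>U. z (j, i) * z (k, i))\<^sup>2"
  let ?b = "2 * int D ^ 3 * int L ^ 4"
  define Q where "Q = {z \<in> ?W. ?S z \<le> 2 * ?b}"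
  have finI: "finite ?I" using U V by simp
  have finW: "finite ?W" using finI by (intro finite_PiE) auto
  have N1: "1 \<le> ?N" using U V by (metis One_nat_def Suc_leI card_gt_0_iff finI Sigma_empty_iff Times_empty)
  have cA: "card ?A = ?q" by simp
  have cW: "card ?W = ?q ^ ?N" using card_PiE[OF finI, of "\<lambda>_. ?A"] by (simp only: cA prod_constant)
  have D0: "0 < D" using U by (metis card_gt_0_iff order_less_le_trans)
  have b0: "0 < ?b" using D0 L by simp
  have S0: "0 \<le> ?S z" for z by (intro sum_nonneg) auto
  have "int (card (?W - Q)) * (2 * ?b) \<le> (\<Sum>z\<in>?W - Q. ?S z)"
    by (rule sum_bounded_below) (auto simp: Q_def)
  also have "\<dots> \<le> (\<Sum>z\<in>?W. ?S z)" using finW S0 by (intro sum_mono2) auto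
  also have "\<dots> \<le> int (card ?W) * ?b" by (rule sum_gram_squares_le) (use U V in auto)
  finally have "int (2 * card (?W - Q)) * ?b \<le> int (card ?W) * ?b" by (simp add: mult_ac)
  then have "int (2 * card (?W - Q)) \<le> int (card ?W)" using b0 by (rule mult_right_le_imp_le)
  then have "2 * card (?W - Q) \<le> card ?W" by linarith
  moreover have "card (?W - Q) = card ?W - card Q"
    using finW by (intro card_Diff_subset) (auto simp: Q_def intro: finite_subset)
  ultimately have cQ: "?q ^ ?N \<le> 2 * card Q" using cW by linarith
  obtain C where C: "C \<subseteq> Q" "\<forall>x\<in>C. \<forall>y\<in>C. x \<noteq> y \<longrightarrow> ?N \<le> 4 * card {p \<in> ?I. x p \<noteq> y p}"
    and cC: "?q ^ ?N \<le> 2 * (card C * (2 ^ ?N * ?q ^ (?N div 4)))"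
    using gv_code[OF finI _ cA _ _ cQ] by (auto simp: Q_def)
  have finC: "finite C" using C finW by (auto simp: Q_def intro: finite_subset)
  have C0: "C \<noteq> {}" using cC by auto
  have c1: "0 < real (card C)" using finC C0 by (simp add: card_gt_0_iff)
  have "ln (real ?q ^ ?N) \<le> ln (2 * (real (card C) * (2 ^ ?N * real ?q ^ (?N div 4))))"
  proof (subst ln_le_cancel_iff)
    show "real ?q ^ ?N \<le> 2 * (real (card C) * (2 ^ ?N * real ?q ^ (?N div 4)))"
      using cC by (metis (mono_tags, lifting) of_nat_le_iff of_nat_mult of_nat_numeral of_nat_power)
  qed (use c1 in auto)
  then have 1: "real ?N * ln (real ?q) \<le> ln 2 + ln (real (card C)) + real ?N * ln 2 + real (?N div 4) * ln (real ?q)"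
    using c1 by (simp add: ln_mult ln_realpow)
  \<comment> \<open>\<open>L \<ge> 12\<close> makes \<open>?q\<close> at least 25, above exp
    3.\<close>
  have lq3: "3 \<le> ln (real ?q)"
  proof -
    have "exp (3::real) = exp 1 ^ 3" by (simp flip: exp_of_nat_mult)
    also have "\<dots> \<le> (2.72::real) ^ 3" using e_less_272 by (intro power_mono) auto
    also have "\<dots> \<le> real ?q" using L by (simp add: power3_eq_cube)
    finally show ?thesis by (subst ln_ge_iff) auto
  qed
  have l2: "ln 2 \<le> (25/36::real)" by (rule ln2_le_25_over_36)
  have l9: "ln (9 / 10 :: real) \<ge> - 1 / 9"
    using ln_add_one_self_le_self[of "1/9::real"] ln_inverse[of "9/10::real"] by simp
  have dv: "real (?N div 4) * ln (real ?q) \<le> real ?N / 4 * ln (real ?q)"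
    using lq3 by (intro mult_right_mono) auto
  have n2: "real ?N * ln 2 \<le> real ?N * (25/36)" using l2 by (intro mult_left_mono) auto
  have n3: "real ?N * 3 \<le> real ?N * ln (real ?q)" using lq3 by (intro mult_left_mono) auto
  have "real ?N / 4 * ln (real ?q) \<le> ln (9/10) + ln (real (card C))"
  proof -
    \<comment> \<open>What remains is \<open>(N + 1) ln 2 + 1/9 \<le> x / 2\<close> with
      \<open>x \<ge> 3 N\<close>. With 25/36 for ln 2 this is an equality at \<open>N = 1\<close>,
      so the numerical bounds just suffice.\<close>
    have "1 \<le> real ?N" using N1 by linarith
    moreover define x where "x = real ?N * ln (real ?q)"
    moreover define y where "y = real (?N div 4) * ln (real ?q)"
    moreover have "x \<le> ln 2 + ln (real (card C)) + real ?N * ln 2 + y" "real ?N * 3 \<le> x"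
      unfolding x_def y_def by (rule 1 n3)+
    moreover have "y \<le> x / 4" using dv by (simp only: x_def y_def)
    moreover have "real ?N / 4 * ln (real ?q) = x / 4" by (simp add: x_def)
    ultimately show ?thesis using n2 l2 l9 by linarith
  qed
  also have "\<dots> = ln (9/10 * real (card C))" using c1 by (subst ln_mult) auto
  finally have "real ?N / 4 * ln (real ?q) \<le> ln (9/10 * real (card C))" .
  moreover have "real ?N / 4 * ln (real L) \<le> real ?N / 4 * ln (real ?q)"
    using L by (intro mult_left_mono) auto
  ultimately have fin: "real (card V * card U) / 4 * ln (real L) \<le> ln (9 / 10 * real (card C))"
    by (simp add: card_cartesian_product)
  show ?thesis
    by (rule that[of C]) (use C finC fin C0 in \<open>auto simp: Q_def card_cartesian_product\<close>)
qed

section \<open>Gaussian integrals\<close>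

definition normal_measure :: "real \<Rightarrow> real \<Rightarrow> real measure" where
  "normal_measure \<mu> \<sigma> = density lborel (\<lambda>x. ennreal (normal_density \<mu> \<sigma> x))"

lemma sets_normal_measure [simp, measurable_cong]: "sets (normal_measure \<mu> \<sigma>) = sets borel"
  by (simp add: normal_measure_def)

lemma space_normal_measure [simp]: "space (normal_measure \<mu> \<sigma>) = UNIV"
  by (simp add: normal_measure_def)

lemma prob_space_normal_measure: "0 < \<sigma> \<Longrightarrow> prob_space (normal_measure \<mu> \<sigma>)"
  unfolding normal_measure_def by (rule prob_space_normal_density)

lemma distributed_lincomb_normal:
  fixes e \<mu> :: "'i \<Rightarrow> real"
  assumes I: "finite I" and e: "(\<Sum>i\<in>I. (e i)\<^sup>2) \<noteq> 0" and \<sigma>: "0 < \<sigma>"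
  shows "distributed (PiM I (\<lambda>i. normal_measure (\<mu> i) \<sigma>)) lborel (\<lambda>x. \<Sum>i\<in>I. e i * x i)
    (\<lambda>x. ennreal (normal_density (\<Sum>i\<in>I. e i * \<mu> i) (\<sigma> * sqrt (\<Sum>i\<in>I. (e i)\<^sup>2)) x))"
proof -
  let ?N = "\<lambda>i. normal_measure (\<mu> i) \<sigma>"
  let ?M = "PiM I ?N"
  have pN: "prob_space (?N i)" for i using \<sigma> by (rule prob_space_normal_measure)
  interpret M: prob_space ?M by (rule prob_space_PiM) (rule pN)
  \<comment> \<open>A term with coefficient 0 is constant and has no density, so the sum is taken
    over the nonzero coefficients.\<close>
  define J where "J = {i \<in> I. e i \<noteq> 0}"
  have "\<exists>i\<in>I. e i \<noteq> 0"
  proof (rule ccontr)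
    assume "\<not> (\<exists>i\<in>I. e i \<noteq> 0)"
    then have "(\<Sum>i\<in>I. (e i)\<^sup>2) = 0" by (intro sum.neutral) auto
    then show False using e by simp
  qed
  then have J: "finite J" "J \<noteq> {}" "J \<subseteq> I" using I by (auto simp: J_def)
  then have I0: "I \<noteq> {}" by auto
  have comp: "distr ?M (?N i) (\<lambda>x. x i) = ?N i" if "i \<in> I" for i
    using that by (intro distr_PiM_component pN)
  have comp': "distr ?M borel (\<lambda>x. x i) = ?N i" if "i \<in> I" for i
    using comp[OF that] by (simp cong: distr_cong)
  \<comment> \<open>The coordinates are independent because their joint law is the product measure
    itself.\<close>
  have "M.indep_vars (\<lambda>_. borel) (\<lambda>i x. x i) I"
  proof (subst M.indep_vars_iff_distr_eq_PiM'[OF I0])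
    show "M.random_variable borel (\<lambda>x. x i)" if "i \<in> I" for i
      using measurable_component_singleton[OF that, of ?N]
      by (subst (asm) measurable_cong_sets[OF refl sets_normal_measure])
    have "distr ?M (PiM I (\<lambda>_. borel)) (\<lambda>x. \<lambda>i\<in>I. x i) = distr ?M ?M (\<lambda>x. x)"
    proof (rule distr_cong[OF refl])
      show "sets (PiM I (\<lambda>_. borel)) = sets ?M" by (rule sets_PiM_cong) auto
      show "(\<lambda>i\<in>I. x i) = x" if "x \<in> space ?M" for x
        using that by (auto simp: space_PiM PiE_def extensional_restrict)
    qed
    also have "\<dots> = ?M" by (rule distr_id)
    also have "\<dots> = PiM I (\<lambda>i. distr ?M borel (\<lambda>x. x i))"
      by (rule PiM_cong) (simp_all add: comp')
    finally show "distr ?M (PiM I (\<lambda>_. borel)) (\<lambda>x. \<lambda>i\<in>I. x i) = PiM I (\<lambda>i. distr ?M borel (\<lambda>x. x i))" .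
  qed
  then have "M.indep_vars (\<lambda>_. borel) (\<lambda>i x. e i * x i) I"
    by (rule M.indep_vars_compose2) auto
  then have ind: "M.indep_vars (\<lambda>_. borel) (\<lambda>i x. e i * x i) J"
    using J(3) by (rule M.indep_vars_subset)
  have dist: "distributed ?M lborel (\<lambda>x. e i * x i) (normal_density (e i * \<mu> i) (\<bar>e i\<bar> * \<sigma>))" if i: "i \<in> J" for i
  proof -
    have iI: "i \<in> I" and e0: "e i \<noteq> 0" using i by (auto simp: J_def)
    have "distributed ?M lborel (\<lambda>x. x i) (normal_density (\<mu> i) \<sigma>)"
      unfolding distributed_def
    proof (intro conjI)
      show [measurable]: "(\<lambda>x. x i) \<in> ?M \<rightarrow>\<^sub>M lborel"
        using measurable_component_singleton[OF iI, of ?N]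
        by (subst (asm) measurable_cong_sets[OF refl sets_normal_measure]) simp
      have "distr ?M lborel (\<lambda>x. x i) = distr ?M borel (\<lambda>x. x i)" by (rule distr_cong) auto
      then show "distr ?M lborel (\<lambda>x. x i) = density lborel (\<lambda>x. ennreal (normal_density (\<mu> i) \<sigma> x))"
        using comp'[OF iI] by (simp add: normal_measure_def)
    qed simp
    from M.normal_density_affine[OF this \<sigma> e0, of 0] show ?thesis by simp
  qed
  have "distributed ?M lborel (\<lambda>x. \<Sum>i\<in>J. e i * x i)
      (normal_density (\<Sum>i\<in>J. e i * \<mu> i) (sqrt (\<Sum>i\<in>J. (\<bar>e i\<bar> * \<sigma>)\<^sup>2)))"
    by (rule M.sum_indep_normal[OF J(1,2) ind _ dist]) (use \<sigma> in \<open>auto simp: J_def\<close>)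
  moreover have "(\<Sum>i\<in>J. e i * x i) = (\<Sum>i\<in>I. e i * x i)" for x
    using I by (intro sum.mono_neutral_left) (auto simp: J_def)
  moreover have "(\<Sum>i\<in>J. (\<bar>e i\<bar> * \<sigma>)\<^sup>2) = \<sigma>\<^sup>2 * (\<Sum>i\<in>I. (e i)\<^sup>2)"
  proof -
    have "(\<Sum>i\<in>J. (\<bar>e i\<bar> * \<sigma>)\<^sup>2) = (\<Sum>i\<in>I. (\<bar>e i\<bar> * \<sigma>)\<^sup>2)"
      using I by (intro sum.mono_neutral_left) (auto simp: J_def)
    then show ?thesis by (simp add: power_mult_distrib sum_distrib_left mult.commute)
  qed
  ultimately show ?thesis using \<sigma> by (simp add: real_sqrt_mult)
qed

text \<open>For \<open>e\<close> different from 0 the linear form is centred normal of deviation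
  \<open>?s\<close>, with moments \<open>?s^2\<close> and \<open>3 ?s^4\<close>; otherwise it
  vanishes.\<close>

lemma lincomb_normal_moment2:
  fixes e :: "'i \<Rightarrow> real"
  assumes I: "finite I" and \<sigma>: "0 < \<sigma>"
  defines "M \<equiv> PiM I (\<lambda>_. normal_measure 0 \<sigma>)"
  shows "integrable M (\<lambda>x. (\<Sum>i\<in>I. e i * x i)\<^sup>2)"
    and "(\<integral>x. (\<Sum>i\<in>I. e i * x i)\<^sup>2 \<partial>M) = \<sigma>\<^sup>2 * (\<Sum>i\<in>I. (e i)\<^sup>2)"
    and "integrable M (\<lambda>x. (\<Sum>i\<in>I. e i * x i) ^ 4)"
    and "(\<integral>x. (\<Sum>i\<in>I. e i * x i) ^ 4 \<partial>M) = 3 * \<sigma> ^ 4 * (\<Sum>i\<in>I. (e i)\<^sup>2)\<^sup>2"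
proof -
  let ?s = "\<sigma> * sqrt (\<Sum>i\<in>I. (e i)\<^sup>2)"
  have "integrable M (\<lambda>x. (\<Sum>i\<in>I. e i * x i)\<^sup>2) \<and>
    (\<integral>x. (\<Sum>i\<in>I. e i * x i)\<^sup>2 \<partial>M) = \<sigma>\<^sup>2 * (\<Sum>i\<in>I. (e i)\<^sup>2) \<and>
    integrable M (\<lambda>x. (\<Sum>i\<in>I. e i * x i) ^ 4) \<and>
    (\<integral>x. (\<Sum>i\<in>I. e i * x i) ^ 4 \<partial>M) = 3 * \<sigma> ^ 4 * (\<Sum>i\<in>I. (e i)\<^sup>2)\<^sup>2"
  proof (cases "(\<Sum>i\<in>I. (e i)\<^sup>2) = 0")
    case True
    then have "\<And>i. i \<in> I \<Longrightarrow> e i = 0" using I by (simp add: sum_nonneg_eq_0_iff)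
    then have "(\<Sum>i\<in>I. e i * x i) = 0" for x by simp
    then show ?thesis using True by simp
  next
    case False
    then have pos: "0 < (\<Sum>i\<in>I. (e i)\<^sup>2)" by (simp add: sum_nonneg order_less_le)
    then have s: "0 < ?s" using \<sigma> by simp
    have D: "distributed M lborel (\<lambda>x. \<Sum>i\<in>I. e i * x i) (\<lambda>x. ennreal (normal_density 0 ?s x))"
      using distributed_lincomb_normal[OF I False \<sigma>, of "\<lambda>_. 0"] by (simp add: M_def)
    have mom: "integrable M (\<lambda>x. (\<Sum>i\<in>I. e i * x i) ^ (2 * k)) \<and>
       (\<integral>x. (\<Sum>i\<in>I. e i * x i) ^ (2 * k) \<partial>M) = fact (2 * k) / ((2 / ?s\<^sup>2) ^ k * fact k)" for k
    proof
      show "integrable M (\<lambda>x. (\<Sum>i\<in>I. e i * x i) ^ (2 * k))"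
        using distributed_integrable[OF D, of "\<lambda>x. x ^ (2 * k)"] integrable_normal_moment[OF s, of 0 "2 * k"]
        by simp
      show "(\<integral>x. (\<Sum>i\<in>I. e i * x i) ^ (2 * k) \<partial>M) = fact (2 * k) / ((2 / ?s\<^sup>2) ^ k * fact k)"
        using distributed_integral[OF D, of "\<lambda>x. x ^ (2 * k)"] integral_normal_moment_even[OF s, of 0 k]
        by simp
    qed
    have s2: "?s\<^sup>2 = \<sigma>\<^sup>2 * (\<Sum>i\<in>I. (e i)\<^sup>2)"
      using pos by (simp add: power_mult_distrib)
    have "fact (2 * 1) / ((2 / ?s\<^sup>2) ^ 1 * fact 1) = \<sigma>\<^sup>2 * (\<Sum>i\<in>I. (e i)\<^sup>2)"
      unfolding s2 using \<sigma> pos by (simp add: fact_numeral)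
    moreover have "fact (2 * 2) / ((2 / ?s\<^sup>2) ^ 2 * fact 2) = 3 * \<sigma> ^ 4 * (\<Sum>i\<in>I. (e i)\<^sup>2)\<^sup>2"
      unfolding s2 using \<sigma> pos by (simp add: fact_numeral power2_eq_square power4_eq_xxxx)
    ultimately show ?thesis using mom[of 1] mom[of 2] by simp
  qed
  then show "integrable M (\<lambda>x. (\<Sum>i\<in>I. e i * x i)\<^sup>2)"
    and "(\<integral>x. (\<Sum>i\<in>I. e i * x i)\<^sup>2 \<partial>M) = \<sigma>\<^sup>2 * (\<Sum>i\<in>I. (e i)\<^sup>2)"
    and "integrable M (\<lambda>x. (\<Sum>i\<in>I. e i * x i) ^ 4)"
    and "(\<integral>x. (\<Sum>i\<in>I. e i * x i) ^ 4 \<partial>M) = 3 * \<sigma> ^ 4 * (\<Sum>i\<in>I. (e i)\<^sup>2)\<^sup>2"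
    by blast+
qed

text \<open>The characteristic function of the standard normal law yields the means of cos and sin
  of \<open>s * x\<close>; the addition theorem does the rest. The sine is the bounded test function
  of \<open>tv_model_ge\<close>, chosen because its Gaussian integrals are explicit.\<close>

lemma integral_normal_density_sin:
  assumes s: "0 < s"
  shows "(\<integral>y. normal_density m s y * sin (y + k) \<partial>lborel) = sin (m + k) * exp (- s\<^sup>2 / 2)"
proof -
  interpret S: prob_space std_normal_distribution by (rule prob_space_normal_density) simp
  have int: "integrable std_normal_distribution (\<lambda>x. iexp (s * x))"
    by (rule S.integrable_const_bound[where B=1]) auto
  have ch: "(\<integral>x. iexp (s * x) \<partial>std_normal_distribution) = complex_of_real (exp (- s\<^sup>2 / 2))"
    using fun_cong[OF char_std_normal_distribution, of s] by (simp add: char_def)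
  have re: "Re (iexp y) = cos y" and im: "Im (iexp y) = sin y" for y :: real
    by (simp_all flip: cis_conv_exp)
  have c: "(\<integral>x. cos (s * x) \<partial>std_normal_distribution) = exp (- s\<^sup>2 / 2)"
    using integral_Re[OF int] unfolding ch re by simp
  have n: "(\<integral>x. sin (s * x) \<partial>std_normal_distribution) = 0"
    using integral_Im[OF int] unfolding ch im by simp
  have ic: "integrable std_normal_distribution (\<lambda>x. cos (s * x))"
    by (rule S.integrable_const_bound[where B=1]) auto
  have ins: "integrable std_normal_distribution (\<lambda>x. sin (s * x))"
    by (rule S.integrable_const_bound[where B=1]) auto
  have "(\<integral>y. normal_density m s y * sin (y + k) \<partial>lborel)
      = s * (\<integral>z. normal_density m s (m + s * z) * sin (m + s * z + k) \<partial>lborel)"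
    using lborel_integral_real_affine[of s "\<lambda>y. normal_density m s y * sin (y + k)" m] s by simp
  also have "\<dots> = (\<integral>z. std_normal_density z * sin (m + s * z + k) \<partial>lborel)"
  proof -
    have "s * normal_density m s (m + s * z) = std_normal_density z" for z
      using s by (simp add: normal_density_def power_mult_distrib real_sqrt_mult)
    then show ?thesis by (simp add: mult.assoc[symmetric] flip: integral_mult_right_zero)
  qed
  also have "\<dots> = (\<integral>z. sin (m + s * z + k) \<partial>std_normal_distribution)"
    by (subst integral_density) auto
  also have "(\<lambda>z. sin (m + s * z + k)) = (\<lambda>z. sin (s * z) * cos (m + k) + cos (s * z) * sin (m + k))"
  proof
    fix z
    have "m + s * z + k = s * z + (m + k)" by simp
    then show "sin (m + s * z + k) = sin (s * z) * cos (m + k) + cos (s * z) * sin (m + k)"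
      by (simp only: sin_add[of "s * z" "m + k"])
  qed
  also have "(\<integral>z. sin (s * z) * cos (m + k) + cos (s * z) * sin (m + k) \<partial>std_normal_distribution)
      = sin (m + k) * exp (- s\<^sup>2 / 2)"
    using ins ic by (simp add: n c)
  finally show ?thesis .
qed

lemma lincomb_normal_sin:
  fixes e \<mu> :: "'i \<Rightarrow> real"
  assumes I: "finite I" and \<sigma>: "0 < \<sigma>"
  shows "(\<integral>x. sin ((\<Sum>i\<in>I. e i * x i) + k) \<partial>PiM I (\<lambda>i. normal_measure (\<mu> i) \<sigma>))
     = sin ((\<Sum>i\<in>I. e i * \<mu> i) + k) * exp (- \<sigma>\<^sup>2 * (\<Sum>i\<in>I. (e i)\<^sup>2) / 2)"
proof (cases "(\<Sum>i\<in>I. (e i)\<^sup>2) = 0")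
  case True
  interpret M: prob_space "PiM I (\<lambda>i. normal_measure (\<mu> i) \<sigma>)"
    by (intro prob_space_PiM prob_space_normal_measure \<sigma>)
  have "\<And>i. i \<in> I \<Longrightarrow> e i = 0" using True I by (simp add: sum_nonneg_eq_0_iff)
  then have "(\<Sum>i\<in>I. e i * x i) = 0" for x by simp
  then show ?thesis using True M.prob_space by simp
next
  case False
  then have pos: "0 < (\<Sum>i\<in>I. (e i)\<^sup>2)" by (simp add: sum_nonneg order_less_le)
  then have s: "0 < \<sigma> * sqrt (\<Sum>i\<in>I. (e i)\<^sup>2)" using \<sigma> by simp
  show ?thesis
    using distributed_integral[OF distributed_lincomb_normal[OF I False \<sigma>, of \<mu>], of "\<lambda>y. sin (y + k)"]
      integral_normal_density_sin[OF s] pos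
    by (simp add: power_mult_distrib)
qed

text \<open>Completing the square. The exponential is the likelihood ratio of mean \<open>c\<close>
  against mean 0, one factor of \<open>ratio\<close> below.\<close>

lemma normal_density_shift:
  assumes "0 < b"
  shows "normal_density 0 b x * exp ((x * c - c\<^sup>2 / 2) / b\<^sup>2) = normal_density c b x"
proof -
  have "- x\<^sup>2 / (2 * b\<^sup>2) + (x * c - c\<^sup>2 / 2) / b\<^sup>2 = - (x - c)\<^sup>2 / (2 * b\<^sup>2)"
    using assms by (simp add: field_simps power2_eq_square)
  then show ?thesis
    by (simp add: normal_density_def flip: exp_add)
qed

text \<open>Among all [0, 1]-valued functions the indicator of \<open>q x < p x\<close> maximises
  the difference of the integrals. Lower bounds of the distance may thus use smooth tests.\<close>

lemma integral_density_le_tv: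
  fixes p q f :: "'a \<Rightarrow> real"
  assumes P: "prob_space (density M (\<lambda>x. ennreal (p x)))" and Q: "prob_space (density M (\<lambda>x. ennreal (q x)))"
    and [measurable]: "p \<in> borel_measurable M" "q \<in> borel_measurable M" "f \<in> borel_measurable M"
    and p0: "\<And>x. 0 \<le> p x" and q0: "\<And>x. 0 \<le> q x"
    and f: "\<And>x. 0 \<le> f x \<and> f x \<le> 1"
  shows "(\<integral>x. f x \<partial>density M (\<lambda>x. ennreal (p x))) - (\<integral>x. f x \<partial>density M (\<lambda>x. ennreal (q x)))
    \<le> tv_dist (density M (\<lambda>x. ennreal (p x))) (density M (\<lambda>x. ennreal (q x)))"
proof -
  let ?P = "density M (\<lambda>x. ennreal (p x))" and ?Q = "density M (\<lambda>x. ennreal (q x))"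
  interpret P: prob_space ?P by fact
  interpret Q: prob_space ?Q by fact
  have ip: "integrable M p"
    using P.emeasure_space_1 p0 by (intro integrableI_nonneg) (auto simp: emeasure_density cong: nn_integral_cong)
  have iq: "integrable M q"
    using Q.emeasure_space_1 q0 by (intro integrableI_nonneg) (auto simp: emeasure_density cong: nn_integral_cong)
  define S where "S = {x \<in> space M. q x < p x}"
  have S [measurable]: "S \<in> sets M" unfolding S_def by measurable
  have mul: "integrable M (\<lambda>x. r x * g x)"
    if "integrable M r" "\<And>x. 0 \<le> g x \<and> g x \<le> 1" "g \<in> borel_measurable M" for r g :: "'a \<Rightarrow> real"
  proof (rule Bochner_Integration.integrable_bound[OF that(1)])
    show "(\<lambda>x. r x * g x) \<in> borel_measurable M" using that by measurable
    show "AE x in M. norm (r x * g x) \<le> norm (r x)"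
      using that(2) by (auto simp: abs_mult intro!: mult_left_le)
  qed
  have "(\<integral>x. f x \<partial>?P) - (\<integral>x. f x \<partial>?Q) = (\<integral>x. p x * f x \<partial>M) - (\<integral>x. q x * f x \<partial>M)"
    using p0 q0 by (simp add: integral_density)
  also have "\<dots> = (\<integral>x. p x * f x - q x * f x \<partial>M)"
    using mul[OF ip f] mul[OF iq f] by simp
  also have "\<dots> \<le> (\<integral>x. p x * indicator S x - q x * indicator S x \<partial>M)"
  proof (rule integral_mono)
    show "integrable M (\<lambda>x. p x * f x - q x * f x)" using mul[OF ip f] mul[OF iq f] by simp
    show "integrable M (\<lambda>x. p x * indicator S x - q x * indicator S x)"
      using mul[OF ip, of "indicator S"] mul[OF iq, of "indicator S"] by (simp add: indicator_def)
    fix x assume "x \<in> space M"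
    show "p x * f x - q x * f x \<le> p x * indicator S x - q x * indicator S x"
    proof (cases "q x < p x")
      case True
      then have "(p x - q x) * f x \<le> (p x - q x) * 1" using f by (intro mult_left_mono) auto
      then show ?thesis using True \<open>x \<in> space M\<close> by (simp add: S_def algebra_simps)
    next
      case False
      then have "(p x - q x) * f x \<le> 0" using f by (intro mult_nonpos_nonneg) auto
      then show ?thesis using False by (simp add: S_def algebra_simps)
    qed
  qed
  also have "\<dots> = (\<integral>x. p x * indicator S x \<partial>M) - (\<integral>x. q x * indicator S x \<partial>M)"
    using mul[OF ip, of "indicator S"] mul[OF iq, of "indicator S"] by (simp add: indicator_def)
  also have "\<dots> = (\<integral>x. indicator S x \<partial>?P) - (\<integral>x. indicator S x \<partial>?Q)"
    using p0 q0 by (simp add: integral_density del: Bochner_Integration.integral_indicator)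
  also have "\<dots> = measure ?P S - measure ?Q S"
    using Bochner_Integration.integral_indicator[of ?P S] Bochner_Integration.integral_indicator[of ?Q S]
      sets.sets_into_space[OF S] by (simp only: space_density Int_absorb2)
  also have "\<dots> \<le> \<bar>measure ?P S - measure ?Q S\<bar>" by simp
  also have "\<dots> \<le> tv_dist ?P ?Q"
    unfolding tv_dist_def
  proof (rule cSUP_upper)
    show "bdd_above ((\<lambda>S. \<bar>measure ?P S - measure ?Q S\<bar>) ` sets ?P)"
    proof (rule bdd_aboveI2)
      fix S show "\<bar>measure ?P S - measure ?Q S\<bar> \<le> 1"
        using P.prob_le_1[of S] Q.prob_le_1[of S] measure_nonneg[of ?P S] measure_nonneg[of ?Q S] by linarith
    qed
  qed simp
  finally show ?thesis .
qed

section \<open>The regression model as a density, and its disintegration\<close>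

locale gauss_block =
  fixes m d :: nat and a b :: real
  assumes md: "m \<le> d" and a: "0 < a" and b: "0 < b"
begin

definition lin :: "(nat \<Rightarrow> nat \<Rightarrow> real) \<Rightarrow> (nat \<Rightarrow> real) \<Rightarrow> nat \<Rightarrow> real" where
  "lin B x j = (\<Sum>i<m. B j i * x i)"

text \<open>The law for regression matrix 0: coordinates below \<open>m\<close> are the covariates,
  the others the responses.\<close>

definition base :: "(nat \<Rightarrow> real) measure" where
  "base = PiM {..<d} (\<lambda>i. normal_measure 0 (if i < m then a else b))"

text \<open>The likelihood ratio of regression matrix \<open>B\<close> against 0. The covariates
  have the same law under both, so only responses contribute a factor.\<close>

definition ratio :: "(nat \<Rightarrow> nat \<Rightarrow> real) \<Rightarrow> (nat \<Rightarrow> real) \<Rightarrow> real" where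
  "ratio B x = exp ((\<Sum>j=m..<d. x j * lin B x j - (lin B x j)\<^sup>2 / 2) / b\<^sup>2)"

definition model :: "(nat \<Rightarrow> nat \<Rightarrow> real) \<Rightarrow> (nat \<Rightarrow> real) measure" where
  "model B = density base (\<lambda>x. ennreal (ratio B x))"

text \<open>The square of the Frobenius norm, not the norm.\<close>

definition frob :: "(nat \<Rightarrow> nat \<Rightarrow> real) \<Rightarrow> real" where
  "frob B = (\<Sum>j=m..<d. \<Sum>i<m. (B j i)\<^sup>2)"

abbreviation covariates :: "(nat \<Rightarrow> real) measure" where
  "covariates \<equiv> PiM {..<m} (\<lambda>_. normal_measure 0 a)"

abbreviation responses :: "(nat \<Rightarrow> real) \<Rightarrow> (nat \<Rightarrow> real) measure" where
  "responses c \<equiv> PiM {m..<d} (\<lambda>j. normal_measure (c j) b)"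

lemma frob_nonneg: "0 \<le> frob B"
  unfolding frob_def by (intro sum_nonneg) auto

lemma measurable_lin_covariates: "(\<lambda>x. lin B x j) \<in> borel_measurable covariates"
  unfolding lin_def by measurable

lemma measurable_coord: "i < d \<Longrightarrow> (\<lambda>x. x i) \<in> borel_measurable base"
  unfolding base_def
  using measurable_component_singleton[of i "{..<d}" "\<lambda>i. normal_measure 0 (if i < m then a else b)",
      unfolded measurable_cong_sets[OF refl sets_normal_measure]] by simp

lemma measurable_lin: "(\<lambda>x. lin B x j) \<in> borel_measurable base"
proof -
  have "(\<lambda>x. x i) \<in> borel_measurable base" if "i < m" for i
    using that md by (intro measurable_coord) simp
  then show ?thesis unfolding lin_def by (intro borel_measurable_sum borel_measurable_times) auto
qed

lemma measurable_ratio [measurable]: "ratio B \<in> borel_measurable base"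
proof -
  note [measurable] = measurable_lin measurable_coord
  show ?thesis unfolding ratio_def by measurable
qed

lemma ratio_pos: "0 < ratio B x"
  by (simp add: ratio_def)

lemma prob_space_covariates: "prob_space covariates"
  by (intro prob_space_PiM prob_space_normal_measure a)

lemma prob_space_responses: "prob_space (responses c)"
  by (intro prob_space_PiM prob_space_normal_measure b)

lemma prob_space_base: "prob_space base"
  unfolding base_def by (intro prob_space_PiM prob_space_normal_measure) (use a b in auto)

lemma lin_merge: "lin B (merge {..<m} {m..<d} (u, v)) j = lin B u j"
  unfolding lin_def by (intro sum.cong) (auto simp: merge_def)

lemma sets_base: "sets base = sets (PiM {..<d} (\<lambda>_. borel))"
  unfolding base_def by (rule sets_PiM_cong) auto

lemma measurable_merge_base:
  assumes "u \<in> space covariates"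
  shows "(\<lambda>v. merge {..<m} {m..<d} (u, v)) \<in> responses c \<rightarrow>\<^sub>M base"
proof -
  have un: "{..<d} = {..<m} \<union> {m..<d}" using md by auto
  have s1: "sets covariates = sets (PiM {..<m} (\<lambda>_. borel))" by (rule sets_PiM_cong) auto
  have s2: "sets (responses c) = sets (PiM {m..<d} (\<lambda>_. borel))" by (rule sets_PiM_cong) auto
  have "(\<lambda>v. merge {..<m} {m..<d} (u, v)) \<in> PiM {m..<d} (\<lambda>_. borel) \<rightarrow>\<^sub>M PiM ({..<m} \<union> {m..<d}) (\<lambda>_. borel)"
    by (rule measurable_compose[OF measurable_Pair1' measurable_merge])
       (use assms sets_eq_imp_space_eq[OF s1] in auto)
  then show ?thesis
    using measurable_cong_sets[OF s2 sets_base] unfolding un by blast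
qed

text \<open>Disintegration: given the covariates \<open>u\<close>, the responses are independent
  normal with means \<open>lin B u\<close>. Since \<open>lin B\<close> depends on the covariates
  only, the ratio at fixed \<open>u\<close> is a product over the responses, and each factor shifts
  one mean by \<open>normal_density_shift\<close>.\<close>

lemma nn_integral_model:
  assumes f [measurable]: "f \<in> borel_measurable base"
  shows "(\<integral>\<^sup>+x. f x \<partial>model B) =
    (\<integral>\<^sup>+u. \<integral>\<^sup>+v. f (merge {..<m} {m..<d} (u, v)) \<partial>responses (lin B u) \<partial>covariates)"
proof -
  let ?\<sigma> = "\<lambda>i. if i < m then a else b"
  let ?mg = "\<lambda>u v. merge {..<m} {m..<d} (u, v)"
  have pr: "prob_space (normal_measure 0 (?\<sigma> i))" for i
    using a b by (intro prob_space_normal_measure) auto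
  interpret S: product_sigma_finite "\<lambda>i. normal_measure 0 (?\<sigma> i)"
    unfolding product_sigma_finite_def using pr prob_space_imp_sigma_finite by blast
  have un: "{..<d} = {..<m} \<union> {m..<d}" using md by auto
  have cov: "PiM {..<m} (\<lambda>i. normal_measure 0 (?\<sigma> i)) = covariates"
    by (rule PiM_cong) auto
  have resp: "PiM {m..<d} (\<lambda>i. normal_measure 0 (?\<sigma> i)) = responses (\<lambda>_. 0)"
    by (rule PiM_cong) auto
  have "(\<integral>\<^sup>+x. f x \<partial>model B) = (\<integral>\<^sup>+x. ennreal (ratio B x) * f x \<partial>base)"
    unfolding model_def by (rule nn_integral_density) measurable
  also have "\<dots> = (\<integral>\<^sup>+u. \<integral>\<^sup>+v. ennreal (ratio B (?mg u v)) * f (?mg u v)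
       \<partial>responses (\<lambda>_. 0) \<partial>covariates)"
    unfolding base_def cov[symmetric] resp[symmetric] un
  proof (rule S.product_nn_integral_fold)
    show "(\<lambda>x. ennreal (ratio B x) * f x) \<in> borel_measurable (PiM ({..<m} \<union> {m..<d}) (\<lambda>i. normal_measure 0 (?\<sigma> i)))"
      unfolding un[symmetric] base_def[symmetric] by measurable
  qed auto
  also have "\<dots> = (\<integral>\<^sup>+u. \<integral>\<^sup>+v. f (?mg u v) \<partial>responses (lin B u) \<partial>covariates)"
  proof (rule nn_integral_cong)
    fix u assume u: "u \<in> space covariates"
    let ?c = "lin B u"
    let ?r = "\<lambda>j x. ennreal (exp ((x * ?c j - (?c j)\<^sup>2 / 2) / b\<^sup>2))"
    have [measurable]: "?r j \<in> borel_measurable (normal_measure 0 b)" for j by measurable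
    have dens: "density (normal_measure 0 b) (?r j) = normal_measure (?c j) b" for j
      unfolding normal_measure_def
      by (subst density_density_eq)
         (auto simp: normal_density_shift[OF b] simp flip: ennreal_mult)
    have "responses ?c = PiM {m..<d} (\<lambda>j. density (normal_measure 0 b) (?r j))"
      by (simp add: dens)
    also have "\<dots> = density (responses (\<lambda>_. 0)) (\<lambda>x. \<Prod>j=m..<d. ?r j (x j))"
      using b by (intro PiM_density)
         (auto simp: dens intro: prob_space_normal_measure prob_space_imp_sigma_finite)
    finally have R: "responses ?c = density (responses (\<lambda>_. 0)) (\<lambda>x. \<Prod>j=m..<d. ?r j (x j))" .
    have rm: "ennreal (ratio B (?mg u v)) = (\<Prod>j=m..<d. ?r j (v j))" for v
    proof -
      have "(\<Prod>j=m..<d. ?r j (v j)) = ennreal (\<Prod>j=m..<d. exp ((v j * ?c j - (?c j)\<^sup>2 / 2) / b\<^sup>2))"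
        by (rule prod_ennreal) auto
      also have "(\<Prod>j=m..<d. exp ((v j * ?c j - (?c j)\<^sup>2 / 2) / b\<^sup>2)) = ratio B (?mg u v)"
        unfolding ratio_def lin_merge sum_divide_distrib exp_sum[OF finite_atLeastLessThan]
        by (intro prod.cong refl) (auto simp: merge_def)
      finally show ?thesis by simp
    qed
    have fm: "(\<lambda>v. f (?mg u v)) \<in> borel_measurable (responses (\<lambda>_. 0))"
      using measurable_merge_base[OF u] f by (rule measurable_compose)
    show "(\<integral>\<^sup>+v. ennreal (ratio B (?mg u v)) * f (?mg u v) \<partial>responses (\<lambda>_. 0))
        = (\<integral>\<^sup>+v. f (?mg u v) \<partial>responses ?c)"
      unfolding R rm by (rule nn_integral_density[symmetric]) (use fm in \<open>measurable\<close>)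
  qed
  finally show ?thesis .
qed

lemma prob_space_model: "prob_space (model B)"
proof
  have "emeasure (model B) (space (model B)) = (\<integral>\<^sup>+x. 1 \<partial>model B)" by simp
  also have "\<dots> = (\<integral>\<^sup>+u. \<integral>\<^sup>+v. 1 \<partial>responses (lin B u) \<partial>covariates)"
    by (rule nn_integral_model) simp
  also have "\<dots> = 1"
    using prob_space.emeasure_space_1[OF prob_space_responses]
      prob_space.emeasure_space_1[OF prob_space_covariates] by simp
  finally show "emeasure (model B) (space (model B)) = 1" .
qed

lemma sets_model [simp]: "sets (model B) = sets base"
  by (simp add: model_def)

text \<open>The inner integral is supplied in closed form as \<open>g\<close>, so measurability in
  \<open>u\<close> is a property of \<open>g\<close> and not of a family of product measures
  depending on \<open>u\<close>.\<close>

lemma integral_model: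
  fixes f :: "(nat \<Rightarrow> real) \<Rightarrow> real"
  assumes f [measurable]: "f \<in> borel_measurable base" and f01: "\<And>x. 0 \<le> f x \<and> f x \<le> 1"
    and g [measurable]: "g \<in> borel_measurable covariates"
    and g_eq: "\<And>u. u \<in> space covariates \<Longrightarrow> (\<integral>v. f (merge {..<m} {m..<d} (u, v)) \<partial>responses (lin B u)) = g u"
  shows "(\<integral>x. f x \<partial>model B) = (\<integral>u. g u \<partial>covariates)"
proof -
  let ?mg = "\<lambda>u v. merge {..<m} {m..<d} (u, v)"
  interpret M: prob_space "model B" by (rule prob_space_model)
  interpret U: prob_space covariates by (rule prob_space_covariates)
  have inner: "(\<integral>\<^sup>+v. ennreal (f (?mg u v)) \<partial>responses (lin B u)) = ennreal (g u)" and g0: "0 \<le> g u"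
    if u: "u \<in> space covariates" for u
  proof -
    interpret R: prob_space "responses (lin B u)" by (rule prob_space_responses)
    have [measurable]: "(\<lambda>v. f (?mg u v)) \<in> borel_measurable (responses (lin B u))"
      using measurable_compose[OF measurable_merge_base[OF u] f] .
    have "integrable (responses (lin B u)) (\<lambda>v. f (?mg u v))"
      using f01 by (intro R.integrable_const_bound[where B=1]) auto
    then show "(\<integral>\<^sup>+v. ennreal (f (?mg u v)) \<partial>responses (lin B u)) = ennreal (g u)"
      using f01 g_eq[OF u] by (subst nn_integral_eq_integral) auto
    show "0 \<le> g u"
      unfolding g_eq[OF u, symmetric] using f01 by (intro integral_nonneg_AE) auto
  qed
  have "(\<integral>x. f x \<partial>model B) = enn2real (\<integral>\<^sup>+x. ennreal (f x) \<partial>model B)"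
    using f01 by (intro integral_eq_nn_integral) (auto simp: model_def)
  also have "(\<integral>\<^sup>+x. ennreal (f x) \<partial>model B) = (\<integral>\<^sup>+u. ennreal (g u) \<partial>covariates)"
    by (subst nn_integral_model) (auto intro!: nn_integral_cong inner)
  also have "enn2real \<dots> = (\<integral>u. g u \<partial>covariates)"
    using g0 by (intro integral_eq_nn_integral[symmetric]) auto
  finally show ?thesis .
qed

end

text \<open>Cauchy--Schwarz for \<open>sqrt w * (y / sqrt w)\<close>. Division by 0 gives 0, which
  is harmless as \<open>y\<close> vanishes where \<open>w\<close> does.\<close>

lemma sum_squared_le_weighted:
  fixes y w :: "'i \<Rightarrow> real"
  assumes w: "\<And>j. j \<in> V \<Longrightarrow> 0 \<le> w j" and 0: "\<And>j. j \<in> V \<Longrightarrow> w j = 0 \<Longrightarrow> y j = 0"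
  shows "(\<Sum>j\<in>V. y j)\<^sup>2 \<le> (\<Sum>j\<in>V. w j) * (\<Sum>j\<in>V. (y j)\<^sup>2 / w j)"
proof -
  have "(\<Sum>j\<in>V. sqrt (w j) * (y j / sqrt (w j)))\<^sup>2 \<le> (\<Sum>j\<in>V. (sqrt (w j))\<^sup>2) * (\<Sum>j\<in>V. (y j / sqrt (w j))\<^sup>2)"
    by (rule Cauchy_Schwarz_ineq_sum)
  moreover have "(\<Sum>j\<in>V. sqrt (w j) * (y j / sqrt (w j))) = (\<Sum>j\<in>V. y j)"
    using 0 by (intro sum.cong) auto
  moreover have "(\<Sum>j\<in>V. (sqrt (w j))\<^sup>2) = (\<Sum>j\<in>V. w j)"
    using w by (intro sum.cong) auto
  moreover have "(\<Sum>j\<in>V. (y j / sqrt (w j))\<^sup>2) = (\<Sum>j\<in>V. (y j)\<^sup>2 / w j)"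
    using w by (intro sum.cong) (auto simp: power_divide)
  ultimately show ?thesis by simp
qed

text \<open>A second order lower bound at 0: sin x \<ge> x - x^2/2, and the factor exp (- y) costs
  at most |sin x| y \<le> x y. It reduces the mean of the test function to the first two moments of
  \<open>qf\<close>.\<close>

lemma sin_exp_ge:
  fixes x y :: real
  assumes "0 \<le> x" "0 \<le> y"
  shows "x - x\<^sup>2 / 2 - x * y \<le> sin x * exp (- y)"
proof -
  have "\<bar>sin x\<bar> * (1 - exp (- y)) \<le> x * y"
  proof (rule mult_mono)
    show "\<bar>sin x\<bar> \<le> x" using abs_sin_x_le_abs_x[of x] assms by simp
    show "1 - exp (- y) \<le> y" using exp_ge_add_one_self[of "- y"] by simp
    show "0 \<le> 1 - exp (- y)" using assms by simp
  qed (use assms in simp)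
  moreover have "sin x * (1 - exp (- y)) \<le> \<bar>sin x\<bar> * (1 - exp (- y))"
    using assms by (intro mult_right_mono) auto
  ultimately have 1: "sin x - x * y \<le> sin x * exp (- y)"
    by (simp add: algebra_simps)
  have 2: "x - x\<^sup>2 / 2 \<le> sin x"
  proof -
    have "(\<lambda>t. sin t - (t - t\<^sup>2 / 2)) 0 \<le> (\<lambda>t. sin t - (t - t\<^sup>2 / 2)) x"
    proof (rule DERIV_nonneg_imp_nondecreasing[OF assms(1)])
      fix t :: real assume t: "0 \<le> t" "t \<le> x"
      \<comment> \<open>This is the nonnegativity of the derivative. Up to 2 it follows from cos t
        \<ge> 1 - t^2/2, beyond from cos t \<ge> -1.\<close>
      have "1 - t \<le> cos t"
      proof (cases "t \<le> 2")
        case True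
        have "(sin (t / 2))\<^sup>2 \<le> (t / 2)\<^sup>2"
          using abs_sin_x_le_abs_x[of "t / 2"] by (simp only: abs_le_square_iff)
        then have "1 - t\<^sup>2 / 2 \<le> cos t"
          using cos_double_sin[of "t / 2"] by (simp add: power_divide)
        moreover have "t\<^sup>2 / 2 \<le> t" using mult_right_mono[OF True t(1)] by (simp add: power2_eq_square)
        ultimately show ?thesis by linarith
      next
        case False
        then show ?thesis using cos_ge_minus_one[of t] by linarith
      qed
      then show "\<exists>y. ((\<lambda>t. sin t - (t - t\<^sup>2 / 2)) has_real_derivative y) (at t) \<and> 0 \<le> y"
        by (intro exI[of _ "cos t - (1 - t)"] conjI) (auto intro!: derivative_eq_intros)
    qed
    then show ?thesis by simp
  qed
  show ?thesis using 1 2 by linarith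
qed

section \<open>Distances between laws of the regression model\<close>

context gauss_block
begin

text \<open>The squared norm of the mean of the responses given the covariates.\<close>

definition qf :: "(nat \<Rightarrow> nat \<Rightarrow> real) \<Rightarrow> (nat \<Rightarrow> real) \<Rightarrow> real" where
  "qf B x = (\<Sum>j=m..<d. (lin B x j)\<^sup>2)"

lemma qf_nonneg: "0 \<le> qf B x"
  unfolding qf_def by (intro sum_nonneg) auto

text \<open>The linear forms of different rows may be correlated. Cauchy--Schwarz weighted by the
  squared row norms reduces the square of \<open>qf\<close> to fourth powers of single rows, and the
  constant 3 is that of one normal variable.\<close>

lemma qf_integrable: "integrable covariates (qf B)"
  and qf_integral: "(\<integral>u. qf B u \<partial>covariates) = a\<^sup>2 * frob B"
  and qf_sq_integrable: "integrable covariates (\<lambda>u. (qf B u)\<^sup>2)"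
  and qf_sq_integral: "(\<integral>u. (qf B u)\<^sup>2 \<partial>covariates) \<le> 3 * a ^ 4 * (frob B)\<^sup>2"
proof -
  let ?w = "\<lambda>j. \<Sum>i<m. (B j i)\<^sup>2"
  have mom: "integrable covariates (\<lambda>u. (lin B u j)\<^sup>2)"
    "(\<integral>u. (lin B u j)\<^sup>2 \<partial>covariates) = a\<^sup>2 * ?w j"
    "integrable covariates (\<lambda>u. (lin B u j) ^ 4)"
    "(\<integral>u. (lin B u j) ^ 4 \<partial>covariates) = 3 * a ^ 4 * (?w j)\<^sup>2" for j
    unfolding lin_def using lincomb_normal_moment2[of "{..<m}" a "B j"] a by auto
  show "integrable covariates (qf B)"
    unfolding qf_def[abs_def] using mom by auto
  show "(\<integral>u. qf B u \<partial>covariates) = a\<^sup>2 * frob B"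
    unfolding qf_def frob_def using mom by (simp add: sum_distrib_left)
  define g where "g u = frob B * (\<Sum>j=m..<d. (lin B u j) ^ 4 / ?w j)" for u
  have gi: "integrable covariates g"
    unfolding g_def[abs_def] using mom by auto
  have "(\<integral>u. g u \<partial>covariates) = frob B * (\<Sum>j=m..<d. 3 * a ^ 4 * (?w j)\<^sup>2 / ?w j)"
    unfolding g_def using mom by simp
  also have "\<dots> = 3 * a ^ 4 * (frob B)\<^sup>2"
  proof -
    have "c * w\<^sup>2 / w = c * w" for c w :: real by (simp add: power2_eq_square)
    then have "(\<Sum>j=m..<d. 3 * a ^ 4 * (?w j)\<^sup>2 / ?w j) = (\<Sum>j=m..<d. 3 * a ^ 4 * ?w j)" by simp
    also have "\<dots> = 3 * a ^ 4 * frob B" by (simp only: frob_def sum_distrib_left)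
    finally show ?thesis by (simp add: power2_eq_square)
  qed
  finally have gI: "(\<integral>u. g u \<partial>covariates) = 3 * a ^ 4 * (frob B)\<^sup>2" .
  have le: "(qf B u)\<^sup>2 \<le> g u" for u
  proof -
    have "(qf B u)\<^sup>2 \<le> frob B * (\<Sum>j=m..<d. ((lin B u j)\<^sup>2)\<^sup>2 / ?w j)"
      unfolding qf_def frob_def
    proof (rule sum_squared_le_weighted)
      show "0 \<le> ?w j" for j by (intro sum_nonneg) auto
      fix j assume "?w j = 0"
      then have "\<And>i. i < m \<Longrightarrow> B j i = 0" by (simp add: sum_nonneg_eq_0_iff)
      then show "(lin B u j)\<^sup>2 = 0" by (simp add: lin_def)
    qed
    then show ?thesis by (simp add: g_def flip: power_mult)
  qed
  show si: "integrable covariates (\<lambda>u. (qf B u)\<^sup>2)"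
  proof (rule Bochner_Integration.integrable_bound[OF gi])
    show "(\<lambda>u. (qf B u)\<^sup>2) \<in> borel_measurable covariates"
      unfolding qf_def using measurable_lin_covariates by measurable
    show "AE u in covariates. norm ((qf B u)\<^sup>2) \<le> norm (g u)"
      using le by (intro AE_I2) (simp add: order_trans[OF le abs_ge_self])
  qed
  have "(\<integral>u. (qf B u)\<^sup>2 \<partial>covariates) \<le> (\<integral>u. g u \<partial>covariates)"
    using si gi le by (intro integral_mono) auto
  then show "(\<integral>u. (qf B u)\<^sup>2 \<partial>covariates) \<le> 3 * a ^ 4 * (frob B)\<^sup>2" using gI by simp
qed

lemma qf_measurable_covariates [measurable]: "qf B \<in> borel_measurable covariates"
  by (rule borel_measurable_integrable[OF qf_integrable])

lemma qf_measurable_base: "qf B \<in> borel_measurable base"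
  unfolding qf_def[abs_def] using measurable_lin by measurable

lemma ratio_integrable: "integrable base (ratio B)" and ratio_integral: "(\<integral>x. ratio B x \<partial>base) = 1"
proof -
  have "emeasure (model B) (space (model B)) = 1"
    using prob_space.emeasure_space_1[OF prob_space_model] .
  then have e: "(\<integral>\<^sup>+x. ennreal (ratio B x) \<partial>base) = 1"
    by (simp add: model_def emeasure_density cong: nn_integral_cong)
  show "integrable base (ratio B)"
    using e ratio_pos[THEN less_imp_le] by (intro integrableI_nonneg) auto
  show "(\<integral>x. ratio B x \<partial>base) = 1"
    using e ratio_pos[THEN less_imp_le] by (subst integral_eq_nn_integral) auto
qed

text \<open>This crude bound serves the two packings that produce a logarithm, where
  \<open>D\<close> is 2.\<close>

lemma integral_ratio_minus_one_le_2: "(\<integral>x. \<bar>ratio B x - 1\<bar> \<partial>base) \<le> 2"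
proof -
  interpret base: prob_space base by (rule prob_space_base)
  have "(\<integral>x. \<bar>ratio B x - 1\<bar> \<partial>base) \<le> (\<integral>x. ratio B x + 1 \<partial>base)"
    using ratio_integrable ratio_pos[THEN less_imp_le]
    by (intro integral_mono) (auto simp: abs_le_iff intro: add_nonneg_nonneg)
  also have "\<dots> = 2" using ratio_integrable ratio_integral base.prob_space by simp
  finally show ?thesis .
qed

text \<open>
  The affinity \<open>\<integral>sqrt (ratio B)\<close> is a Gaussian integral under the model with half the regression
  matrix, and controls the \<open>L1\<close> distance by Cauchy--Schwarz applied to
  \<open>ratio B - 1 = (sqrt (ratio B) - 1) * (sqrt (ratio B) + 1)\<close>.
\<close>

lemma integral_ratio_minus_one_le:
  assumes s: "0 < s" and F: "frob B \<le> s\<^sup>2"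
  shows "(\<integral>x. \<bar>ratio B x - 1\<bar> \<partial>base) \<le> a / b * s"
proof -
  interpret base: prob_space base by (rule prob_space_base)
  interpret cov: prob_space covariates by (rule prob_space_covariates)
  define B2 where "B2 j i = B j i / 2" for j i
  define k where "k x = exp (- qf B x / (8 * b\<^sup>2))" for x
  define h where "h x = ratio B2 x * k x" for x
  have k01: "0 \<le> k x \<and> k x \<le> 1" for x
    using qf_nonneg[of B x] b by (simp add: k_def)
  have [measurable]: "k \<in> borel_measurable base"
    unfolding k_def using qf_measurable_base by measurable
  have [measurable]: "k \<in> borel_measurable covariates"
    unfolding k_def by measurable
  have lin2: "lin B2 x j = lin B x j / 2" for x j
    by (simp add: lin_def B2_def sum_divide_distrib)
  \<comment> \<open>Halving \<open>B\<close> quarters the quadratic term, so the square of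
    \<open>ratio B2\<close> exceeds \<open>ratio B\<close> by the factor exp (qf B / (4 b^2));
    \<open>k\<close> is the inverse square root of that factor.\<close>
  have h2: "(h x)\<^sup>2 = ratio B x" for x
  proof -
    have "2 * (\<Sum>j=m..<d. x j * lin B2 x j - (lin B2 x j)\<^sup>2 / 2) - qf B x / 4
        = (\<Sum>j=m..<d. x j * lin B x j - (lin B x j)\<^sup>2 / 2)"
      unfolding lin2 qf_def sum_distrib_left sum_divide_distrib sum_subtractf[symmetric]
      by (intro sum.cong refl) (simp add: power2_eq_square field_simps)
    then have "2 * ((\<Sum>j=m..<d. x j * lin B2 x j - (lin B2 x j)\<^sup>2 / 2) / b\<^sup>2 + - qf B x / (8 * b\<^sup>2))
        = (\<Sum>j=m..<d. x j * lin B x j - (lin B x j)\<^sup>2 / 2) / b\<^sup>2"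
      using b by (simp add: field_simps)
    then show ?thesis
      unfolding h_def k_def ratio_def exp_add[symmetric] exp_double[symmetric] by simp
  qed
  have h0: "0 \<le> h x" for x
    unfolding h_def using k01 ratio_pos[of B2 x] by (intro mult_nonneg_nonneg) auto
  have hi: "integrable base h"
  proof (rule Bochner_Integration.integrable_bound[OF ratio_integrable[of B2]])
    show "h \<in> borel_measurable base" unfolding h_def[abs_def] by measurable
    show "AE x in base. norm (h x) \<le> norm (ratio B2 x)"
      using k01 ratio_pos[of B2] by (intro AE_I2) (auto simp: h_def abs_mult intro!: mult_left_le)
  qed
  have "(\<integral>x. h x \<partial>base) = (\<integral>x. k x \<partial>model B2)"
    unfolding model_def h_def using ratio_pos[of B2, THEN less_imp_le] by (subst integral_density) auto
  also have "\<dots> = (\<integral>u. k u \<partial>covariates)"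
  proof (rule integral_model[OF _ k01])
    fix u
    have "k (merge {..<m} {m..<d} (u, v)) = k u" for v
      by (simp add: k_def qf_def lin_merge)
    then show "(\<integral>v. k (merge {..<m} {m..<d} (u, v)) \<partial>responses (lin B2 u)) = k u"
      using prob_space.prob_space[OF prob_space_responses] by simp
  qed auto
  also have "\<dots> \<ge> (\<integral>u. 1 - qf B u / (8 * b\<^sup>2) \<partial>covariates)"
  proof (rule integral_mono)
    show "integrable covariates k" using k01 by (intro cov.integrable_const_bound[where B=1]) auto
    show "1 - qf B u / (8 * b\<^sup>2) \<le> k u" for u
      unfolding k_def using exp_ge_add_one_self[of "- qf B u / (8 * b\<^sup>2)"] by simp
  qed (use qf_integrable in auto)
  moreover have "(\<integral>u. 1 - qf B u / (8 * b\<^sup>2) \<partial>covariates) = 1 - a\<^sup>2 * frob B / (8 * b\<^sup>2)"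
    using qf_integrable qf_integral cov.prob_space by simp
  ultimately have Eh: "1 - a\<^sup>2 * frob B / (8 * b\<^sup>2) \<le> (\<integral>x. h x \<partial>base)" by simp
  \<comment> \<open>The minimiser of \<open>t a^2 s^2 / (8 b^2) + 2 / t\<close>; both terms become
    \<open>a s / (2 b)\<close>.\<close>
  define t where "t = 4 * b / (a * s)"
  have t: "0 < t" using a b s by (simp add: t_def)
  \<comment> \<open>Cauchy--Schwarz in pointwise form: a weighted arithmetic-geometric mean
    inequality for |h - 1| (h + 1), followed by (h + 1)^2 \<le> 2 (h^2 + 1).\<close>
  have pt: "\<bar>ratio B x - 1\<bar> \<le> t / 2 * (ratio B x - 2 * h x + 1) + (ratio B x + 1) / t" for x
  proof -
    have "0 \<le> (t * \<bar>h x - 1\<bar> - (h x + 1))\<^sup>2" by simp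
    then have "2 * t * (\<bar>h x - 1\<bar> * (h x + 1)) \<le> t\<^sup>2 * (h x - 1)\<^sup>2 + (h x + 1)\<^sup>2"
      by (simp add: power2_diff power_mult_distrib)
    moreover have "\<bar>h x - 1\<bar> * (h x + 1) = \<bar>ratio B x - 1\<bar>"
    proof -
      have "\<bar>h x - 1\<bar> * (h x + 1) = \<bar>(h x - 1) * (h x + 1)\<bar>" using h0[of x] by (simp add: abs_mult)
      also have "(h x - 1) * (h x + 1) = ratio B x - 1" by (simp add: h2[symmetric] power2_eq_square algebra_simps)
      finally show ?thesis .
    qed
    moreover have "(h x - 1)\<^sup>2 = ratio B x - 2 * h x + 1" by (simp add: h2[symmetric] power2_diff)
    moreover have "(h x + 1)\<^sup>2 \<le> 2 * (ratio B x + 1)"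
      using zero_le_power2[of "h x - 1"] by (simp add: h2[symmetric] power2_diff power2_sum)
    ultimately have "2 * t * \<bar>ratio B x - 1\<bar> \<le> t\<^sup>2 * (ratio B x - 2 * h x + 1) + 2 * (ratio B x + 1)"
      by simp
    then show ?thesis using t by (simp add: field_simps power2_eq_square)
  qed
  have "(\<integral>x. \<bar>ratio B x - 1\<bar> \<partial>base) \<le> (\<integral>x. t / 2 * (ratio B x - 2 * h x + 1) + (ratio B x + 1) / t \<partial>base)"
    using ratio_integrable hi pt by (intro integral_mono) auto
  also have "\<dots> = t / 2 * (2 - 2 * (\<integral>x. h x \<partial>base)) + 2 / t"
    using ratio_integrable hi ratio_integral base.prob_space by simp
  also have "\<dots> \<le> t / 2 * (2 * (a\<^sup>2 * frob B / (8 * b\<^sup>2))) + 2 / t"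
    using Eh t by (intro add_right_mono mult_left_mono) linarith+
  also have "\<dots> \<le> t / 2 * (2 * (a\<^sup>2 * s\<^sup>2 / (8 * b\<^sup>2))) + 2 / t"
    using F t b by (intro add_right_mono mult_left_mono divide_right_mono) auto
  also have "\<dots> = a / b * s"
    using a b s by (simp add: t_def field_simps power2_eq_square)
  finally show ?thesis .
qed

text \<open>The statistic \<open>T\<close> pairs the residuals under \<open>B\<close> with the
  difference \<open>E u\<close> of the two regression means; up to a factor it is the linear part of
  the log-likelihood ratio. Given \<open>u\<close> it has mean 0 under \<open>B\<close> and mean
  \<open>qf E u\<close> under \<open>B'\<close>. The test function (1 + sin (l T))/2 therefore has
  mean 1/2 under \<open>B\<close>, and its mean under \<open>B'\<close> is bounded below by
  \<open>sin_exp_ge\<close> and the moments of \<open>qf\<close>.\<close>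

lemma tv_model_ge:
  "min 1 (a / b * sqrt (frob (\<lambda>j i. B' j i - B j i))) / 16 \<le> tv_dist (model B') (model B)"
proof -
  define E where "E j i = B' j i - B j i" for j i
  define s where "s = a / b * sqrt (frob E)"
  define M where "M = max 1 s"
  \<comment> \<open>The mean of \<open>l * T\<close> under \<open>B'\<close> is
    \<open>l b^2 s^2 = s / (4 M)\<close>: it is s/4 up to \<open>s = 1\<close> and held at 1/4 from
    there on, which keeps the quadratic error below the linear gain.\<close>
  define l where "l = 1 / (4 * b\<^sup>2 * s * M)"
  interpret cov: prob_space covariates by (rule prob_space_covariates)
  have goal_eq: "a / b * sqrt (frob (\<lambda>j i. B' j i - B j i)) = s"
    by (simp add: s_def E_def[abs_def])
  note tv = integral_density_le_tv[OF prob_space_model[unfolded model_def] prob_space_model[unfolded model_def]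
      measurable_ratio measurable_ratio _ ratio_pos[THEN less_imp_le] ratio_pos[THEN less_imp_le], folded model_def]
  have s_nonneg: "0 \<le> s" using a b frob_nonneg by (simp add: s_def)
  show ?thesis
  \<comment> \<open>The frequency \<open>l\<close> makes no sense for \<open>s = 0\<close>; there
    the claim is that the distance is nonnegative, seen from the test function 0.\<close>
  proof (cases "s = 0")
    case True
    have "0 \<le> tv_dist (model B') (model B)"
      using tv[of "\<lambda>_. 0" B' B] by simp
    then show ?thesis unfolding goal_eq using True by simp
  next
    case False
    then have s0: "0 < s" using s_nonneg by simp
  have M1: "1 \<le> M" "s \<le> M" by (auto simp: M_def)
  define T where "T x = (\<Sum>j=m..<d. (x j - lin B x j) * lin E x j)" for x
  define f where "f x = (1 + sin (l * T x)) / 2" for x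
  have f01: "0 \<le> f x \<and> f x \<le> 1" for x
  proof -
    have "0 \<le> (1 + y) / 2 \<and> (1 + y) / 2 \<le> 1" if "-1 \<le> y" "y \<le> 1" for y :: real
      using that by simp
    then show ?thesis unfolding f_def using sin_ge_minus_one sin_le_one by blast
  qed
  have [measurable]: "T \<in> borel_measurable base"
  proof -
    note [measurable] = measurable_coord measurable_lin
    show ?thesis unfolding T_def[abs_def] by measurable
  qed
  have fm [measurable]: "f \<in> borel_measurable base" unfolding f_def[abs_def] by measurable
  \<comment> \<open>Computed for an arbitrary matrix \<open>C\<close>, to be used with
    \<open>B\<close> and with \<open>B'\<close>.\<close>
  have inner: "(\<integral>v. f (merge {..<m} {m..<d} (u, v)) \<partial>responses (lin C u))
      = (1 + sin (l * (\<Sum>j=m..<d. (lin C u j - lin B u j) * lin E u j)) * exp (- b\<^sup>2 * l\<^sup>2 * qf E u / 2)) / 2"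
    if u: "u \<in> space covariates" for u C
  proof -
    interpret R: prob_space "responses (lin C u)" by (rule prob_space_responses)
    let ?k = "- (l * (\<Sum>j=m..<d. lin B u j * lin E u j))"
    have Tm: "l * T (merge {..<m} {m..<d} (u, v)) = (\<Sum>j=m..<d. (l * lin E u j) * v j) + ?k" for v
    proof -
      have "T (merge {..<m} {m..<d} (u, v)) = (\<Sum>j=m..<d. (v j - lin B u j) * lin E u j)"
        unfolding T_def lin_merge by (intro sum.cong) (auto simp: merge_def)
      then show ?thesis
        by (simp add: sum_distrib_left sum_subtractf[symmetric] algebra_simps)
    qed
    have "(\<lambda>v. l * T (merge {..<m} {m..<d} (u, v))) \<in> borel_measurable (responses (lin C u))"
      using measurable_compose[OF measurable_merge_base[OF u] \<open>T \<in> borel_measurable base\<close>] by measurable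
    then have int: "integrable (responses (lin C u)) (\<lambda>v. sin (l * T (merge {..<m} {m..<d} (u, v))))"
      by (intro R.integrable_const_bound[where B=1]) auto
    have "(\<integral>v. sin (l * T (merge {..<m} {m..<d} (u, v))) \<partial>responses (lin C u))
        = sin ((\<Sum>j=m..<d. (l * lin E u j) * lin C u j) + ?k) * exp (- b\<^sup>2 * (\<Sum>j=m..<d. (l * lin E u j)\<^sup>2) / 2)"
      unfolding Tm by (rule lincomb_normal_sin) (use b in auto)
    also have "(\<Sum>j=m..<d. (l * lin E u j) * lin C u j) + ?k = l * (\<Sum>j=m..<d. (lin C u j - lin B u j) * lin E u j)"
      by (simp add: sum_distrib_left sum_subtractf[symmetric] algebra_simps)
    also have "(\<Sum>j=m..<d. (l * lin E u j)\<^sup>2) = l\<^sup>2 * qf E u"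
      by (simp add: qf_def sum_distrib_left power_mult_distrib)
    finally show ?thesis
      unfolding f_def using int R.prob_space by (simp add: mult.assoc)
  qed
  have linE: "lin B' u j - lin B u j = lin E u j" for u j
    by (simp add: lin_def E_def sum_subtractf[symmetric] algebra_simps)
  let ?g = "\<lambda>u. (1 + sin (l * qf E u) * exp (- b\<^sup>2 * l\<^sup>2 * qf E u / 2)) / 2"
  have "(\<integral>x. f x \<partial>model B) = (\<integral>u. 1 / 2 \<partial>covariates)"
    by (rule integral_model[OF fm f01]) (simp_all add: inner)
  then have fB: "(\<integral>x. f x \<partial>model B) = 1 / 2" using cov.prob_space by simp
  have fB': "(\<integral>x. f x \<partial>model B') = (\<integral>u. ?g u \<partial>covariates)"
  proof (rule integral_model[OF fm f01])
    show "?g \<in> borel_measurable covariates" by measurable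
    show "(\<integral>v. f (merge {..<m} {m..<d} (u, v)) \<partial>responses (lin B' u)) = ?g u"
      if "u \<in> space covariates" for u
      unfolding inner[OF that] linE by (simp add: qf_def power2_eq_square)
  qed
  have l0: "0 < l" using b M1 s0 by (simp add: l_def)
  let ?L = "\<lambda>u. (1 + (l * qf E u - (l\<^sup>2 / 2 + l ^ 3 * b\<^sup>2 / 2) * (qf E u)\<^sup>2)) / 2"
  have "(\<integral>u. ?L u \<partial>covariates) \<le> (\<integral>u. ?g u \<partial>covariates)"
  proof (rule integral_mono)
    show "integrable covariates ?L" using qf_integrable qf_sq_integrable by simp
    show "integrable covariates ?g"
    proof (rule cov.integrable_const_bound[where B=1])
      have "norm (?g u) \<le> 1" for u
      proof -
        have "\<bar>sin (l * qf E u) * exp (- b\<^sup>2 * l\<^sup>2 * qf E u / 2)\<bar> \<le> 1 * 1"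
          unfolding abs_mult using qf_nonneg[of E u] by (intro mult_mono) auto
        moreover have "norm ((1 + y) / 2) \<le> 1" if "\<bar>y\<bar> \<le> 1 * 1" for y :: real
          using that by (simp add: abs_le_iff)
        ultimately show ?thesis by blast
      qed
      then show "AE u in covariates. norm (?g u) \<le> 1" by simp
    qed measurable
    fix u
    have "l * qf E u - (l * qf E u)\<^sup>2 / 2 - (l * qf E u) * (b\<^sup>2 * l\<^sup>2 * qf E u / 2)
        \<le> sin (l * qf E u) * exp (- (b\<^sup>2 * l\<^sup>2 * qf E u / 2))"
      using l0 qf_nonneg[of E u] by (intro sin_exp_ge) auto
    then show "?L u \<le> ?g u"
      by (simp add: power2_eq_square power3_eq_cube algebra_simps)
  qed
  moreover have "(\<integral>u. ?L u \<partial>covariates) = (1 + (l * (a\<^sup>2 * frob E) - (l\<^sup>2 / 2 + l ^ 3 * b\<^sup>2 / 2) * (\<integral>u. (qf E u)\<^sup>2 \<partial>covariates))) / 2"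
    using qf_integrable qf_sq_integrable qf_integral cov.prob_space by simp
  ultimately have 1: "(1 + (l * (a\<^sup>2 * frob E) - (l\<^sup>2 / 2 + l ^ 3 * b\<^sup>2 / 2) * (\<integral>u. (qf E u)\<^sup>2 \<partial>covariates))) / 2
      \<le> (\<integral>x. f x \<partial>model B')" using fB' by simp
  have "(l\<^sup>2 / 2 + l ^ 3 * b\<^sup>2 / 2) * (\<integral>u. (qf E u)\<^sup>2 \<partial>covariates)
      \<le> (l\<^sup>2 / 2 + l ^ 3 * b\<^sup>2 / 2) * (3 * a ^ 4 * (frob E)\<^sup>2)"
    using l0 by (intro mult_left_mono qf_sq_integral) auto
  then have 2: "(l * (a\<^sup>2 * frob E) - (l\<^sup>2 / 2 + l ^ 3 * b\<^sup>2 / 2) * (3 * a ^ 4 * (frob E)\<^sup>2)) / 2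
      \<le> (\<integral>x. f x \<partial>model B') - (\<integral>x. f x \<partial>model B)"
    using 1 fB by simp
  have aF: "a\<^sup>2 * frob E = b\<^sup>2 * s\<^sup>2"
    using b frob_nonneg[of E] by (simp add: s_def power_mult_distrib power_divide)
  have 3: "l * (a\<^sup>2 * frob E) - (l\<^sup>2 / 2 + l ^ 3 * b\<^sup>2 / 2) * (3 * a ^ 4 * (frob E)\<^sup>2)
      = x - 3 / 2 * x\<^sup>2 * (1 + l * b\<^sup>2)" if "x = l * (b\<^sup>2 * s\<^sup>2)" for x
    unfolding that aF[symmetric] by (simp add: power2_eq_square power3_eq_cube power4_eq_xxxx algebra_simps)
  define x where "x = l * (b\<^sup>2 * s\<^sup>2)"
  have x: "x = s / M / 4" and lb: "l * b\<^sup>2 = 1 / (4 * s * M)"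
    using b s0 M1 by (auto simp: x_def l_def power2_eq_square field_simps)
  have sM: "0 \<le> s / M" "s / M \<le> 1" using s0 M1 by auto
  have "(s / M)\<^sup>2 \<le> s / M"
    using mult_left_mono[OF sM(2) sM(1)] by (simp add: power2_eq_square)
  then have x2: "x\<^sup>2 \<le> s / M / 16" by (simp add: x power_divide)
  have "x\<^sup>2 * (l * b\<^sup>2) = s / M / 64 * (1 / M\<^sup>2)"
    unfolding lb x using s0 M1 by (simp add: power2_eq_square field_simps)
  also have "\<dots> \<le> s / M / 64 * 1"
    using sM M1 by (intro mult_left_mono) auto
  finally have x3: "x\<^sup>2 * (l * b\<^sup>2) \<le> s / M / 64" by simp
  \<comment> \<open>With \<open>r = s / M\<close> the right side is at least (1/4 - 3/2 (1/16 +
    1/64)) r = 17/128 r.\<close>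
  have "s / M / 8 \<le> x - 3 / 2 * (x\<^sup>2 + x\<^sup>2 * (l * b\<^sup>2))"
  proof -
    have "r / 8 \<le> y - 3 / 2 * (p + q)" if "y = r / 4" "p \<le> r / 16" "q \<le> r / 64" "0 \<le> r" for r y p q :: real
      using that by (simp add: field_simps)
    from this[OF x x2 x3 sM(1)] show ?thesis .
  qed
  also have "\<dots> = x - 3 / 2 * x\<^sup>2 * (1 + l * b\<^sup>2)" by (simp add: algebra_simps)
  finally have "s / M / 16 \<le> (\<integral>x. f x \<partial>model B') - (\<integral>x. f x \<partial>model B)"
    using 2 unfolding 3[OF x_def] by simp
  also have "\<dots> \<le> tv_dist (model B') (model B)"
    by (rule tv[OF fm f01])
  also have "s / M = min 1 s" using s0 by (auto simp: M_def max_def min_def)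
  finally show ?thesis unfolding goal_eq by simp
  qed
qed

end

section \<open>Gaussian measures with positive definite covariance\<close>

lemma mat_inverse_eqI:
  fixes A :: "'a :: field mat"
  assumes A: "A \<in> carrier_mat d d" and X: "X \<in> carrier_mat d d" and AX: "A * X = 1\<^sub>m d"
  shows "mat_inverse A = Some X"
proof -
  have dA: "Determinant.det A \<noteq> 0"
    using det_mult[OF A X] AX by auto
  then have "A \<in> Units (ring_mat TYPE('a) d ())" by (rule det_non_zero_imp_unit[OF A])
  then obtain Y where Y: "mat_inverse A = Some Y"
    using mat_inverse(1)[OF A, of "()"] by (cases "mat_inverse A") auto
  from mat_inverse(2)[OF A Y] have YA: "Y * A = 1\<^sub>m d" and Yc: "Y \<in> carrier_mat d d" by auto
  have "Y = Y * (A * X)" using AX Yc by simp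
  also have "\<dots> = (Y * A) * X" using Yc A X by (simp add: assoc_mult_mat)
  also have "\<dots> = X" using YA X by simp
  finally show ?thesis using Y by simp
qed

lemma scalar_prod_mult_mat_vec:
  fixes X :: "real mat"
  assumes "X \<in> carrier_mat d d" "v \<in> carrier_vec d" "w \<in> carrier_vec d"
  shows "scalar_prod v (X *\<^sub>v w) = (\<Sum>i<d. \<Sum>j<d. v $ i * X $$ (i, j) * w $ j)"
  using assms
  by (simp add: scalar_prod_def sum_distrib_left mult.assoc atLeast0LessThan)

text \<open>The sum of the moduli of the entries serves as an explicit bound for the largest
  eigenvalue, from |w_i w_j| \<le> |w|^2.\<close>

lemma quadratic_form_le:
  fixes A :: "real mat"
  assumes A: "A \<in> carrier_mat d d" and w: "w \<in> carrier_vec d"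
  shows "scalar_prod w (A *\<^sub>v w) \<le> (\<Sum>i<d. \<Sum>j<d. \<bar>A $$ (i, j)\<bar>) * scalar_prod w w"
proof -
  have sq: "scalar_prod w w = (\<Sum>i<d. (w $ i)\<^sup>2)"
    using w by (simp add: scalar_prod_def power2_eq_square atLeast0LessThan)
  have le: "(w $ i)\<^sup>2 \<le> scalar_prod w w" if "i < d" for i
    unfolding sq by (rule member_le_sum) (use that in auto)
  have "w $ i * A $$ (i, j) * w $ j \<le> \<bar>A $$ (i, j)\<bar> * scalar_prod w w" if "i < d" "j < d" for i j
  proof -
    have "0 \<le> (\<bar>w $ i\<bar> - \<bar>w $ j\<bar>)\<^sup>2" by simp
    then have "2 * \<bar>w $ i * w $ j\<bar> \<le> (w $ i)\<^sup>2 + (w $ j)\<^sup>2"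
      by (simp add: power2_diff abs_mult)
    then have "\<bar>w $ i * w $ j\<bar> \<le> scalar_prod w w"
      using le[OF that(1)] le[OF that(2)] by linarith
    then have "\<bar>A $$ (i, j)\<bar> * \<bar>w $ i * w $ j\<bar> \<le> \<bar>A $$ (i, j)\<bar> * scalar_prod w w"
      by (rule mult_left_mono) simp
    moreover have "w $ i * A $$ (i, j) * w $ j \<le> \<bar>A $$ (i, j)\<bar> * \<bar>w $ i * w $ j\<bar>"
      using abs_ge_self[of "A $$ (i, j) * (w $ i * w $ j)"] by (simp add: abs_mult mult_ac)
    ultimately show ?thesis by linarith
  qed
  then show ?thesis
    unfolding scalar_prod_mult_mat_vec[OF A w w] sum_distrib_right by (intro sum_mono) auto
qed

text \<open>
  With \<open>z = A\<^sup>-\<^sup>1 y\<close> the form \<open>y \<bullet> A\<^sup>-\<^sup>1 y = z \<bullet> A z\<close> is bounded below by testing positivity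
  of \<open>A\<close> on \<open>z - A z / K\<close>.
\<close>

lemma pd_inverse_coercive:
  assumes pd: "pd_mat d A"
  obtains X K where "X \<in> carrier_mat d d" "mat_inverse A = Some X" "0 < K"
    "\<And>y. y \<in> carrier_vec d \<Longrightarrow> scalar_prod y y / K \<le> scalar_prod y (X *\<^sub>v y)"
proof -
  have A: "A \<in> carrier_mat d d" and sym: "A\<^sup>T = A"
    and pos: "\<And>v. v \<in> carrier_vec d \<Longrightarrow> v \<noteq> 0\<^sub>v d \<Longrightarrow> 0 < scalar_prod v (A *\<^sub>v v)"
    using pd by (auto simp: pd_mat_def)
  have nonneg: "0 \<le> scalar_prod v (A *\<^sub>v v)" if v: "v \<in> carrier_vec d" for v
  proof (cases "v = 0\<^sub>v d")
    case True
    then show ?thesis using A by (simp add: scalar_prod_def)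
  qed (use pos[OF v] in simp)
  have "Determinant.det A \<noteq> 0"
  proof
    assume "Determinant.det A = 0"
    then obtain v where v: "v \<in> carrier_vec d" "v \<noteq> 0\<^sub>v d" "A *\<^sub>v v = 0\<^sub>v d"
      using det_0_iff_vec_prod_zero_field[OF A] by auto
    with pos[OF v(1,2)] show False by simp
  qed
  then have "A \<in> Units (ring_mat TYPE(real) d ())" by (rule det_non_zero_imp_unit[OF A])
  then obtain X where X: "mat_inverse A = Some X"
    using mat_inverse(1)[OF A, of "()"] by (cases "mat_inverse A") auto
  from mat_inverse(2)[OF A X] have AX: "A * X = 1\<^sub>m d" and Xc: "X \<in> carrier_mat d d" by auto
  define K where "K = 1 + (\<Sum>i<d. \<Sum>j<d. \<bar>A $$ (i, j)\<bar>)"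
  have K1: "1 \<le> K" by (simp add: K_def sum_nonneg)
  have "scalar_prod y y / K \<le> scalar_prod y (X *\<^sub>v y)" if y: "y \<in> carrier_vec d" for y
  proof -
    define z where "z = X *\<^sub>v y"
    have z: "z \<in> carrier_vec d" using Xc y by (simp add: z_def)
    have Az: "A *\<^sub>v z = y"
      unfolding z_def using A Xc y AX by (simp add: assoc_mult_mat_vec[symmetric])
    \<comment> \<open>\<open>K\<close> bounds \<open>A\<close> from above, so with this factor the
      quadratic term of the expansion is at most y \<bullet> y / K and takes back at most half of
      the linear term - 2 y \<bullet> y / K.\<close>
    let ?t = "- 1 / K"
    let ?u = "z + ?t \<cdot>\<^sub>v y"
    have Ay: "A *\<^sub>v y \<in> carrier_vec d" using A y by simp
    have Au: "A *\<^sub>v ?u = y + ?t \<cdot>\<^sub>v (A *\<^sub>v y)"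
      using A z y by (simp add: mult_add_distrib_mat_vec mult_mat_vec Az)
    have zAy: "scalar_prod z (A *\<^sub>v y) = scalar_prod y y"
    proof -
      have "scalar_prod z (A *\<^sub>v y) = scalar_prod (A\<^sup>T *\<^sub>v z) y"
        using transpose_vec_mult_scalar[OF A y z] by simp
      then show ?thesis using sym Az by simp
    qed
    have zy: "scalar_prod z y = scalar_prod y z" using z y by (rule comm_scalar_prod)
    have yy: "0 \<le> scalar_prod y y" by (simp add: scalar_prod_def sum_nonneg)
    have "0 \<le> scalar_prod ?u (A *\<^sub>v ?u)" using z y by (intro nonneg) simp
    also have "\<dots> = scalar_prod y z + 2 * ?t * scalar_prod y y + ?t\<^sup>2 * scalar_prod y (A *\<^sub>v y)"
      unfolding Au using z y Ay
      by (simp add: add_scalar_prod_distrib[of _ d] scalar_prod_add_distrib[of _ d] zAy zy power2_eq_square algebra_simps)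
    also have "?t\<^sup>2 * scalar_prod y (A *\<^sub>v y) \<le> ?t\<^sup>2 * (K * scalar_prod y y)"
    proof (rule mult_left_mono)
      have "scalar_prod y (A *\<^sub>v y) \<le> (K - 1) * scalar_prod y y"
        using quadratic_form_le[OF A y] by (simp add: K_def)
      then show "scalar_prod y (A *\<^sub>v y) \<le> K * scalar_prod y y" using yy by (simp add: algebra_simps)
    qed simp
    also have "scalar_prod y z + 2 * ?t * scalar_prod y y + ?t\<^sup>2 * (K * scalar_prod y y) = scalar_prod y z - scalar_prod y y / K"
      using K1 by (simp add: power2_eq_square field_simps)
    finally show ?thesis by (simp add: z_def)
  qed
  then show ?thesis using that[of X K] Xc X K1 by simp
qed

section \<open>Finite mass and the triangle inequality for total variation\<close>

lemma product_sigma_finite_lborel: "product_sigma_finite (\<lambda>_. lborel :: real measure)"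
  by (simp add: product_sigma_finite_def lborel.sigma_finite_measure_axioms)

text \<open>An accurate output may be any positive definite matrix. Coercivity of the inverse
  dominates its density by a product of one-dimensional Gaussians, which gives the finite mass that
  the triangle inequality asks for.\<close>

lemma finite_measure_gaussian:
  assumes pd: "pd_mat d A"
  shows "finite_measure (gaussian d A)"
proof -
  interpret L: product_sigma_finite "\<lambda>_. lborel :: real measure" by (rule product_sigma_finite_lborel)
  obtain X K where X: "X \<in> carrier_mat d d" and inv: "mat_inverse A = Some X" and K: "0 < K"
    and le: "\<And>y. y \<in> carrier_vec d \<Longrightarrow> scalar_prod y y / K \<le> scalar_prod y (X *\<^sub>v y)"
    using pd_inverse_coercive[OF pd] by blast
  let ?c = "sqrt ((2 * pi) ^ d * Determinant.det A)"
  let ?q = "\<lambda>x. scalar_prod (Matrix.vec d x) (X *\<^sub>v Matrix.vec d x)"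
  have q: "?q x = (\<Sum>i<d. \<Sum>j<d. x i * X $$ (i, j) * x j)" for x :: "nat \<Rightarrow> real"
    by (subst scalar_prod_mult_mat_vec[OF X]) auto
  have coord: "(\<lambda>x. x i) \<in> borel_measurable (lebesgue_vec d)" if "i < d" for i
    unfolding lebesgue_vec_def using measurable_component_singleton[of i "{..<d}" "\<lambda>_. lborel"] that by simp
  have qm: "?q \<in> borel_measurable (lebesgue_vec d)"
    unfolding q by (intro borel_measurable_sum borel_measurable_times coord borel_measurable_const) auto
  have fin1: "(\<integral>\<^sup>+t. ennreal (exp (- t\<^sup>2 / (2 * K))) \<partial>lborel) < \<infinity>"
  proof -
    have "(\<lambda>t. exp (- t\<^sup>2 / (2 * K))) = (\<lambda>t. sqrt (2 * pi * K) * normal_density 0 (sqrt K) t)"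
      using K by (auto simp: normal_density_def fun_eq_iff)
    moreover have "integrable lborel (\<lambda>t. sqrt (2 * pi * K) * normal_density 0 (sqrt K) t)"
      using K by simp
    ultimately have "integrable lborel (\<lambda>t. exp (- t\<^sup>2 / (2 * K)))" by simp
    from nn_integral_eq_integral[OF this] show ?thesis by simp
  qed
  have "emeasure (gaussian d A) (space (gaussian d A))
      = (\<integral>\<^sup>+x. ennreal (exp (- ?q x / 2) / ?c) \<partial>lebesgue_vec d)"
    unfolding gaussian_def inv option.sel using qm
    by (subst emeasure_density) (auto cong: nn_integral_cong)
  also have "\<dots> \<le> (\<integral>\<^sup>+x. ennreal (1 / ?c) * (\<Prod>i<d. ennreal (exp (- (x i)\<^sup>2 / (2 * K)))) \<partial>lebesgue_vec d)"
  proof (rule nn_integral_mono)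
    fix x :: "nat \<Rightarrow> real"
    have sx: "scalar_prod (Matrix.vec d x) (Matrix.vec d x) = (\<Sum>i<d. (x i)\<^sup>2)"
      by (simp add: scalar_prod_def power2_eq_square atLeast0LessThan)
    have "(\<Sum>i<d. (x i)\<^sup>2) / K \<le> ?q x"
      using le[of "Matrix.vec d x"] sx by simp
    then have "exp (- ?q x / 2) \<le> exp (- ((\<Sum>i<d. (x i)\<^sup>2) / K) / 2)" by simp
    also have "\<dots> = (\<Prod>i<d. exp (- (x i)\<^sup>2 / (2 * K)))"
      by (simp add: exp_sum[symmetric] sum_divide_distrib sum_negf[symmetric] mult.commute)
    finally have e: "exp (- ?q x / 2) \<le> (\<Prod>i<d. exp (- (x i)\<^sup>2 / (2 * K)))" .
    show "ennreal (exp (- ?q x / 2) / ?c) \<le> ennreal (1 / ?c) * (\<Prod>i<d. ennreal (exp (- (x i)\<^sup>2 / (2 * K))))"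
    \<comment> \<open>The sign of the determinant is left open: for a negative \<open>?c\<close> the
      density is negative and \<open>ennreal\<close> makes it 0.\<close>
    proof (cases "0 \<le> ?c")
      case True
      have "ennreal (exp (- ?q x / 2) / ?c) \<le> ennreal (1 / ?c * (\<Prod>i<d. exp (- (x i)\<^sup>2 / (2 * K))))"
        using e True by (intro ennreal_leI) (auto intro: divide_right_mono)
      also have "\<dots> = ennreal (1 / ?c) * (\<Prod>i<d. ennreal (exp (- (x i)\<^sup>2 / (2 * K))))"
        using True by (subst ennreal_mult) (auto intro!: prod_nonneg simp: prod_ennreal)
      finally show ?thesis .
    next
      case False
      then have "exp (- ?q x / 2) / ?c \<le> 0" by (intro divide_nonneg_nonpos) auto
      then show ?thesis by (simp add: ennreal_neg)
    qed
  qed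
  also have "\<dots> = ennreal (1 / ?c) * (\<integral>\<^sup>+x. (\<Prod>i<d. ennreal (exp (- (x i)\<^sup>2 / (2 * K)))) \<partial>lebesgue_vec d)"
  proof (rule nn_integral_cmult, rule borel_measurable_prod_ennreal)
    fix i assume "i \<in> {..<d}"
    then have [measurable]: "(\<lambda>x. x i) \<in> borel_measurable (lebesgue_vec d)" using coord by simp
    show "(\<lambda>x. ennreal (exp (- (x i)\<^sup>2 / (2 * K)))) \<in> borel_measurable (lebesgue_vec d)" by measurable
  qed
  also have "(\<integral>\<^sup>+x. (\<Prod>i<d. ennreal (exp (- (x i)\<^sup>2 / (2 * K)))) \<partial>lebesgue_vec d)
      = (\<Prod>i<d. \<integral>\<^sup>+t. ennreal (exp (- t\<^sup>2 / (2 * K))) \<partial>lborel)"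
    unfolding lebesgue_vec_def by (rule L.product_nn_integral_prod) auto
  also have "ennreal (1 / ?c) * \<dots> < \<infinity>"
  proof -
    have "(\<Prod>i<d. \<integral>\<^sup>+t. ennreal (exp (- t\<^sup>2 / (2 * K))) \<partial>lborel) < \<infinity>"
      using fin1 unfolding prod_constant by (induction d) (auto simp: ennreal_mult_less_top lessThan_Suc)
    then show ?thesis by (simp add: ennreal_mult_less_top)
  qed
  finally show ?thesis by (intro finite_measureI) auto
qed

text \<open>A real supremum is meaningful only for a set that is bounded above, which finite mass
  guarantees. \<open>tv_dist\<close> ranges over the sets of its first argument, so
  \<open>sets R = sets P\<close> lets both distances be applied to the same set.\<close>

lemma tv_dist_triangle:
  assumes P: "finite_measure P" and Q: "finite_measure Q" and R: "finite_measure R"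
    and sPR: "sets R = sets P"
    and 1: "tv_dist P Q < \<delta>" and 2: "tv_dist R Q < \<delta>"
  shows "tv_dist P R < 2 * \<delta>"
proof -
  have bdd: "bdd_above ((\<lambda>S. \<bar>measure P' S - measure Q' S\<bar>) ` sets P')"
    if "finite_measure P'" "finite_measure Q'" for P' Q' :: "'a measure"
  proof (rule bdd_aboveI2)
    fix S
    show "\<bar>measure P' S - measure Q' S\<bar> \<le> measure P' (space P') + measure Q' (space Q')"
      using finite_measure.bounded_measure[OF that(1), of S] finite_measure.bounded_measure[OF that(2), of S]
        measure_nonneg[of P' S] measure_nonneg[of Q' S] by linarith
  qed
  have "tv_dist P R \<le> tv_dist P Q + tv_dist R Q"
    unfolding tv_dist_def[of P R]
  proof (rule cSUP_least)
    show "sets P \<noteq> {}" by auto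
    fix S assume S: "S \<in> sets P"
    have "\<bar>measure P S - measure Q S\<bar> \<le> tv_dist P Q"
      unfolding tv_dist_def by (rule cSUP_upper[OF S bdd[OF P Q]])
    moreover have "\<bar>measure R S - measure Q S\<bar> \<le> tv_dist R Q"
      unfolding tv_dist_def by (rule cSUP_upper[OF _ bdd[OF R Q]]) (use S sPR in simp)
    ultimately show "\<bar>measure P S - measure R S\<bar> \<le> tv_dist P Q + tv_dist R Q" by linarith
  qed
  then show ?thesis using 1 2 by linarith
qed

section \<open>Covariance matrices of the regression model\<close>

lemma scalar_prod_transpose_mult:
  fixes K :: "real mat"
  assumes K: "K \<in> carrier_mat d d" and v: "v \<in> carrier_vec d"
  shows "scalar_prod v ((K\<^sup>T * K) *\<^sub>v v) = (\<Sum>i<d. ((K *\<^sub>v v) $ i)\<^sup>2)"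
proof -
  have KT: "K\<^sup>T \<in> carrier_mat d d" using K by simp
  have Kv: "K *\<^sub>v v \<in> carrier_vec d" using K v by simp
  have "scalar_prod v ((K\<^sup>T * K) *\<^sub>v v) = scalar_prod v (K\<^sup>T *\<^sub>v (K *\<^sub>v v))"
    using assoc_mult_mat_vec[OF KT K v] by simp
  also have "\<dots> = scalar_prod (K *\<^sub>v v) (K *\<^sub>v v)"
    using transpose_vec_mult_scalar[OF KT Kv v] by simp
  also have "\<dots> = (\<Sum>i<d. ((K *\<^sub>v v) $ i)\<^sup>2)"
    using K v by (simp add: scalar_prod_def power2_eq_square atLeast0LessThan)
  finally show ?thesis .
qed

lemma smult_one_mat_mult_vec:
  fixes c :: real
  assumes v: "v \<in> carrier_vec d"
  shows "(c \<cdot>\<^sub>m 1\<^sub>m d) *\<^sub>v v = c \<cdot>\<^sub>v v"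
proof (rule eq_vecI)
  fix i assume "i < dim_vec (c \<cdot>\<^sub>v v)"
  then have i: "i < d" using v by auto
  have "((c \<cdot>\<^sub>m 1\<^sub>m d) *\<^sub>v v) $ i = (\<Sum>k<d. (c \<cdot>\<^sub>m 1\<^sub>m d) $$ (i, k) * v $ k)"
    using i v by (auto simp: scalar_prod_def atLeast0LessThan intro!: sum.cong)
  also have "\<dots> = (\<Sum>k<d. if k = i then c * v $ i else 0)"
    using i by (intro sum.cong) auto
  finally have "((c \<cdot>\<^sub>m 1\<^sub>m d) *\<^sub>v v) $ i = (\<Sum>k<d. if k = i then c * v $ i else 0)" .
  then show "((c \<cdot>\<^sub>m 1\<^sub>m d) *\<^sub>v v) $ i = (c \<cdot>\<^sub>v v) $ i" using i v by simp
qed (use v in auto)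

lemma transpose_minus_symmetric:
  assumes A: "A \<in> carrier_mat d d" "A\<^sup>T = A" and B: "B \<in> carrier_mat d d" "B\<^sup>T = B"
  shows "(A - B)\<^sup>T = A - B"
proof (rule eq_matI)
  fix i j assume "i < dim_row (A - B)" "j < dim_col (A - B)"
  then have ij: "i < d" "j < d" using B by auto
  have "A $$ (j, i) = A $$ (i, j)" "B $$ (j, i) = B $$ (i, j)"
    using ij A B index_transpose_mat(1)[of i A j] index_transpose_mat(1)[of i B j] by auto
  then show "(A - B)\<^sup>T $$ (i, j) = (A - B) $$ (i, j)" using ij A B by simp
qed (use A B in auto)

lemma transpose_smult_one [simp]: "((c :: real) \<cdot>\<^sub>m 1\<^sub>m d)\<^sup>T = c \<cdot>\<^sub>m 1\<^sub>m d"
  by (rule eq_matI) auto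

lemma scalar_prod_minus_mat:
  fixes A B :: "real mat"
  assumes A: "A \<in> carrier_mat d d" and B: "B \<in> carrier_mat d d" and v: "v \<in> carrier_vec d"
  shows "scalar_prod v ((A - B) *\<^sub>v v) = scalar_prod v (A *\<^sub>v v) - scalar_prod v (B *\<^sub>v v)"
  using A B v by (simp add: minus_mult_distrib_mat_vec[OF A B v] scalar_prod_minus_distrib[of _ d])

lemma loewner_scalar_le:
  assumes A: "A \<in> carrier_mat d d" and sym: "A\<^sup>T = A"
    and q: "\<And>v. v \<in> carrier_vec d \<Longrightarrow> c * scalar_prod v v \<le> scalar_prod v (A *\<^sub>v v)"
  shows "loewner_le d (c \<cdot>\<^sub>m 1\<^sub>m d) A"
  unfolding loewner_le_def psd_mat_def
  using A q by (auto simp: scalar_prod_minus_mat[OF A] smult_one_mat_mult_vec intro!: transpose_minus_symmetric sym)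

lemma loewner_le_scalar:
  assumes A: "A \<in> carrier_mat d d" and sym: "A\<^sup>T = A"
    and q: "\<And>v. v \<in> carrier_vec d \<Longrightarrow> scalar_prod v (A *\<^sub>v v) \<le> c * scalar_prod v v"
  shows "loewner_le d A (c \<cdot>\<^sub>m 1\<^sub>m d)"
  unfolding loewner_le_def psd_mat_def
  using A q by (auto simp: scalar_prod_minus_mat[OF _ A] smult_one_mat_mult_vec intro!: transpose_minus_symmetric sym)

section \<open>Triangular factors of the covariance and the density of the model\<close>

context gauss_block
begin

abbreviation scale :: "nat \<Rightarrow> real" where
  "scale i \<equiv> if i < m then a else b"

text \<open>Applied to independent standard normal variables this gives a vector of the regression
  model; the factor \<open>a\<close> in \<open>a * B i j\<close> is the deviation of the
  covariates.\<close>

definition chol :: "(nat \<Rightarrow> nat \<Rightarrow> real) \<Rightarrow> real mat" where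
  "chol B = mat d d (\<lambda>(i, j). if i = j then scale i else if j < m \<and> m \<le> i then a * B i j else 0)"

text \<open>This standardises: covariates are divided by \<open>a\<close>, and a response is
  replaced by its residual over \<open>b\<close>.\<close>

definition chol_inv :: "(nat \<Rightarrow> nat \<Rightarrow> real) \<Rightarrow> real mat" where
  "chol_inv B = mat d d (\<lambda>(i, j). if i = j then 1 / scale i else if j < m \<and> m \<le> i then - B i j / b else 0)"

definition cov_mat :: "(nat \<Rightarrow> nat \<Rightarrow> real) \<Rightarrow> real mat" where
  "cov_mat B = chol B * (chol B)\<^sup>T"

lemma chol_carrier [simp]: "chol B \<in> carrier_mat d d" "chol_inv B \<in> carrier_mat d d"
  by (simp_all add: chol_def chol_inv_def)

lemma cov_mat_carrier [simp]: "cov_mat B \<in> carrier_mat d d"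
  unfolding cov_mat_def by (intro mult_carrier_mat[of _ d d]) auto

lemma cov_mat_symmetric: "(cov_mat B)\<^sup>T = cov_mat B"
  unfolding cov_mat_def by (subst transpose_mult[of _ d d _ d]) auto

lemma sum_lower_row:
  fixes f :: "nat \<Rightarrow> real"
  assumes i: "i < d"
  shows "(\<Sum>k<d. (if i = k then x else if k < m \<and> m \<le> i then g k else 0) * f k)
    = x * f i + (if m \<le> i then (\<Sum>k<m. g k * f k) else 0)"
proof -
  have "(\<Sum>k<d. (if i = k then x else if k < m \<and> m \<le> i then g k else 0) * f k)
     = (\<Sum>k<d. (if i = k then x * f k else 0) + (if k < m \<and> m \<le> i then g k * f k else 0))"
    by (intro sum.cong) auto
  also have "\<dots> = x * f i + (\<Sum>k<d. if k < m \<and> m \<le> i then g k * f k else 0)"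
    using i by (simp add: sum.distrib)
  also have "(\<Sum>k<d. if k < m \<and> m \<le> i then g k * f k else 0) = (if m \<le> i then (\<Sum>k<m. g k * f k) else 0)"
  proof (cases "m \<le> i")
    case True
    have "{..<d} \<inter> {k. k < m} = {..<m}" using md by auto
    then show ?thesis using True by (simp add: sum.inter_restrict[symmetric] Int_def lessThan_def[symmetric] flip: sum.inter_filter)
  qed simp
  finally show ?thesis .
qed

lemma chol_inv_mult: "chol_inv B * chol B = 1\<^sub>m d"
proof (rule eq_matI)
  fix i j assume "i < dim_row (1\<^sub>m d :: real mat)" "j < dim_col (1\<^sub>m d :: real mat)"
  then have i: "i < d" and j: "j < d" by auto
  have "(chol_inv B * chol B) $$ (i, j) = (\<Sum>k<d. chol_inv B $$ (i, k) * chol B $$ (k, j))"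
    using i j by (simp add: scalar_prod_def atLeast0LessThan chol_def chol_inv_def)
  also have "\<dots> = (\<Sum>k<d. (if i = k then 1 / scale i else if k < m \<and> m \<le> i then - B i k / b else 0) * chol B $$ (k, j))"
    using i by (intro sum.cong) (auto simp: chol_inv_def)
  also have "\<dots> = 1 / scale i * chol B $$ (i, j) + (if m \<le> i then (\<Sum>k<m. - B i k / b * chol B $$ (k, j)) else 0)"
    by (rule sum_lower_row[OF i])
  also have "(\<Sum>k<m. - B i k / b * chol B $$ (k, j)) = (if j < m then - B i j / b * a else 0)"
  proof -
    have "(\<Sum>k<m. - B i k / b * chol B $$ (k, j)) = (\<Sum>k<m. if k = j then - B i j / b * a else 0)"
      using md j by (intro sum.cong) (auto simp: chol_def)
    then show ?thesis by simp
  qed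
  finally show "(chol_inv B * chol B) $$ (i, j) = 1\<^sub>m d $$ (i, j)"
    using i j a b by (auto simp: chol_def)
qed (auto simp: chol_def chol_inv_def)

lemma mat_inverse_cov_mat: "mat_inverse (cov_mat B) = Some ((chol_inv B)\<^sup>T * chol_inv B)"
proof (rule mat_inverse_eqI)
  let ?L = "chol B" and ?K = "chol_inv B"
  show KK: "?K\<^sup>T * ?K \<in> carrier_mat d d" by (intro mult_carrier_mat[of _ d d]) auto
  have LK: "?L * ?K = 1\<^sub>m d"
    by (rule mat_mult_left_right_inverse[OF _ _ chol_inv_mult]) auto
  have "?L\<^sup>T * ?K\<^sup>T = (?K * ?L)\<^sup>T"
    by (rule transpose_mult[symmetric, of _ d d _ d]) auto
  then have T: "?L\<^sup>T * ?K\<^sup>T = 1\<^sub>m d" by (simp add: chol_inv_mult)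
  have "cov_mat B * (?K\<^sup>T * ?K) = ?L * (?L\<^sup>T * (?K\<^sup>T * ?K))"
    unfolding cov_mat_def by (rule assoc_mult_mat[of _ d d _ d _ d]) (use KK in auto)
  also have "?L\<^sup>T * (?K\<^sup>T * ?K) = (?L\<^sup>T * ?K\<^sup>T) * ?K"
    by (rule assoc_mult_mat[symmetric, of _ d d _ d _ d]) auto
  also have "\<dots> = ?K" unfolding T by (rule left_mult_one_mat[of _ _ d]) auto
  finally show "cov_mat B * (?K\<^sup>T * ?K) = 1\<^sub>m d" using LK by simp
qed auto

lemma det_cov_mat: "Determinant.det (cov_mat B) = (\<Prod>i<d. (scale i)\<^sup>2)"
proof -
  have "Determinant.det (chol B) = prod_list (diag_mat (chol B))"
    by (rule det_lower_triangular[of d]) (auto simp: chol_def)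
  also have "\<dots> = (\<Prod>i<d. scale i)"
    unfolding prod_list_diag_prod
    by (rule prod.cong) (auto simp: chol_def)
  finally have L: "Determinant.det (chol B) = (\<Prod>i<d. scale i)" .
  have "Determinant.det (cov_mat B) = Determinant.det (chol B) * Determinant.det ((chol B)\<^sup>T)"
    unfolding cov_mat_def by (rule det_mult[of _ d]) auto
  also have "Determinant.det ((chol B)\<^sup>T) = Determinant.det (chol B)"
    by (rule det_transpose[of _ d]) auto
  finally show ?thesis by (simp only: L prod.distrib[symmetric] power2_eq_square)
qed

lemma precision_form:
  "scalar_prod (Matrix.vec d x) (((chol_inv B)\<^sup>T * chol_inv B) *\<^sub>v Matrix.vec d x)
    = (\<Sum>i<d. ((x i - (if i < m then 0 else lin B x i)) / scale i)\<^sup>2)"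
proof -
  have "(chol_inv B *\<^sub>v Matrix.vec d x) $ i = (x i - (if i < m then 0 else lin B x i)) / scale i" if i: "i < d" for i
  proof -
    have "(chol_inv B *\<^sub>v Matrix.vec d x) $ i = (\<Sum>k<d. chol_inv B $$ (i, k) * x k)"
      using i by (simp add: scalar_prod_def atLeast0LessThan chol_inv_def)
    also have "\<dots> = (\<Sum>k<d. (if i = k then 1 / scale i else if k < m \<and> m \<le> i then - B i k / b else 0) * x k)"
      using i by (intro sum.cong) (auto simp: chol_inv_def)
    also have "\<dots> = 1 / scale i * x i + (if m \<le> i then (\<Sum>k<m. - B i k / b * x k) else 0)"
      by (rule sum_lower_row[OF i])
    also have "(\<Sum>k<m. - B i k / b * x k) = - lin B x i / b"
      by (simp add: lin_def sum_divide_distrib sum_negf)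
    finally show ?thesis by (auto simp: diff_divide_distrib)
  qed
  then show ?thesis
    by (subst scalar_prod_transpose_mult[of _ d]) auto
qed

text \<open>The two Lebesgue densities are compared: the determinant gives the normalising constants
  of the coordinates, and in the exponent the square is completed for each response. The mass, the
  disintegration and the distances found for \<open>model\<close> thus hold for
  \<open>gaussian\<close>.\<close>

lemma gaussian_cov_mat: "gaussian d (cov_mat B) = model B"
proof -
  let ?\<phi> = "\<lambda>i x. normal_density 0 (scale i) x"
  have sc: "0 < scale i" for i using a b by simp
  have base: "base = density (lebesgue_vec d) (\<lambda>x. \<Prod>i<d. ennreal (?\<phi> i (x i)))"
    unfolding base_def lebesgue_vec_def normal_measure_def
    by (rule PiM_density) (auto intro!: prob_space_normal_density lborel.sigma_finite_measure_axioms sc simp: a b)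
  have coord: "(\<lambda>x. x i) \<in> borel_measurable (lebesgue_vec d)" if "i < d" for i
    unfolding lebesgue_vec_def using measurable_component_singleton[of i "{..<d}" "\<lambda>_. lborel"] that by simp
  have pm: "(\<lambda>x. \<Prod>i<d. ennreal (?\<phi> i (x i))) \<in> borel_measurable (lebesgue_vec d)"
  proof (rule borel_measurable_prod_ennreal)
    fix i assume "i \<in> {..<d}"
    then have [measurable]: "(\<lambda>x. x i) \<in> borel_measurable (lebesgue_vec d)" using coord by simp
    show "(\<lambda>x. ennreal (?\<phi> i (x i))) \<in> borel_measurable (lebesgue_vec d)" by measurable
  qed
  have rm: "(\<lambda>x. ennreal (ratio B x)) \<in> borel_measurable (lebesgue_vec d)"
  proof -
    have "sets base = sets (lebesgue_vec d)" by (simp add: base)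
    from measurable_cong_sets[OF this refl] have "ratio B \<in> borel_measurable (lebesgue_vec d)"
      using measurable_ratio by blast
    then show ?thesis by measurable
  qed
  have "model B = density (lebesgue_vec d) (\<lambda>x. (\<Prod>i<d. ennreal (?\<phi> i (x i))) * ennreal (ratio B x))"
    unfolding model_def base by (rule density_density_eq[OF pm rm])
  moreover have "(\<Prod>i<d. ennreal (?\<phi> i (x i))) * ennreal (ratio B x)
     = ennreal (exp (- (\<Sum>i<d. ((x i - (if i < m then 0 else lin B x i)) / scale i)\<^sup>2) / 2)
         / sqrt ((2 * pi) ^ d * (\<Prod>i<d. (scale i)\<^sup>2)))" for x
  proof -
    have "(\<Prod>i<d. ennreal (?\<phi> i (x i))) * ennreal (ratio B x) = ennreal ((\<Prod>i<d. ?\<phi> i (x i)) * ratio B x)"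
      using ratio_pos[of B x] by (simp add: prod_ennreal normal_density_nonneg prod_nonneg ennreal_mult')
    also have "(\<Prod>i<d. ?\<phi> i (x i)) = exp (- (\<Sum>i<d. (x i / scale i)\<^sup>2) / 2) / sqrt ((2 * pi) ^ d * (\<Prod>i<d. (scale i)\<^sup>2))"
    proof -
      have "(\<Prod>i<d. ?\<phi> i (x i)) = (\<Prod>i<d. exp (- (x i / scale i)\<^sup>2 / 2)) / (\<Prod>i<d. sqrt (2 * pi * (scale i)\<^sup>2))"
        unfolding prod_dividef[symmetric] normal_density_def
        by (intro prod.cong refl) (simp add: power_divide)
      also have "(\<Prod>i<d. exp (- (x i / scale i)\<^sup>2 / 2)) = exp (- (\<Sum>i<d. (x i / scale i)\<^sup>2) / 2)"
        by (simp add: exp_sum[symmetric] sum_divide_distrib sum_negf)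
      also have "(\<Prod>i<d. sqrt (2 * pi * (scale i)\<^sup>2)) = sqrt ((2 * pi) ^ d * (\<Prod>i<d. (scale i)\<^sup>2))"
      proof -
        have "(\<Prod>i<n. sqrt (f i)) = sqrt (\<Prod>i<n. f i)" for f :: "nat \<Rightarrow> real" and n
          by (induction n) (auto simp: real_sqrt_mult)
        then show ?thesis by (simp only: prod.distrib prod_constant card_lessThan power_mult_distrib)
      qed
      finally show ?thesis .
    qed
    also have "exp (- (\<Sum>i<d. (x i / scale i)\<^sup>2) / 2) / sqrt ((2 * pi) ^ d * (\<Prod>i<d. (scale i)\<^sup>2)) * ratio B x
       = exp (- (\<Sum>i<d. (x i / scale i)\<^sup>2) / 2 + (\<Sum>j=m..<d. x j * lin B x j - (lin B x j)\<^sup>2 / 2) / b\<^sup>2)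
         / sqrt ((2 * pi) ^ d * (\<Prod>i<d. (scale i)\<^sup>2))"
      unfolding ratio_def exp_add by simp
    also have "- (\<Sum>i<d. (x i / scale i)\<^sup>2) / 2 + (\<Sum>j=m..<d. x j * lin B x j - (lin B x j)\<^sup>2 / 2) / b\<^sup>2
       = - (\<Sum>i<d. ((x i - (if i < m then 0 else lin B x i)) / scale i)\<^sup>2) / 2"
    proof -
      have "(\<Sum>j=m..<d. (x j * lin B x j - (lin B x j)\<^sup>2 / 2) / b\<^sup>2)
          = (\<Sum>j<d. if j < m then 0 else (x j * lin B x j - (lin B x j)\<^sup>2 / 2) / b\<^sup>2)"
        by (rule sum.mono_neutral_cong_left) auto
      moreover have "- (x i / scale i)\<^sup>2 / 2 + (if i < m then 0 else (x i * lin B x i - (lin B x i)\<^sup>2 / 2) / b\<^sup>2)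
          = - ((x i - (if i < m then 0 else lin B x i)) / scale i)\<^sup>2 / 2" for i
        using b by (simp add: field_simps power2_eq_square)
      ultimately show ?thesis
        by (simp only: sum_divide_distrib sum_negf[symmetric] sum.distrib[symmetric])
    qed
    finally show ?thesis .
  qed
  ultimately show ?thesis
    unfolding gaussian_def mat_inverse_cov_mat option.sel precision_form det_cov_mat by simp
qed

text \<open>
  In the quadratic form of \<open>cov_mat B\<close> the vector \<open>v = (p, r)\<close> enters through \<open>P = |p|^2\<close>,
  \<open>R = |r|^2\<close>, \<open>W = |B\<^sup>T r|^2\<close> and \<open>X = p \<bullet> B\<^sup>T r\<close>; \<open>P + 2 t X + t^2 W\<close> is \<open>|p + t B\<^sup>T r|^2\<close>.
\<close>

lemma cov_mat_loewner:
  assumes op: "\<And>v. (\<Sum>i<m. (\<Sum>j=m..<d. B j i * v j)\<^sup>2) \<le> \<beta>\<^sup>2 * (\<Sum>j=m..<d. (v j)\<^sup>2)"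
    and lo: "\<And>P X W R. 0 \<le> P \<Longrightarrow> 0 \<le> W \<Longrightarrow> 0 \<le> R \<Longrightarrow> W \<le> \<beta>\<^sup>2 * R \<Longrightarrow> (\<And>t. 0 \<le> P + 2 * t * X + t\<^sup>2 * W)
      \<Longrightarrow> P + R \<le> a\<^sup>2 * (P + 2 * X + W) + b\<^sup>2 * R"
    and hi: "\<And>P X W R. 0 \<le> P \<Longrightarrow> 0 \<le> W \<Longrightarrow> 0 \<le> R \<Longrightarrow> W \<le> \<beta>\<^sup>2 * R \<Longrightarrow> (\<And>t. 0 \<le> P + 2 * t * X + t\<^sup>2 * W)
      \<Longrightarrow> a\<^sup>2 * (P + 2 * X + W) + b\<^sup>2 * R \<le> \<kappa> * (P + R)"
  shows "loewner_le d (1\<^sub>m d) (cov_mat B) \<and> loewner_le d (cov_mat B) (\<kappa> \<cdot>\<^sub>m 1\<^sub>m d)"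
proof -
  have main: "scalar_prod v v \<le> scalar_prod v (cov_mat B *\<^sub>v v) \<and> scalar_prod v (cov_mat B *\<^sub>v v) \<le> \<kappa> * scalar_prod v v"
    if v: "v \<in> carrier_vec d" for v
  proof -
    let ?w = "\<lambda>i. \<Sum>j=m..<d. B j i * v $ j"
    let ?P = "\<Sum>i<m. (v $ i)\<^sup>2" and ?R = "\<Sum>j=m..<d. (v $ j)\<^sup>2"
    let ?X = "\<Sum>i<m. v $ i * ?w i" and ?W = "\<Sum>i<m. (?w i)\<^sup>2"
    have split: "(\<Sum>i<d. f i) = (\<Sum>i<m. f i) + (\<Sum>j=m..<d. f j)" for f :: "nat \<Rightarrow> real"
    proof -
      have "{..<d} = {..<m} \<union> {m..<d}" using md by auto
      then show ?thesis by (simp add: sum.union_disjoint ivl_disj_int)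
    qed
    have expand: "(\<Sum>i<m. (f i + t * g i)\<^sup>2) = (\<Sum>i<m. (f i)\<^sup>2) + 2 * t * (\<Sum>i<m. f i * g i) + t\<^sup>2 * (\<Sum>i<m. (g i)\<^sup>2)"
      for f g :: "nat \<Rightarrow> real" and t
      by (simp add: power2_sum power_mult_distrib sum.distrib sum_distrib_left algebra_simps)
    have vv: "scalar_prod v v = ?P + ?R"
      using v split[of "\<lambda>i. (v $ i)\<^sup>2"] by (simp add: scalar_prod_def power2_eq_square atLeast0LessThan)
    have LT: "((chol B)\<^sup>T *\<^sub>v v) $ i = (if i < m then a * (v $ i + ?w i) else b * v $ i)" if i: "i < d" for i
    proof -
      have "((chol B)\<^sup>T *\<^sub>v v) $ i = (\<Sum>k<d. chol B $$ (k, i) * v $ k)"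
        using i v by (simp add: scalar_prod_def atLeast0LessThan chol_def)
      also have "\<dots> = (\<Sum>k<m. chol B $$ (k, i) * v $ k) + (\<Sum>k=m..<d. chol B $$ (k, i) * v $ k)"
        by (rule split)
      also have "(\<Sum>k<m. chol B $$ (k, i) * v $ k) = (\<Sum>k<m. if k = i then a * v $ i else 0)"
        using i md by (intro sum.cong) (auto simp: chol_def)
      also have "\<dots> = (if i < m then a * v $ i else 0)" by simp
      also have "(\<Sum>k=m..<d. chol B $$ (k, i) * v $ k) = (\<Sum>k=m..<d. if i < m then a * (B k i * v $ k) else if k = i then b * v $ i else 0)"
        using i md by (intro sum.cong) (auto simp: chol_def)
      also have "\<dots> = (if i < m then a * ?w i else b * v $ i)"
        using i by (auto simp: sum_distrib_left)
      finally show ?thesis by (simp add: algebra_simps)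
    qed
    have "scalar_prod v (cov_mat B *\<^sub>v v) = (\<Sum>i<d. (((chol B)\<^sup>T *\<^sub>v v) $ i)\<^sup>2)"
      unfolding cov_mat_def using scalar_prod_transpose_mult[of "(chol B)\<^sup>T" d v] v by simp
    also have "\<dots> = (\<Sum>i<d. (if i < m then a * (v $ i + ?w i) else b * v $ i)\<^sup>2)"
      using LT by (intro sum.cong) auto
    also have "\<dots> = (\<Sum>i<m. (a * (v $ i + ?w i))\<^sup>2) + (\<Sum>j=m..<d. (b * v $ j)\<^sup>2)"
      unfolding split by (intro arg_cong2[of _ _ _ _ "(+)"] sum.cong) auto
    also have "(\<Sum>j=m..<d. (b * v $ j)\<^sup>2) = b\<^sup>2 * ?R"
      by (simp add: power_mult_distrib sum_distrib_left)
    also have "(\<Sum>i<m. (a * (v $ i + ?w i))\<^sup>2) = a\<^sup>2 * (?P + 2 * ?X + ?W)"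
      using expand[of "\<lambda>i. v $ i" 1 ?w] by (simp add: power_mult_distrib sum_distrib_left[symmetric])
    finally have cv: "scalar_prod v (cov_mat B *\<^sub>v v) = a\<^sup>2 * (?P + 2 * ?X + ?W) + b\<^sup>2 * ?R" .
    \<comment> \<open>The family of inequalities over all \<open>t\<close> carries Cauchy--Schwarz
      for \<open>?X\<close>; \<open>lo\<close> and \<open>hi\<close> pick the values of
      \<open>t\<close> that suit them.\<close>
    have t: "0 \<le> ?P + 2 * t * ?X + t\<^sup>2 * ?W" for t
    proof -
      have "0 \<le> (\<Sum>i<m. (v $ i + t * ?w i)\<^sup>2)" by (intro sum_nonneg) auto
      also have "\<dots> = ?P + 2 * t * ?X + t\<^sup>2 * ?W"
        by (rule expand)
      finally show ?thesis .
    qed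
    have nn: "0 \<le> ?P" "0 \<le> ?W" "0 \<le> ?R" by (intro sum_nonneg; simp)+
    show ?thesis
      unfolding cv vv using lo[OF nn op t] hi[OF nn op t] by blast
  qed
  have "loewner_le d (1 \<cdot>\<^sub>m 1\<^sub>m d) (cov_mat B)"
    by (rule loewner_scalar_le) (use main cov_mat_symmetric in auto)
  moreover have "(1 :: real) \<cdot>\<^sub>m 1\<^sub>m d = 1\<^sub>m d" by (rule eq_matI) auto
  moreover have "loewner_le d (cov_mat B) (\<kappa> \<cdot>\<^sub>m 1\<^sub>m d)"
    by (rule loewner_le_scalar) (use main cov_mat_symmetric in auto)
  ultimately show ?thesis by simp
qed

end

section \<open>The packing bound\<close>

text \<open>A set outside the \<sigma>-algebra has \<open>measure\<close> 0 by convention, so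
  positive probability proves measurability. The lemma is applied to sets of accurate outputs, whose
  probability is at least 9/10.\<close>

lemma accurate_outputs_measurable:
  assumes est: "estimator n d M" and P: "prob_space (gaussian d A)"
    and acc: "0 < measure (output_dist n d M A) G"
  shows "G \<in> sets (mat_borel d)"
proof -
  interpret P: prob_space "gaussian d A" by (rule P)
  interpret Pn: product_prob_space "\<lambda>_. gaussian d A" "{..<n}" by unfold_locales
  have "sets (PiM {..<n} (\<lambda>_. gaussian d A)) = sets (dataset_space n d)"
    unfolding dataset_space_def by (rule sets_PiM_cong) (auto simp: gaussian_def)
  then have M: "M \<in> PiM {..<n} (\<lambda>_. gaussian d A) \<rightarrow>\<^sub>M subprob_algebra (mat_borel d)"
    using measurable_prob_algebraD[OF est[unfolded estimator_def]] measurable_cong_sets by blast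
  have "sets (output_dist n d M A) = sets (mat_borel d)"
    unfolding output_dist_def
    by (rule sets_bind) (use sets_kernel[OF M] Pn.not_empty in auto)
  then show ?thesis
    using acc measure_notin_sets[of G "output_dist n d M A"] by force
qed

lemma exp_minus_one_le:
  fixes \<epsilon> :: real
  assumes "0 \<le> \<epsilon>" "\<epsilon> \<le> 1"
  shows "exp \<epsilon> - 1 \<le> 2 * \<epsilon>"
proof -
  have "exp \<epsilon> \<le> 1 + \<epsilon> + \<epsilon>\<^sup>2" by (rule exp_bound) (use assms in auto)
  moreover have "\<epsilon>\<^sup>2 \<le> \<epsilon>" using mult_left_mono[OF assms(2,1)] by (simp add: power2_eq_square)
  ultimately show ?thesis by linarith
qed

context gauss_block
begin

text \<open>A common accurate output would put two models at a distance below 2 \<delta>, so the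
  sets of accurate outputs are disjoint. The factor of \<open>dp_packing\<close> is at most exp (2 D
  \<epsilon>) per sample.\<close>

lemma packing_bound:
  fixes B :: "'z \<Rightarrow> nat \<Rightarrow> nat \<Rightarrow> real"
  assumes est: "estimator n d M" and dp: "pure_dp \<epsilon> n d M" and \<epsilon>: "0 \<le> \<epsilon>" "\<epsilon> \<le> 1"
    and acc: "accurate_estimator n d M \<kappa> \<delta>" and C: "finite C" "C \<noteq> {}" and D: "0 \<le> D"
    and cls: "\<And>z. z \<in> C \<Longrightarrow> loewner_le d (1\<^sub>m d) (cov_mat (B z)) \<and> loewner_le d (cov_mat (B z)) (\<kappa> \<cdot>\<^sub>m 1\<^sub>m d)"
    and sep: "\<And>y z. y \<in> C \<Longrightarrow> z \<in> C \<Longrightarrow> y \<noteq> z \<Longrightarrow> 2 * \<delta> \<le> tv_dist (model (B y)) (model (B z))"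
    and L1: "\<And>z. z \<in> C \<Longrightarrow> (\<integral>x. \<bar>ratio (B z) x - 1\<bar> \<partial>base) \<le> D"
  shows "ln (9 / 10 * real (card C)) \<le> 2 * real n * D * \<epsilon>"
proof -
  let ?G = "\<lambda>z. accurate_outputs d (cov_mat (B z)) \<delta>"
  have ac: "9 / 10 \<le> measure (output_dist n d M (cov_mat (B z))) (?G z)" if "z \<in> C" for z
    using acc cls[OF that] unfolding accurate_estimator_def by auto
  have Gm: "?G z \<in> sets (mat_borel d)" if "z \<in> C" for z
    by (rule accurate_outputs_measurable[OF est, of "cov_mat (B z)"]) (use ac[OF that] prob_space_model gaussian_cov_mat in auto)
  have disj: "disjoint_family_on ?G C"
  proof (unfold disjoint_family_on_def, intro ballI impI, rule ccontr)
    fix y z assume y: "y \<in> C" and z: "z \<in> C" and yz: "y \<noteq> z" and "?G y \<inter> ?G z \<noteq> {}"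
    then obtain X where "pd_mat d X" and 1: "tv_dist (gaussian d (cov_mat (B y))) (gaussian d X) < \<delta>"
      and 2: "tv_dist (gaussian d (cov_mat (B z))) (gaussian d X) < \<delta>"
      by (auto simp: accurate_outputs_def)
    have fin: "finite_measure (model E)" for E
      using prob_space_model prob_space.finite_measure by blast
    have "tv_dist (model (B y)) (model (B z)) < 2 * \<delta>"
      by (rule tv_dist_triangle[OF fin finite_measure_gaussian[OF \<open>pd_mat d X\<close>] fin])
         (use 1 2 in \<open>simp_all add: gaussian_cov_mat\<close>)
    then show False using sep[OF y z yz] by simp
  qed
  have "9 / 10 * real (card C) \<le> (1 + D * (exp \<epsilon> - 1)) ^ n"
  proof (rule dp_packing[OF est dp \<epsilon>(1) prob_space_base _ C(1) D, where r = "\<lambda>z. ratio (B z)" and A = "\<lambda>z. cov_mat (B z)" and G = ?G])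
    show "sets base = sets (lebesgue_vec d)"
      unfolding sets_base lebesgue_vec_def by (rule sets_PiM_cong) auto
    show "gaussian d (cov_mat (B z)) = density base (\<lambda>x. ennreal (ratio (B z) x))" for z
      by (simp add: gaussian_cov_mat model_def)
  qed (use Gm disj ac L1 ratio_pos[THEN less_imp_le] prob_space_model gaussian_cov_mat in auto)
  also have "\<dots> \<le> exp (D * (2 * \<epsilon>)) ^ n"
  proof (rule power_mono)
    have "D * (exp \<epsilon> - 1) \<le> D * (2 * \<epsilon>)" by (intro mult_left_mono exp_minus_one_le \<epsilon> D)
    then show "1 + D * (exp \<epsilon> - 1) \<le> exp (D * (2 * \<epsilon>))"
      using exp_ge_add_one_self[of "D * (2 * \<epsilon>)"] by linarith
    show "0 \<le> 1 + D * (exp \<epsilon> - 1)" using D \<epsilon> by simp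
  qed
  also have "\<dots> = exp (2 * real n * D * \<epsilon>)" by (simp add: exp_of_nat_mult[symmetric] mult_ac)
  finally have "9 / 10 * real (card C) \<le> exp (2 * real n * D * \<epsilon>)" .
  moreover have "0 < 9 / 10 * real (card C)" using C by (simp add: card_gt_0_iff)
  ultimately show ?thesis by (metis exp_gt_zero ln_exp ln_le_cancel_iff)
qed

text \<open>|B^T v|^2 is the form of the Gram matrix B B^T at \<open>v\<close>, and Cauchy--Schwarz
  over pairs bounds it by the Frobenius norm of B B^T. For typical matrices this is far below the
  squared Frobenius norm of \<open>B\<close>, which leaves room for many levels.\<close>

lemma operator_norm_le_gram:
  fixes v :: "nat \<Rightarrow> real"
  assumes "(\<Sum>j=m..<d. \<Sum>k=m..<d. (\<Sum>i<m. B j i * B k i)\<^sup>2) \<le> \<beta> ^ 4"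
  shows "(\<Sum>i<m. (\<Sum>j=m..<d. B j i * v j)\<^sup>2) \<le> \<beta>\<^sup>2 * (\<Sum>j=m..<d. (v j)\<^sup>2)"
proof -
  let ?I = "{m..<d} \<times> {m..<d}"
  let ?g = "\<lambda>(j, k). \<Sum>i<m. B j i * B k i"
  have "(\<Sum>i<m. (\<Sum>j=m..<d. B j i * v j)\<^sup>2) = (\<Sum>i<m. \<Sum>j=m..<d. \<Sum>k=m..<d. B j i * v j * (B k i * v k))"
    by (simp add: power2_eq_square sum_product)
  also have "\<dots> = (\<Sum>j=m..<d. \<Sum>k=m..<d. \<Sum>i<m. B j i * v j * (B k i * v k))"
    by (rule trans[OF sum.swap], rule sum.cong[OF refl], rule sum.swap)
  also have "\<dots> = (\<Sum>j=m..<d. \<Sum>k=m..<d. (\<Sum>i<m. B j i * B k i) * (v j * v k))"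
    by (simp add: sum_distrib_left mult_ac)
  also have "\<dots> = (\<Sum>p\<in>?I. ?g p * (v (fst p) * v (snd p)))"
    unfolding sum.cartesian_product by (simp add: case_prod_unfold)
  finally have eq: "(\<Sum>i<m. (\<Sum>j=m..<d. B j i * v j)\<^sup>2) = (\<Sum>p\<in>?I. ?g p * (v (fst p) * v (snd p)))" .
  have "(\<Sum>i<m. (\<Sum>j=m..<d. B j i * v j)\<^sup>2)\<^sup>2 \<le> (\<Sum>p\<in>?I. (?g p)\<^sup>2) * (\<Sum>p\<in>?I. (v (fst p) * v (snd p))\<^sup>2)"
    unfolding eq by (rule Cauchy_Schwarz_ineq_sum)
  also have "(\<Sum>p\<in>?I. (?g p)\<^sup>2) = (\<Sum>j=m..<d. \<Sum>k=m..<d. (\<Sum>i<m. B j i * B k i)\<^sup>2)"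
    by (simp add: sum.cartesian_product case_prod_unfold)
  also have "(\<Sum>p\<in>?I. (v (fst p) * v (snd p))\<^sup>2) = (\<Sum>j=m..<d. (v j)\<^sup>2)\<^sup>2"
    by (simp add: power2_eq_square sum_product sum.cartesian_product case_prod_unfold mult_ac)
  also have "(\<Sum>j=m..<d. \<Sum>k=m..<d. (\<Sum>i<m. B j i * B k i)\<^sup>2) * (\<Sum>j=m..<d. (v j)\<^sup>2)\<^sup>2 \<le> \<beta> ^ 4 * (\<Sum>j=m..<d. (v j)\<^sup>2)\<^sup>2"
    using assms by (rule mult_right_mono) simp
  also have "\<dots> = (\<beta>\<^sup>2 * (\<Sum>j=m..<d. (v j)\<^sup>2))\<^sup>2" by (simp add: power_mult_distrib)
  finally show ?thesis
    by (rule power2_le_imp_le) (auto intro!: mult_nonneg_nonneg sum_nonneg)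
qed

lemma operator_norm_le_frob:
  fixes v :: "nat \<Rightarrow> real"
  assumes "frob B \<le> \<beta>\<^sup>2"
  shows "(\<Sum>i<m. (\<Sum>j=m..<d. B j i * v j)\<^sup>2) \<le> \<beta>\<^sup>2 * (\<Sum>j=m..<d. (v j)\<^sup>2)"
proof -
  have "(\<Sum>i<m. (\<Sum>j=m..<d. B j i * v j)\<^sup>2) \<le> (\<Sum>i<m. (\<Sum>j=m..<d. (B j i)\<^sup>2) * (\<Sum>j=m..<d. (v j)\<^sup>2))"
    by (intro sum_mono Cauchy_Schwarz_ineq_sum)
  also have "\<dots> = frob B * (\<Sum>j=m..<d. (v j)\<^sup>2)"
    unfolding frob_def by (subst sum.swap) (simp add: sum_distrib_right)
  also have "\<dots> \<le> \<beta>\<^sup>2 * (\<Sum>j=m..<d. (v j)\<^sup>2)"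
    using assms by (intro mult_right_mono sum_nonneg) auto
  finally show ?thesis .
qed

lemma frob_le:
  assumes "\<And>j i. m \<le> j \<Longrightarrow> j < d \<Longrightarrow> i < m \<Longrightarrow> \<bar>B j i\<bar> \<le> c / real d" and d: "0 < d" and c: "0 \<le> c"
  shows "frob B \<le> c\<^sup>2"
proof -
  have "frob B \<le> (\<Sum>j=m..<d. \<Sum>i<m. (c / real d)\<^sup>2)"
    unfolding frob_def using assms(1) c
    by (intro sum_mono) (auto simp: abs_le_square_iff[symmetric])
  also have "\<dots> = real ((d - m) * m) * (c / real d)\<^sup>2" by simp
  also have "\<dots> \<le> real (d * d) * (c / real d)\<^sup>2"
    using md by (intro mult_right_mono of_nat_mono mult_mono) auto
  also have "\<dots> = c\<^sup>2" using d by (simp add: power2_eq_square)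
  finally show ?thesis .
qed

text \<open>The frame of all three packings. \<open>cls\<close> may use a bound on the entries or
  the Gram bound of the code. At least d^2/8 entries are free, and two code words differ in at least
  a quarter of them, by \<open>h\<close> or more, so their Frobenius distance is at least h d / sqrt
  32 \<ge> h d / 6.\<close>

lemma code_bound:
  fixes L n :: nat and h \<epsilon> \<delta> \<kappa> D :: real
  defines "B \<equiv> \<lambda>(z :: nat \<times> nat \<Rightarrow> int) j i. h * real_of_int (z (j, i))"
  assumes est: "estimator n d M" and dp: "pure_dp \<epsilon> n d M" and \<epsilon>: "0 \<le> \<epsilon>" "\<epsilon> \<le> 1"
    and acc: "accurate_estimator n d M \<kappa> \<delta>" and d: "2 \<le> d" and m: "m = d div 2" and L: "12 \<le> L"
    and h: "0 < h" and D: "0 \<le> D"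
    and cls: "\<And>z. (\<And>j i. m \<le> j \<Longrightarrow> j < d \<Longrightarrow> i < m \<Longrightarrow> \<bar>B z j i\<bar> \<le> h * real L) \<Longrightarrow>
      (\<Sum>j=m..<d. \<Sum>k=m..<d. (\<Sum>i<m. B z j i * B z k i)\<^sup>2) \<le> 4 * real d ^ 3 * (h * real L) ^ 4 \<Longrightarrow>
      loewner_le d (1\<^sub>m d) (cov_mat (B z)) \<and> loewner_le d (cov_mat (B z)) (\<kappa> \<cdot>\<^sub>m 1\<^sub>m d) \<and>
      (\<integral>x. \<bar>ratio (B z) x - 1\<bar> \<partial>base) \<le> D"
    and sep: "2 * \<delta> \<le> min 1 (a / b * (h * real d / 6)) / 16"
  shows "(real d)\<^sup>2 * ln (real L) \<le> 64 * real n * D * \<epsilon>"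
proof -
  let ?U = "{..<m}" and ?V = "{m..<d}"
  have m1: "1 \<le> m" "m < d" using d m by auto
  have UV: "finite ?U" "card ?U \<le> d" "?U \<noteq> {}" "finite ?V" "card ?V \<le> d" "?V \<noteq> {}"
    using m1 by (auto simp: lessThan_empty_iff)
  obtain C where C: "finite C" "C \<subseteq> Pi\<^sub>E (?V \<times> ?U) (\<lambda>_. {- int L..int L})"
    and gram: "\<And>z. z \<in> C \<Longrightarrow> (\<Sum>j\<in>?V. \<Sum>k\<in>?V. (\<Sum>i\<in>?U. z (j, i) * z (k, i))\<^sup>2) \<le> 4 * int d ^ 3 * int L ^ 4"
    and ham: "\<And>x y. x \<in> C \<Longrightarrow> y \<in> C \<Longrightarrow> x \<noteq> y \<Longrightarrow> card ?V * card ?U \<le> 4 * card {p \<in> ?V \<times> ?U. x p \<noteq> y p}"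
    and card: "real (card ?V * card ?U) / 4 * ln (real L) \<le> ln (9 / 10 * real (card C))"
    and C0: "C \<noteq> {}"
    by (rule exists_matrix_code[OF UV L], rule that)
  have N: "(real d)\<^sup>2 \<le> 8 * real (card ?V * card ?U)"
  proof -
    have "d * d \<le> 8 * ((d - m) * m)"
    proof -
      \<comment> \<open>Sharp for \<open>d = 3\<close>, where the blocks have sizes 1 and 2.\<close>
      have "d \<le> 3 * m" using d m by presburger
      moreover have "d \<le> 2 * (d - m)" using m by presburger
      ultimately have "d * d \<le> (2 * (d - m)) * (3 * m)" by (intro mult_mono) auto
      then show ?thesis by linarith
    qed
    then have "real (d * d) \<le> real (8 * ((d - m) * m))" by (rule of_nat_mono)
    then show ?thesis by (simp add: power2_eq_square)
  qed
  have bounds: "loewner_le d (1\<^sub>m d) (cov_mat (B z)) \<and> loewner_le d (cov_mat (B z)) (\<kappa> \<cdot>\<^sub>m 1\<^sub>m d) \<and>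
      (\<integral>x. \<bar>ratio (B z) x - 1\<bar> \<partial>base) \<le> D" if z: "z \<in> C" for z
  proof (rule cls)
    fix j i assume "m \<le> j" "j < d" "i < m"
    then have "z (j, i) \<in> {- int L..int L}" using C(2) z by (auto simp: PiE_iff)
    then have "\<bar>real_of_int (z (j, i))\<bar> \<le> real L" by auto
    then show "\<bar>B z j i\<bar> \<le> h * real L" using h by (simp add: B_def abs_mult)
  next
    have "(\<Sum>j=m..<d. \<Sum>k=m..<d. (\<Sum>i<m. B z j i * B z k i)\<^sup>2)
        = h ^ 4 * real_of_int (\<Sum>j\<in>?V. \<Sum>k\<in>?V. (\<Sum>i\<in>?U. z (j, i) * z (k, i))\<^sup>2)"
    proof -
      have "(\<Sum>i<m. B z j i * B z k i)\<^sup>2 = h ^ 4 * (real_of_int (\<Sum>i\<in>?U. z (j, i) * z (k, i)))\<^sup>2" for j k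
      proof -
        have "(\<Sum>i<m. B z j i * B z k i) = h\<^sup>2 * real_of_int (\<Sum>i\<in>?U. z (j, i) * z (k, i))"
          by (simp add: B_def sum_distrib_left power2_eq_square mult_ac)
        then show ?thesis by (simp add: power_mult_distrib flip: power_mult)
      qed
      then show ?thesis by (simp add: sum_distrib_left)
    qed
    also have "\<dots> \<le> h ^ 4 * real_of_int (4 * int d ^ 3 * int L ^ 4)"
      by (intro mult_left_mono of_int_le_iff[THEN iffD2] gram z) simp
    also have "\<dots> = 4 * real d ^ 3 * (h * real L) ^ 4" by (simp add: power_mult_distrib)
    finally show "(\<Sum>j=m..<d. \<Sum>k=m..<d. (\<Sum>i<m. B z j i * B z k i)\<^sup>2) \<le> 4 * real d ^ 3 * (h * real L) ^ 4" .
  qed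
  have far: "2 * \<delta> \<le> tv_dist (model (B y)) (model (B z))" if y: "y \<in> C" and z: "z \<in> C" and yz: "y \<noteq> z" for y z
  proof -
    let ?F = "frob (\<lambda>j i. B y j i - B z j i)"
    let ?d = "{p \<in> ?V \<times> ?U. y p \<noteq> z p}"
    have F: "?F = (\<Sum>p\<in>?V \<times> ?U. h\<^sup>2 * (real_of_int (y p - z p))\<^sup>2)"
      by (simp add: frob_def sum.cartesian_product B_def power_mult_distrib[symmetric] algebra_simps case_prod_unfold)
    have "h\<^sup>2 * real (card ?d) = (\<Sum>p\<in>?d. h\<^sup>2 * 1)" by simp
    also have "\<dots> \<le> (\<Sum>p\<in>?d. h\<^sup>2 * (real_of_int (y p - z p))\<^sup>2)"
    proof (intro sum_mono mult_left_mono)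
      fix p assume "p \<in> ?d"
      then have "0 < (y p - z p)\<^sup>2" by simp
      then have "1 \<le> (y p - z p)\<^sup>2" by linarith
      then show "1 \<le> (real_of_int (y p - z p))\<^sup>2" by (metis of_int_1_le_iff of_int_power)
    qed simp
    also have "\<dots> \<le> ?F"
      unfolding F by (intro sum_mono2) auto
    finally have F1: "h\<^sup>2 * real (card ?d) \<le> ?F" .
    have "real (card ?V * card ?U) \<le> 4 * real (card ?d)"
      using of_nat_mono[OF ham[OF y z yz], where 'a = real] by simp
    then have "(real d)\<^sup>2 \<le> 36 * real (card ?d)" using N by linarith
    then have "(h * real d / 6)\<^sup>2 \<le> h\<^sup>2 * real (card ?d)"
      using h by (simp add: power_mult_distrib power_divide)
    then have "h * real d / 6 \<le> sqrt ?F" using F1 by (intro real_le_rsqrt) linarith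
    then have "a / b * (h * real d / 6) \<le> a / b * sqrt ?F" using a b by (intro mult_left_mono) auto
    then have "min 1 (a / b * (h * real d / 6)) / 16 \<le> min 1 (a / b * sqrt ?F) / 16" by simp
    also have "\<dots> \<le> tv_dist (model (B y)) (model (B z))" by (rule tv_model_ge)
    finally show ?thesis using sep by linarith
  qed
  have "ln (9 / 10 * real (card C)) \<le> 2 * real n * D * \<epsilon>"
    by (rule packing_bound[OF est dp \<epsilon> acc C(1) C0 D _ far]) (use bounds in auto)
  then have "real (card ?V * card ?U) / 4 * ln (real L) \<le> 2 * real n * D * \<epsilon>" using card by linarith
  moreover have "(real d)\<^sup>2 * ln (real L) \<le> 8 * real (card ?V * card ?U) * ln (real L)"
    using N L by (intro mult_right_mono) auto
  ultimately show ?thesis by linarith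
qed

end

section \<open>The three packings\<close>

text \<open>The factor 1 + \<alpha>/2 is the middle of [1, 1 + \<alpha>]; the perturbation 2 X + W
  is at most \<beta> + \<beta>^2 relative to P + R, small enough to stay inside on both
  sides.\<close>

lemma near_identity_bounds:
  fixes \<alpha> \<beta> \<kappa> P X W R :: real
  assumes \<alpha>: "0 < \<alpha>" "\<alpha> < 1" and \<beta>: "\<beta> = \<alpha> / 6" and \<kappa>: "1 + \<alpha> \<le> \<kappa>"
    and PR: "0 \<le> P" "0 \<le> W" "0 \<le> R" "W \<le> \<beta>\<^sup>2 * R" and t: "\<And>t. 0 \<le> P + 2 * t * X + t\<^sup>2 * W"
  shows "P + R \<le> (1 + \<alpha> / 2) * (P + 2 * X + W) + (1 + \<alpha> / 2) * R"
    and "(1 + \<alpha> / 2) * (P + 2 * X + W) + (1 + \<alpha> / 2) * R \<le> \<kappa> * (P + R)"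
proof -
  have b: "0 < \<beta>" using \<alpha> \<beta> by simp
  have WR: "W / \<beta> \<le> \<beta> * R" using PR(4) b by (simp add: field_simps power2_eq_square)
  \<comment> \<open>The values t = 1/\<beta> and t = -1/\<beta>, weighted by \<beta>, give |2 X|
    \<le> \<beta> P + W/\<beta> \<le> \<beta> (P + R).\<close>
  have "0 \<le> \<beta> * (P + 2 * (1 / \<beta>) * X + (1 / \<beta>)\<^sup>2 * W)" "0 \<le> \<beta> * (P + 2 * (- 1 / \<beta>) * X + (- 1 / \<beta>)\<^sup>2 * W)"
    by (intro mult_nonneg_nonneg less_imp_le[OF b] t)+
  moreover have "\<beta> * (P + 2 * (1 / \<beta>) * X + (1 / \<beta>)\<^sup>2 * W) = \<beta> * P + 2 * X + W / \<beta>"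
    "\<beta> * (P + 2 * (- 1 / \<beta>) * X + (- 1 / \<beta>)\<^sup>2 * W) = \<beta> * P - 2 * X + W / \<beta>"
    using b by (simp_all add: field_simps power2_eq_square)
  ultimately have "0 \<le> \<beta> * P + 2 * X + W / \<beta>" "0 \<le> \<beta> * P - 2 * X + W / \<beta>" by simp_all
  then have X: "- (\<beta> * (P + R)) \<le> 2 * X" "2 * X \<le> \<beta> * (P + R)"
    using WR by (simp_all add: algebra_simps)
  let ?S = "P + R"
  have S: "0 \<le> ?S" using PR by simp
  have a2: "\<alpha> * \<alpha> \<le> \<alpha> * 4" "\<alpha>\<^sup>2 \<le> \<alpha>" "\<alpha> ^ 3 \<le> \<alpha>" "0 \<le> \<alpha>\<^sup>2"
    using \<alpha> mult_mono[of \<alpha> \<alpha> \<alpha> 4] power_decreasing[of 1 2 \<alpha>] power_decreasing[of 1 3 \<alpha>] by auto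
  \<comment> \<open>(1 + \<alpha>/2)(1 - \<alpha>/6) = 1 + \<alpha>/3 - \<alpha>^2/12, and
    \<alpha>^2 \<le> 4 \<alpha>.\<close>
  have "1 * ?S \<le> ((1 + \<alpha> / 2) * (1 - \<beta>)) * ?S"
    using a2 S by (intro mult_right_mono) (simp_all add: \<beta> field_simps power2_eq_square)
  also have "\<dots> = (1 + \<alpha> / 2) * (?S - \<beta> * ?S)"
    by (simp only: mult.assoc left_diff_distrib mult_1_left)
  also have "\<dots> \<le> (1 + \<alpha> / 2) * (?S + (2 * X + W))"
    using X(1) PR \<alpha> by (intro mult_left_mono) auto
  finally show "P + R \<le> (1 + \<alpha> / 2) * (P + 2 * X + W) + (1 + \<alpha> / 2) * R"
    by (simp add: algebra_simps)
  have WS: "W \<le> \<beta>\<^sup>2 * ?S"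
    using PR mult_left_mono[of R ?S "\<beta>\<^sup>2"] by simp
  have "(1 + \<alpha> / 2) * (?S + (2 * X + W)) \<le> (1 + \<alpha> / 2) * (?S + (\<beta> * ?S + \<beta>\<^sup>2 * ?S))"
    using X(2) WS \<alpha> by (intro mult_left_mono) auto
  also have "\<dots> = ((1 + \<alpha> / 2) * (1 + \<beta> + \<beta>\<^sup>2)) * ?S"
    by (simp only: mult.assoc distrib_right mult_1_left add.assoc)
  also have "\<dots> \<le> (1 + \<alpha>) * ?S"
  proof (rule mult_right_mono[OF _ S])
    have "(1 + \<alpha> / 2) * (1 + \<beta> + \<beta>\<^sup>2) = 1 + 2 / 3 * \<alpha> + 1 / 9 * \<alpha>\<^sup>2 + 1 / 72 * \<alpha> ^ 3"
      by (simp add: \<beta> field_simps power2_eq_square power3_eq_cube)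
    then show "(1 + \<alpha> / 2) * (1 + \<beta> + \<beta>\<^sup>2) \<le> 1 + \<alpha>" using a2 \<alpha> by linarith
  qed
  also have "\<dots> \<le> \<kappa> * ?S" using \<kappa> S by (rule mult_right_mono)
  finally show "(1 + \<alpha> / 2) * (P + 2 * X + W) + (1 + \<alpha> / 2) * R \<le> \<kappa> * (P + R)"
    by (simp add: algebra_simps)
qed

text \<open>Where p = - B^T r the first block contributes nothing, although P = W may reach R/4; a
  noise variance of 3/2 covers P + R there.\<close>

lemma ill_conditioned_bounds:
  fixes \<kappa> P X W R :: real
  assumes \<kappa>: "8 \<le> \<kappa>" and PR: "0 \<le> P" "0 \<le> W" "0 \<le> R" "W \<le> (1 / 2)\<^sup>2 * R"
    and t: "\<And>t. 0 \<le> P + 2 * t * X + t\<^sup>2 * W"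
  shows "P + R \<le> \<kappa> / 4 * (P + 2 * X + W) + 3 / 2 * R"
    and "\<kappa> / 4 * (P + 2 * X + W) + 3 / 2 * R \<le> \<kappa> * (P + R)"
proof -
  have W: "4 * W \<le> R" using PR(4) by (simp add: power2_eq_square)
  \<comment> \<open>t = 1 allows the factor \<kappa>/4 to be lowered to 2, t = 2 then gives the
    lower bound, and t = -1 gives P + 2 X + W \<le> 2 P + 2 W for the upper one.\<close>
  have 1: "0 \<le> P + 2 * X + W" "0 \<le> P + 4 * X + 4 * W" "0 \<le> P - 2 * X + W"
    using t[of 1] t[of 2] t[of "-1"] by simp_all
  have "2 * (P + 2 * X + W) \<le> \<kappa> / 4 * (P + 2 * X + W)"
    using \<kappa> 1(1) by (intro mult_right_mono) auto
  moreover define Y where "Y = \<kappa> / 4 * (P + 2 * X + W)"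
  ultimately have "2 * (P + 2 * X + W) \<le> Y" by simp
  then have "2 * P + 2 * R \<le> 2 * Y + 3 * R" using 1(2) W by (simp add: algebra_simps)
  then have "P + R \<le> Y + 3 / 2 * R" by simp
  then show "P + R \<le> \<kappa> / 4 * (P + 2 * X + W) + 3 / 2 * R" by (simp only: Y_def)
  have "\<kappa> / 4 * (P + 2 * X + W) \<le> \<kappa> / 4 * (2 * P + R / 2)"
    using 1(3) W \<kappa> by (intro mult_left_mono) auto
  also have "\<dots> = \<kappa> * P / 2 + \<kappa> * R / 8" by (simp add: field_simps)
  finally have 2: "\<kappa> / 4 * (P + 2 * X + W) \<le> \<kappa> * P / 2 + \<kappa> * R / 8" .
  have "0 \<le> \<kappa> * P" "8 * R \<le> \<kappa> * R" using \<kappa> PR by (auto intro: mult_right_mono)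
  then show "\<kappa> / 4 * (P + 2 * X + W) + 3 / 2 * R \<le> \<kappa> * (P + R)"
    using 2 PR by (simp add: algebra_simps)
qed

lemma ln_12_ge: "1 \<le> ln (12 :: real)"
  using e_less_272 by (subst ln_ge_iff) auto

text \<open>The summand 12 is the least \<open>L\<close> that \<open>exists_matrix_code\<close>
  admits. With the fourth root, \<open>ln L\<close> is still at least a quarter of
  \<open>ln x\<close>.\<close>

lemma root4_level:
  fixes x :: real
  assumes x: "1 \<le> x"
  obtains L :: nat where "12 \<le> L" "x powr (1 / 4) \<le> real L" "real L \<le> 13 * x powr (1 / 4)"
proof -
  let ?r = "x powr (1 / 4)"
  have r: "1 \<le> ?r" using x by (simp add: ge_one_powr_ge_zero)
  show ?thesis
  proof (rule that[of "12 + nat \<lfloor>?r\<rfloor>"])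
    show "?r \<le> real (12 + nat \<lfloor>?r\<rfloor>)" using r by linarith
    show "real (12 + nat \<lfloor>?r\<rfloor>) \<le> 13 * ?r" using r by linarith
  qed simp
qed

lemma ln_le_4_ln_level:
  fixes x :: real
  assumes x: "1 \<le> x" and L: "x powr (1 / 4) \<le> real L"
  shows "ln x \<le> 4 * ln (real L)"
proof -
  have "0 < x powr (1 / 4)" using x by simp
  moreover from this L have "0 < real L" by linarith
  ultimately have le: "ln (x powr (1 / 4)) \<le> ln (real L)" using L by (simp only: ln_le_cancel_iff)
  have "ln (x powr (1 / 4)) = ln x / 4" using x by (simp add: ln_powr)
  then have "ln x / 4 \<le> ln (real L)" using le by (simp only:)
  then show ?thesis by simp
qed

section \<open>The three lower bounds for the sample size and their sum\<close>

locale accurate_dp_estimator =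
  fixes \<epsilon> \<alpha> \<kappa> :: real and d n :: nat and M
  assumes \<epsilon>: "0 < \<epsilon>" "\<epsilon> < 1" and \<alpha>: "0 < \<alpha>" "\<alpha> < 1" and d: "2 \<le> d" and \<kappa>: "1 + \<alpha> \<le> \<kappa>"
    and est: "estimator n d M" and dp: "pure_dp \<epsilon> n d M"
    and acc: "accurate_estimator n d M \<kappa> (1 / 30000 * \<alpha>)"
begin

text \<open>With a fixed number of levels, the diameter of the packing and its separation are both
  of order \<alpha>. The small diameter gives \<open>D = \<alpha> / 6\<close>, and this is where the
  factor 1/\<alpha> comes from.\<close>

lemma sample_bound_accuracy: "(real d)\<^sup>2 \<le> 11 * real n * \<alpha> * \<epsilon>"
proof -
  let ?s = "sqrt (1 + \<alpha> / 2)"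
  have s: "0 < ?s" "?s\<^sup>2 = 1 + \<alpha> / 2" using \<alpha> by auto
  interpret gauss_block "d div 2" d ?s ?s
    by unfold_locales (use s in auto)
  have "(real d)\<^sup>2 * ln (real 12) \<le> 64 * real n * (\<alpha> / 6) * \<epsilon>"
  \<comment> \<open>12 levels of this spacing reach \<alpha>/(6 d), so the Frobenius norm is at most
    \<alpha>/6. The separation is \<alpha>/432, and \<alpha>/6912 after division by 16.\<close>
  proof (rule code_bound[OF est dp _ _ acc d refl, where h = "\<alpha> / (72 * real d)"])
    fix z :: "nat \<times> nat \<Rightarrow> int"
    let ?B = "\<lambda>j i. \<alpha> / (72 * real d) * real_of_int (z (j, i))"
    assume "\<And>j i. d div 2 \<le> j \<Longrightarrow> j < d \<Longrightarrow> i < d div 2 \<Longrightarrow> \<bar>?B j i\<bar> \<le> \<alpha> / (72 * real d) * real 12"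
    then have F: "frob ?B \<le> (\<alpha> / 6)\<^sup>2"
      using d \<alpha> by (intro frob_le) auto
    have "loewner_le d (1\<^sub>m d) (cov_mat ?B) \<and> loewner_le d (cov_mat ?B) (\<kappa> \<cdot>\<^sub>m 1\<^sub>m d)"
      by (rule cov_mat_loewner[OF operator_norm_le_frob[OF F]]; unfold s(2))
         (rule near_identity_bounds[OF \<alpha> refl \<kappa>]; assumption)+
    moreover have "(\<integral>x. \<bar>ratio ?B x - 1\<bar> \<partial>base) \<le> \<alpha> / 6"
      using integral_ratio_minus_one_le[of "\<alpha> / 6" ?B] F \<alpha> s by simp
    ultimately show "loewner_le d (1\<^sub>m d) (cov_mat ?B) \<and> loewner_le d (cov_mat ?B) (\<kappa> \<cdot>\<^sub>m 1\<^sub>m d) \<and>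
        (\<integral>x. \<bar>ratio ?B x - 1\<bar> \<partial>base) \<le> \<alpha> / 6" by blast
  next
    show "2 * (1 / 30000 * \<alpha>) \<le> min 1 (?s / ?s * (\<alpha> / (72 * real d) * real d / 6)) / 16"
      using d \<alpha> s by simp
  qed (use \<epsilon> \<alpha> d in auto)
  moreover have "(real d)\<^sup>2 * 1 \<le> (real d)\<^sup>2 * ln (real 12)"
    using ln_12_ge by (intro mult_left_mono) auto
  moreover have "0 \<le> real n * \<alpha> * \<epsilon>" using \<alpha> \<epsilon> by simp
  ultimately have "(real d)\<^sup>2 * 3 \<le> 32 * (real n * \<alpha> * \<epsilon>)" "0 \<le> real n * \<alpha> * \<epsilon>"
    by (simp_all add: mult_ac)
  moreover have "x \<le> 11 * y" if "x * 3 \<le> 32 * y" "0 \<le> y" for x y :: real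
    using that by linarith
  ultimately show ?thesis by (metis mult.assoc)
qed

text \<open>Membership in the class is decided by the operator norm rather than the Frobenius norm.
  Entries up to \<alpha>/(12 d^(3/4)) keep it at most \<alpha>/6 by the Gram bound, while a spacing
  of order \<alpha>/d already separates; in between there is room for about d^(1/4) levels.\<close>

lemma sample_bound_dimension: "(real d)\<^sup>2 * ln (real d) \<le> 512 * real n * \<epsilon>"
proof -
  let ?s = "sqrt (1 + \<alpha> / 2)"
  have s: "0 < ?s" "?s\<^sup>2 = 1 + \<alpha> / 2" using \<alpha> by auto
  interpret gauss_block "d div 2" d ?s ?s
    by unfold_locales (use s in auto)
  have d1: "1 \<le> real d" using d by simp
  define r where "r = real d powr (1 / 4)"
  have r: "1 \<le> r" using d1 by (simp add: r_def ge_one_powr_ge_zero)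
  have r4: "r ^ 4 = real d" using d1 by (simp add: r_def flip: powr_numeral powr_powr) (simp add: powr_powr)
  obtain L :: nat where L: "12 \<le> L" "r \<le> real L" "real L \<le> 13 * r"
    using root4_level[OF d1] unfolding r_def by blast
  \<comment> \<open>Chosen so that h L = \<alpha>/(12 r^3), whose fourth power cancels the d^3 of
    the Gram bound since r^4 = d.\<close>
  define h where "h = \<alpha> / (12 * r ^ 3 * real L)"
  have h: "0 < h" using \<alpha> r L by (simp add: h_def)
  have "(real d)\<^sup>2 * ln (real L) \<le> 64 * real n * 2 * \<epsilon>"
  proof (rule code_bound[OF est dp _ _ acc d refl L(1) h])
    fix z :: "nat \<times> nat \<Rightarrow> int"
    let ?B = "\<lambda>j i. h * real_of_int (z (j, i))"
    assume "(\<Sum>j=d div 2..<d. \<Sum>k=d div 2..<d. (\<Sum>i<d div 2. ?B j i * ?B k i)\<^sup>2) \<le> 4 * real d ^ 3 * (h * real L) ^ 4"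
    also have "4 * real d ^ 3 * (h * real L) ^ 4 = 4 * (\<alpha> / 12) ^ 4"
    proof -
      have "h * real L = \<alpha> / 12 / r ^ 3" using L by (simp add: h_def)
      then have "(h * real L) ^ 4 = (\<alpha> / 12) ^ 4 / (r ^ 4) ^ 3"
        by (simp add: power_divide flip: power_mult)
      then show ?thesis using d1 by (simp add: r4)
    qed
    also have "\<dots> \<le> (\<alpha> / 6) ^ 4" by (simp add: power_divide)
    finally have G: "(\<Sum>j=d div 2..<d. \<Sum>k=d div 2..<d. (\<Sum>i<d div 2. ?B j i * ?B k i)\<^sup>2) \<le> (\<alpha> / 6) ^ 4" .
    have "loewner_le d (1\<^sub>m d) (cov_mat ?B) \<and> loewner_le d (cov_mat ?B) (\<kappa> \<cdot>\<^sub>m 1\<^sub>m d)"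
      by (rule cov_mat_loewner[OF operator_norm_le_gram[OF G]]; unfold s(2))
         (rule near_identity_bounds[OF \<alpha> refl \<kappa>]; assumption)+
    then show "loewner_le d (1\<^sub>m d) (cov_mat ?B) \<and> loewner_le d (cov_mat ?B) (\<kappa> \<cdot>\<^sub>m 1\<^sub>m d) \<and>
        (\<integral>x. \<bar>ratio ?B x - 1\<bar> \<partial>base) \<le> 2"
      using integral_ratio_minus_one_le_2 by blast
  next
    have "\<alpha> / 156 \<le> h * real d"
    proof -
      have "h * real d = \<alpha> * r / (12 * real L)"
        using r L by (simp add: h_def r4[symmetric] power_eq_if[of r 4] field_simps eval_nat_numeral)
      also have "\<dots> \<ge> \<alpha> * r / (12 * (13 * r))"
        using L r \<alpha> by (intro divide_left_mono) auto
      finally show ?thesis using r by simp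
    qed
    \<comment> \<open>\<alpha>/(936 * 16) = \<alpha>/14976 lies just above 2 \<alpha>/30000: this
      packing fixes the accuracy constant.\<close>
    then have "\<alpha> / 936 \<le> ?s / ?s * (h * real d / 6)" using s by simp
    then show "2 * (1 / 30000 * \<alpha>) \<le> min 1 (?s / ?s * (h * real d / 6)) / 16"
      using \<alpha> by (simp add: min_def)
  qed (use \<epsilon> \<alpha> in auto)
  moreover have "(real d)\<^sup>2 * ln (real d) \<le> (real d)\<^sup>2 * (4 * ln (real L))"
    using ln_le_4_ln_level[OF d1] L(2) by (intro mult_left_mono) (auto simp: r_def)
  ultimately show ?thesis by simp
qed

text \<open>The ratio a/b grows like the square root of \<kappa>. Hence regression matrices of
  Frobenius norm at most 1/2 stay a constant distance apart although the number of levels grows with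
  \<kappa>.\<close>

lemma sample_bound_condition:
  assumes \<kappa>8: "8 \<le> \<kappa>"
  shows "(real d)\<^sup>2 * ln \<kappa> \<le> 512 * real n * \<epsilon>"
proof -
  let ?a = "sqrt (\<kappa> / 4)" and ?b = "sqrt (3 / 2)"
  have ab: "0 < ?a" "0 < ?b" "?a\<^sup>2 = \<kappa> / 4" "?b\<^sup>2 = 3 / 2" using \<kappa>8 by auto
  interpret gauss_block "d div 2" d ?a ?b
    by unfold_locales (use ab in auto)
  have k1: "1 \<le> \<kappa>" using \<kappa>8 by simp
  define r where "r = \<kappa> powr (1 / 4)"
  have r: "1 \<le> r" using k1 by (simp add: r_def ge_one_powr_ge_zero)
  have r2: "r\<^sup>2 = sqrt \<kappa>"
    using k1 by (simp add: r_def powr_half_sqrt[symmetric] flip: powr_numeral) (simp add: powr_powr)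
  obtain L :: nat where L: "12 \<le> L" "r \<le> real L" "real L \<le> 13 * r"
    using root4_level[OF k1] unfolding r_def by blast
  define h where "h = 1 / (2 * real L * real d)"
  have h: "0 < h" using d L by (simp add: h_def)
  have "(real d)\<^sup>2 * ln (real L) \<le> 64 * real n * 2 * \<epsilon>"
  proof (rule code_bound[OF est dp _ _ acc d refl L(1) h])
    fix z :: "nat \<times> nat \<Rightarrow> int"
    let ?B = "\<lambda>j i. h * real_of_int (z (j, i))"
    assume "\<And>j i. d div 2 \<le> j \<Longrightarrow> j < d \<Longrightarrow> i < d div 2 \<Longrightarrow> \<bar>?B j i\<bar> \<le> h * real L"
    moreover have "h * real L = 1 / 2 / real d" using L by (simp add: h_def)
    ultimately have F: "frob ?B \<le> (1 / 2)\<^sup>2"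
      using d by (intro frob_le) auto
    have "loewner_le d (1\<^sub>m d) (cov_mat ?B) \<and> loewner_le d (cov_mat ?B) (\<kappa> \<cdot>\<^sub>m 1\<^sub>m d)"
      by (rule cov_mat_loewner[OF operator_norm_le_frob[OF F]]; unfold ab(3,4))
         (rule ill_conditioned_bounds[OF \<kappa>8]; assumption)+
    then show "loewner_le d (1\<^sub>m d) (cov_mat ?B) \<and> loewner_le d (cov_mat ?B) (\<kappa> \<cdot>\<^sub>m 1\<^sub>m d) \<and>
        (\<integral>x. \<bar>ratio ?B x - 1\<bar> \<partial>base) \<le> 2"
      using integral_ratio_minus_one_le_2 by blast
  next
    have "1 / 26 \<le> h * real d * r"
    proof -
      have "1 / 26 = r / (2 * (13 * r))" using r by simp
      also have "\<dots> \<le> r / (2 * real L)" using L r by (intro divide_left_mono) auto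
      also have "\<dots> = h * real d * r" using d by (simp add: h_def)
      finally show ?thesis .
    qed
    \<comment> \<open>In fact a/b is at least r^2/3; the single power of \<open>r\<close> matches
      the number of levels, which is of order \<open>r\<close>.\<close>
    have "r / 3 \<le> ?a / ?b"
    proof -
      have "r * 1 \<le> r\<^sup>2" using r by (simp add: power2_eq_square)
      have "(r\<^sup>2 / 3)\<^sup>2 \<le> (?a / ?b)\<^sup>2" using k1 by (simp add: power_divide ab r2)
      then have "r\<^sup>2 / 3 \<le> ?a / ?b" by (rule power2_le_imp_le) (use ab in simp)
      then show ?thesis using \<open>r * 1 \<le> r\<^sup>2\<close> by linarith
    qed
    then have "r / 3 * (h * real d / 6) \<le> ?a / ?b * (h * real d / 6)"
      using h by (intro mult_right_mono) auto
    moreover have "1 / 468 \<le> r / 3 * (h * real d / 6)"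
      using \<open>1 / 26 \<le> h * real d * r\<close> by (simp add: mult_ac)
    ultimately have "1 / 468 \<le> ?a / ?b * (h * real d / 6)" by (rule order_trans[rotated])
    then have "1 / 468 \<le> min 1 (?a / ?b * (h * real d / 6))" by (simp only: min_def) simp
    moreover have "2 * (1 / 30000 * \<alpha>) \<le> w / 16" if "1 / 468 \<le> w" for w
      using that \<alpha> by simp
    ultimately show "2 * (1 / 30000 * \<alpha>) \<le> min 1 (?a / ?b * (h * real d / 6)) / 16" by blast
  qed (use \<epsilon> in auto)
  moreover have "(real d)\<^sup>2 * ln \<kappa> \<le> (real d)\<^sup>2 * (4 * ln (real L))"
    using ln_le_4_ln_level[OF k1] L(2) by (intro mult_left_mono) (auto simp: r_def)
  ultimately show ?thesis by simp
qed

text \<open>The logarithm splits into ln d, ln \<kappa> and ln (1/\<alpha>). The last is at most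
  1/\<alpha> and is absorbed by the second term of the bound, as is ln \<kappa> for \<kappa> < 8,
  where it is at most 7.\<close>

lemma sample_bound:
  "1 / 2000 * ((real d)\<^sup>2 / \<epsilon> * ln (real d * \<kappa> / \<alpha>) + (real d)\<^sup>2 / (\<epsilon> * \<alpha>)) \<le> real n"
proof -
  let ?T = "(real d)\<^sup>2 / (\<epsilon> * \<alpha>)"
  have T: "?T \<le> 11 * real n"
    using sample_bound_accuracy \<epsilon> \<alpha> by (simp add: divide_le_eq mult_ac)
  have small: "(real d)\<^sup>2 / \<epsilon> * x \<le> c * ?T" if "x \<le> c / \<alpha>" for x c
  proof -
    have "(real d)\<^sup>2 / \<epsilon> * x \<le> (real d)\<^sup>2 / \<epsilon> * (c / \<alpha>)"
      using that \<epsilon> by (intro mult_left_mono) auto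
    then show ?thesis by (simp add: mult_ac)
  qed
  have D: "(real d)\<^sup>2 / \<epsilon> * ln (real d) \<le> 512 * real n"
    using sample_bound_dimension \<epsilon> by (simp add: divide_le_eq mult_ac)
  have A: "(real d)\<^sup>2 / \<epsilon> * ln (1 / \<alpha>) \<le> 1 * ?T"
    using ln_le_minus_one[of "1 / \<alpha>"] \<alpha> by (intro small) auto
  have K: "(real d)\<^sup>2 / \<epsilon> * ln \<kappa> \<le> 512 * real n"
  proof (cases "8 \<le> \<kappa>")
    case True
    then show ?thesis using sample_bound_condition \<epsilon> by (simp add: divide_le_eq mult_ac)
  next
    case False
    have "ln \<kappa> \<le> 7" using ln_le_minus_one[of \<kappa>] False \<kappa> \<alpha> by linarith
    also have "7 \<le> 7 / \<alpha>" using \<alpha> by (simp add: le_divide_eq)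
    finally have "(real d)\<^sup>2 / \<epsilon> * ln \<kappa> \<le> 7 * ?T" by (rule small)
    then show ?thesis using T by simp
  qed
  have "ln (real d * \<kappa> / \<alpha>) = ln (real d) + ln \<kappa> + ln (1 / \<alpha>)"
    using d \<kappa> \<alpha> by (simp add: ln_mult ln_div)
  then have S: "(real d)\<^sup>2 / \<epsilon> * ln (real d * \<kappa> / \<alpha>)
      = (real d)\<^sup>2 / \<epsilon> * ln (real d) + (real d)\<^sup>2 / \<epsilon> * ln \<kappa> + (real d)\<^sup>2 / \<epsilon> * ln (1 / \<alpha>)"
    by (simp only: distrib_left)
  \<comment> \<open>The coefficients of \<open>k\<close> add up to 512 + 512 + 11 + 11.\<close>
  have "1 / 2000 * (x + t) \<le> k" if "x = p + q + r" "t \<le> 11 * k" "p \<le> 512 * k" "r \<le> 1 * t" "q \<le> 512 * k" "0 \<le> k"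
    for x p q r t k :: real
  proof -
    have "x + t \<le> 2000 * k" using that by linarith
    then show ?thesis by simp
  qed
  from this[OF S T D A K of_nat_0_le_iff] show ?thesis .
qed

end

theorem theorem7p1:
  shows "\<exists>c > 0. \<exists>C > 0. \<forall>(\<epsilon>::real) (\<alpha>::real) (\<kappa>::real) (d::nat) (n::nat) M.
    0 < \<epsilon> \<and> \<epsilon> < 1 \<and> 0 < \<alpha> \<and> \<alpha> < 1 \<and> 2 \<le> d \<and> 1 + \<alpha> \<le> \<kappa> \<longrightarrow>
    estimator n d M \<longrightarrow>
    pure_dp \<epsilon> n d M \<longrightarrow>
    accurate_estimator n d M \<kappa> (c * \<alpha>) \<longrightarrow>
    real n \<ge> C * ((real d)\<^sup>2 / \<epsilon> * ln (real d * \<kappa> / \<alpha>) + (real d)\<^sup>2 / (\<epsilon> * \<alpha>))"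
proof (rule exI[of _ "1 / 30000"], rule conjI, simp, rule exI[of _ "1 / 2000"], rule conjI, simp,
    intro allI impI, elim conjE)
  fix \<epsilon> \<alpha> \<kappa> :: real and d n :: nat and M
  assume "0 < \<epsilon>" "\<epsilon> < 1" "0 < \<alpha>" "\<alpha> < 1" "2 \<le> d" "1 + \<alpha> \<le> \<kappa>" "estimator n d M" "pure_dp \<epsilon> n d M"
    "accurate_estimator n d M \<kappa> (1 / 30000 * \<alpha>)"
  then interpret accurate_dp_estimator \<epsilon> \<alpha> \<kappa> d n M
    by unfold_locales
  show "real n \<ge> 1 / 2000 * ((real d)\<^sup>2 / \<epsilon> * ln (real d * \<kappa> / \<alpha>) + (real d)\<^sup>2 / (\<epsilon> * \<alpha>))"
    by (rule sample_bound)
qed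

end
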